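(* Let $n\ge 2$, $k\in\{1,\dots,n-1\}$, and work in parabolic space $\mathbb{R}^{n+1}$. The following statements hold. (A) Suppose $\nu$ is a $1$-regular measure on $(\mathbb{R},\sqrt{|\cdot|})$, i.e. $\nu((t-r^2,t+r^2))\approx r$ for every $t\in\operatorname{supp}(\nu)$ and $r>0$, and $L\subset\mathbb{R}^n$ is a $(k+1)$-plane. Then $\mu=\mathcal H^{k+1}|_L\times\nu$ is a $(k+2)$-regular measure for which all CZOs are bounded in $L^2(\mu)$. (B) Suppose $\nu$ is a measure on $(\mathbb{R},\sqrt{|\cdot|})$ satisfying $\nu((t-r^2,t+r^2))\approx\min(r,r^2)$ for every $t\in\operatorname{supp}(\nu)$ and $r>0$. Suppose $L$ is a $k$-plane in $\mathbb{R}^n$ and $e$ is a non-zero normal vector to $L$. Then $$\mu=\Big[\sum_{j\in\mathbb{Z}}\mathcal H^{k}|_{L+je}\Big]\times\nu$$ is a $(k+2)$-regular measure for which all CZOs are bounded in $L^2(\mu)$. (C) Suppose $k+2\le n$, $L$ is a $(k+2)$-plane in $\mathbb{R}^n$, and $\mu=\mathcal H^{k+2}|_L\times\delta_0$, where $\delta_0$ is the Dirac measure at $0$ on $\mathbb{R}$. Then $\mu$ is a $(k+2)$-regular measure for which all CZOs are bounded in $L^2(\mu)$.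
   Context: Points of parabolic space $\mathbb{R}^{n+1}$ are $\mathbf X=(X,t)$, $X\in\mathbb{R}^n$, $t\in\mathbb{R}$; $\|\mathbf X\|=(|X|^2+|t|)^{1/2}$, $B_r(\mathbf X)=\{\mathbf Y:\|\mathbf X-\mathbf Y\|<r\}$, and diameters are with respect to $\|\mathbf X-\mathbf Y\|$. "Measure" means locally finite Borel measure; $a\approx b$ means $A^{-1}b\le a\le Ab$ for a constant $A$ independent of $t$ and $r$. $\mu$ is $(k+2)$-regular (or $(k+2)$-ADR) if there is $C_0>0$ with $C_0^{-1}r^{k+2}\le\mu(B_r(\mathbf X))\le C_0r^{k+2}$ for all $\mathbf X\in\operatorname{supp}(\mu)$ and $r\in(0,\operatorname{diam}(\operatorname{supp}\mu))$. "CZO" means a $(k+2)$-dimensional spatially antisymmetric Calderón–Zygmund operator, associated with an admissible kernel: a smooth $K:\mathbb{R}^{n+1}\setminus\{\mathbf 0\}\to\mathbb{R}$ with $K(X,t)=-K(-X,t)$ for all $(X,t)\ne\mathbf 0$ and, for all integers $\ell,j\ge0$, $|\nabla_X^\ell\partial_t^jK(\mathbf X)|\le C_{\ell,j}\|\mathbf X\|^{-(k+2)-\ell-2j}$. It is bounded in $L^2(\mu)$ if, with $T_\epsilon f(\mathbf X)=\int_{\|\mathbf X-\mathbf Y\|>\epsilon}K(\mathbf X-\mathbf Y)f(\mathbf Y)\,d\mu(\mathbf Y)$, there is $C>0$ with $\int\sup_{\epsilon>0}|T_\epsilon f|^2\,d\mu\le C\|f\|^2_{L^2(\mu)}$ for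 all $f\in L^2(\mu)$. *)

theory Defs
  imports "HOL-Analysis.Analysis" "HOL-Probability.Giry_Monad"
begin

section \<open>Parabolic space\<close>

text \<open>
  Points of parabolic space are pairs \<open>(x, t)\<close> in \<open>(real^'n) \<times> real\<close>.  The library norm and
  distance of this product type are the Euclidean ones and are not used here; the parabolic norm
  induces the same topology, so that \<open>open\<close> and \<open>borel\<close> have the intended meaning.
\<close>

definition pnorm :: "(real^'n) \<times> real \<Rightarrow> real" where
  "pnorm X = sqrt ((norm (fst X))\<^sup>2 + \<bar>snd X\<bar>)"

definition pball :: "(real^'n) \<times> real \<Rightarrow> real \<Rightarrow> ((real^'n) \<times> real) set" where
  "pball X r = {Y. pnorm (X - Y) < r}"

definition pdiameter :: "((real^'n) \<times> real) set \<Rightarrow> ennreal" where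
  "pdiameter S = (SUP (X, Y)\<in>S \<times> S. ennreal (pnorm (X - Y)))"


section \<open>Measures\<close>

definition locally_finite_borel :: "'a::topological_space measure \<Rightarrow> bool" where
  "locally_finite_borel M \<longleftrightarrow>
     sets M = sets borel \<and> (\<forall>x. \<exists>U. open U \<and> x \<in> U \<and> emeasure M U < \<infinity>)"

definition msupport :: "'a::topological_space measure \<Rightarrow> 'a set" where
  "msupport M = {x. \<forall>U. open U \<and> x \<in> U \<longrightarrow> emeasure M U > 0}"

definition parabolic_regular :: "nat \<Rightarrow> ((real^'n) \<times> real) measure \<Rightarrow> bool" where
  "parabolic_regular m \<mu> \<longleftrightarrow> locally_finite_borel \<mu> \<and>
     (\<exists>C>0. \<forall>X\<in>msupport \<mu>. \<forall>r>0. ennreal r < pdiameter (msupport \<mu>) \<longrightarrow>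
        ennreal (r ^ m / C) \<le> emeasure \<mu> (pball X r) \<and>
        emeasure \<mu> (pball X r) \<le> ennreal (C * r ^ m))"

text \<open>
  The open interval below is the ball of radius \<open>r\<close> about \<open>t\<close> in the real line with the metric
  \<open>sqrt \<bar>s - t\<bar>\<close>.
\<close>

definition time_growth :: "(real \<Rightarrow> real) \<Rightarrow> real measure \<Rightarrow> bool" where
  "time_growth \<phi> \<nu> \<longleftrightarrow>
     (\<exists>A>0. \<forall>t\<in>msupport \<nu>. \<forall>r>0.
        ennreal (\<phi> r / A) \<le> emeasure \<nu> {t - r\<^sup>2<..<t + r\<^sup>2} \<and>
        emeasure \<nu> {t - r\<^sup>2<..<t + r\<^sup>2} \<le> ennreal (A * \<phi> r))"

text \<open>
  Hausdorff measure normalised so as to agree with Lebesgue measure on Euclidean spaces of dimension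
  \<open>m\<close>.  The library diameter of an unbounded set carries no information, whence the boundedness
  condition on the covering sets; empty covering sets contribute nothing also when \<open>m = 0\<close>.
\<close>

definition hausdorff_content :: "nat \<Rightarrow> 'a::metric_space set \<Rightarrow> ennreal" where
  "hausdorff_content m E =
     (if E = {} then 0 else ennreal (unit_ball_vol (real m) * (diameter E / 2) ^ m))"

definition hausdorff_outer :: "nat \<Rightarrow> 'a::metric_space set \<Rightarrow> ennreal" where
  "hausdorff_outer m E =
     (SUP \<delta>\<in>{0<..}.
        INF A\<in>{A :: nat \<Rightarrow> 'a set. E \<subseteq> (\<Union>i. A i) \<and> (\<forall>i. bounded (A i) \<and> diameter (A i) \<le> \<delta>)}.
          \<Sum>i. hausdorff_content m (A i))"

definition hausdorff_measure :: "nat \<Rightarrow> 'a::metric_space measure" where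
  "hausdorff_measure m = measure_of UNIV (sets borel) (hausdorff_outer m)"

definition hausdorff_on :: "nat \<Rightarrow> 'a::metric_space set \<Rightarrow> 'a measure" where
  "hausdorff_on m L = density (hausdorff_measure m) (indicator L)"

definition measure_sum :: "('i \<Rightarrow> 'a::topological_space measure) \<Rightarrow> 'a measure" where
  "measure_sum M = measure_of UNIV (sets borel) (\<lambda>A. \<integral>\<^sup>+ i. emeasure (M i) A \<partial>count_space UNIV)"


section \<open>Planes\<close>

definition is_plane :: "nat \<Rightarrow> 'a::euclidean_space set \<Rightarrow> bool" where
  "is_plane m L \<longleftrightarrow> affine L \<and> aff_dim L = int m"

definition normal_to :: "'a::euclidean_space \<Rightarrow> 'a set \<Rightarrow> bool" where
  "normal_to e L \<longleftrightarrow> (\<forall>x\<in>L. \<forall>y\<in>L. e \<bullet> (x - y) = 0)"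


section \<open>Calderon--Zygmund operators\<close>

definition dir_deriv ::
    "'a::real_normed_vector \<Rightarrow> ('a \<Rightarrow> 'b::real_normed_vector) \<Rightarrow> 'a \<Rightarrow> 'b" where
  "dir_deriv v F X = frechet_derivative F (at X) v"

definition smooth_on_open :: "'a::euclidean_space set \<Rightarrow> ('a \<Rightarrow> 'b::real_normed_vector) \<Rightarrow> bool" where
  "smooth_on_open S F \<longleftrightarrow>
     open S \<and> (\<forall>vs. set vs \<subseteq> Basis \<longrightarrow> (\<forall>X\<in>S. foldr dir_deriv vs F differentiable at X))"

text \<open>
  Euclidean norm of the tensor of all spatial partial derivatives of order \<open>l\<close> of the \<open>j\<close>-th time
  derivative of \<open>K\<close>; the tensor is indexed by lists of \<open>l\<close> coordinate directions.
\<close>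

definition deriv_norm :: "nat \<Rightarrow> nat \<Rightarrow> ((real^'n) \<times> real \<Rightarrow> real) \<Rightarrow> (real^'n) \<times> real \<Rightarrow> real" where
  "deriv_norm l j K X =
     sqrt (\<Sum>vs\<in>{vs :: (real^'n) list. set vs \<subseteq> Basis \<and> length vs = l}.
       (foldr dir_deriv (map (\<lambda>v. (v, 0)) vs @ replicate j (0, 1)) K X)\<^sup>2)"

text \<open>
  The kernels live on the punctured space; the value of the total function \<open>K\<close> at the origin is
  irrelevant.
\<close>

definition admissible_kernel :: "nat \<Rightarrow> ((real^'n) \<times> real \<Rightarrow> real) \<Rightarrow> bool" where
  "admissible_kernel m K \<longleftrightarrow>
     smooth_on_open (- {0}) K \<and>
     (\<forall>x t. (x, t) \<noteq> 0 \<longrightarrow> K (x, t) = - K (- x, t)) \<and>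
     (\<forall>l j. \<exists>C. \<forall>X. X \<noteq> 0 \<longrightarrow> deriv_norm l j K X \<le> C / pnorm X ^ (m + l + 2 * j))"

text \<open>
  If \<open>\<mu>\<close> is \<open>m\<close>-regular with support of infinite diameter, \<open>K\<close> is admissible of dimension \<open>m\<close> and \<open>f\<close>
  is square integrable, the integrand below is integrable, so that the library convention for
  integrals of non-integrable functions plays no role.
\<close>

definition trunc_op ::
    "((real^'n) \<times> real \<Rightarrow> real) \<Rightarrow> ((real^'n) \<times> real) measure \<Rightarrow> real \<Rightarrow>
     ((real^'n) \<times> real \<Rightarrow> real) \<Rightarrow> (real^'n) \<times> real \<Rightarrow> real" where
  "trunc_op K \<mu> \<epsilon> f X = (LINT Y:{Y. pnorm (X - Y) > \<epsilon>}|\<mu>. K (X - Y) * f Y)"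

definition CZO_L2_bounded ::
    "((real^'n) \<times> real \<Rightarrow> real) \<Rightarrow> ((real^'n) \<times> real) measure \<Rightarrow> bool" where
  "CZO_L2_bounded K \<mu> \<longleftrightarrow>
     (\<exists>C>0. \<forall>f\<in>borel_measurable \<mu>. (\<integral>\<^sup>+ X. ennreal ((f X)\<^sup>2) \<partial>\<mu>) < \<infinity> \<longrightarrow>
        (\<integral>\<^sup>+ X. (SUP \<epsilon>\<in>{0<..}. ennreal (\<bar>trunc_op K \<mu> \<epsilon> f X\<bar>\<^sup>2)) \<partial>\<mu>)
          \<le> ennreal C * (\<integral>\<^sup>+ X. ennreal ((f X)\<^sup>2) \<partial>\<mu>))"

definition all_CZOs_bounded :: "nat \<Rightarrow> ((real^'n) \<times> real) measure \<Rightarrow> bool" where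
  "all_CZOs_bounded m \<mu> \<longleftrightarrow> (\<forall>K. admissible_kernel m K \<longrightarrow> CZO_L2_bounded K \<mu>)"

end

theory Submission
  imports Defs "HOL-Library.Function_Algebras"
begin

text \<open>
  Write \<open>\<mu>\<close> as the product of a spatial measure \<open>\<sigma>\<close> and \<open>\<nu>\<close>.  In all three cases \<open>\<sigma>\<close> is invariant under the
  point reflections through its support, so the spatial antisymmetry of the kernel makes the integral of
  each of its dyadic pieces vanish, in either variable.  The corresponding operators are therefore almost
  orthogonal, and the Cotlar-Stein lemma bounds their partial sums in \<open>L2\<close> uniformly.  For the maximal
  truncations, the same cancellation yields Cotlar's inequality in the form
  \<open>\<bar>T\<^sub>N f\<bar> \<le> C (M (T f) + M f)\<close>, pointwise and without any weak type estimate, where \<open>M\<close> is the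
  Hardy-Littlewood maximal function.  The latter is bounded in \<open>L2\<close> by a TT* argument that needs no
  covering lemma.  Regularity of \<open>\<mu>\<close> reduces to the Hausdorff measure of balls in a plane, which by scaling
  need only be shown to be positive and finite for one ball.
\<close>

section \<open>The Cotlar-Stein lemma\<close>

text \<open>A reflection preserves the measure when its centre lies in the support, so the pieces
  have mean zero at almost every centre rather than at all of them; hence the almost-everywhere
  hypotheses on cancellation. The sum of all pieces need not converge absolutely, so every estimate
  concerns a finite range of scales, with a constant free of the range, and Fatou's lemma lets the
  range grow at the end. The usual proof of Cotlar's inequality splits off the local part of
  \<open>f\<close> and needs a weak type bound for it. Here the average is taken against a Lipschitz
  function instead of the indicator of a ball, so that the pieces below the scale of the average are
  small by their own cancellation. A sharp truncation differs from a limit of sums of pieces by a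
  kernel living in one dyadic shell, and the maximal function absorbs the difference. The three
  cases meet in one statement on products, where the growth of the spatial factor times that of the
  temporal one is \<open>r ^ (k + 2)\<close>: a stack of k-planes looks k-dimensional at small
  scales and of dimension k + 1 at large ones, which \<open>min r (r\<^sup>2)\<close>
  compensates.\<close>

definition lists_of :: "'i set \<Rightarrow> nat \<Rightarrow> 'i list set" where
  "lists_of I n = {w. set w \<subseteq> I \<and> length w = n}"

lemma lists_of_0 [simp]: "lists_of I 0 = {[]}"
  by (auto simp: lists_of_def)

lemma finite_lists_of: "finite I \<Longrightarrow> finite (lists_of I n)"
  unfolding lists_of_def by (rule finite_lists_length_eq)

lemma sum_lists_of_Suc:
  assumes "finite I"
  shows "(\<Sum>w\<in>lists_of I (Suc n). F w) = (\<Sum>i\<in>I. \<Sum>w\<in>lists_of I n. F (i # w))"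
proof -
  have eq: "lists_of I (Suc n) = (\<lambda>(i, w). i # w) ` (I \<times> lists_of I n)"
    by (force simp: lists_of_def length_Suc_conv image_iff)
  have "(\<Sum>w\<in>lists_of I (Suc n). F w) = (\<Sum>p\<in>I \<times> lists_of I n. F (fst p # snd p))"
    unfolding eq by (subst sum.reindex) (auto simp: inj_on_def case_prod_beta)
  then show ?thesis
    by (simp add: sum.cartesian_product case_prod_beta)
qed

text \<open>Consecutive pairs overlap: a word of length n carries n - 1 factors, from the pairs
  starting at odd and at even positions alike. Words with fewer than two letters get the empty
  product.\<close>

fun chain_weight :: "('i \<Rightarrow> 'i \<Rightarrow> real) \<Rightarrow> 'i list \<Rightarrow> real" where
  "chain_weight a (i # j # w) = a i j * chain_weight a (j # w)"
| "chain_weight a w = 1"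

text \<open>Letters are consumed two at a time, so an unpaired last letter would be dropped; the
  words in the expansion of a power of \<open>T* T\<close> all have even length.\<close>

fun alternating_word :: "('i \<Rightarrow> 'f \<Rightarrow> 'f) \<Rightarrow> ('i \<Rightarrow> 'f \<Rightarrow> 'f) \<Rightarrow> 'i list \<Rightarrow> 'f \<Rightarrow> 'f" where
  "alternating_word T T' (i # j # w) f = T' i (T j (alternating_word T T' w f))"
| "alternating_word T T' w f = f"

lemma chain_weight_nonneg:
  assumes "\<And>i j. a i j \<ge> 0"
  shows "chain_weight a w \<ge> 0"
  using assms by (induction a w rule: chain_weight.induct) auto

text \<open>With the first letter fixed, summing out the remaining letters from the last one
  backwards costs one row sum of \<open>a\<close> each.\<close>

lemma sum_chain_weight_le:
  assumes fin: "finite I" and a0: "\<And>i j. a i j \<ge> 0"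
    and row: "\<And>i. i \<in> I \<Longrightarrow> (\<Sum>j\<in>I. a i j) \<le> A" and iI: "i \<in> I"
  shows "(\<Sum>w\<in>lists_of I n. chain_weight a (i # w)) \<le> A ^ n"
  using iI
proof (induction n arbitrary: i)
  case (Suc n)
  have "0 \<le> (\<Sum>j\<in>I. a i j)" by (intro sum_nonneg a0)
  then have A0: "A \<ge> 0" using row[OF Suc.prems] by simp
  have "(\<Sum>w\<in>lists_of I (Suc n). chain_weight a (i # w))
      = (\<Sum>j\<in>I. a i j * (\<Sum>w\<in>lists_of I n. chain_weight a (j # w)))"
    by (simp add: sum_lists_of_Suc[OF fin] sum_distrib_left)
  also have "\<dots> \<le> (\<Sum>j\<in>I. a i j * A ^ n)"
    by (intro sum_mono mult_left_mono Suc.IH a0)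
  also have "\<dots> = (\<Sum>j\<in>I. a i j) * A ^ n" by (simp add: sum_distrib_right)
  also have "\<dots> \<le> A * A ^ n"
    by (intro mult_right_mono row Suc.prems) (use A0 in simp)
  finally show ?case by simp
qed simp

text \<open>If \<open>x / y > 1\<close>, its powers would outgrow the constant \<open>c\<close>. The
  exponents are powers of two because the moments in \<open>cotlar_stein\<close> are compared by
  repeated squaring.\<close>

lemma power_bound_imp_le:
  fixes x y c :: real
  assumes y: "y \<ge> 0" and le: "\<And>k. x ^ (2 ^ k) \<le> c * y ^ (2 ^ k)"
  shows "x \<le> y"
proof (rule ccontr)
  assume "\<not> x \<le> y"
  then have xy: "y < x" by simp
  show False
  proof (cases "y = 0")
    case True
    then show ?thesis using le[of 0] xy by simp
  next
    case False
    with y have y0: "y > 0" by simp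
    define z where "z = x / y"
    have z1: "z > 1" unfolding z_def using xy y0 by simp
    have b: "z ^ (2 ^ k) \<le> c" for k
      using le[of k] y0 by (simp add: z_def power_divide field_simps)
    obtain n where n: "c < z ^ n" using real_arch_pow[OF z1] by blast
    have "z ^ n \<le> z ^ (2 ^ n)"
      using z1 by (intro power_increasing) auto
    with b[of n] n show False by linarith
  qed
qed

text \<open>
  \<open>(T* T)^n\<close> is expanded into alternating words.  Adjacent factors of a word can be paired in two ways, as
  \<open>T* T\<close> or as \<open>T T*\<close>; the geometric mean of the two resulting bounds is the chain weight, whose sum over all
  words is at most a constant times \<open>A ^ (2 * n)\<close>.  The constant disappears as \<open>n\<close> tends to infinity.
\<close>

theorem cotlar_stein:
  fixes V :: "'f::ab_group_add set" and T T' :: "'i \<Rightarrow> 'f \<Rightarrow> 'f"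
    and ip :: "'f \<Rightarrow> 'f \<Rightarrow> real" and nm :: "'f \<Rightarrow> real" and a :: "'i \<Rightarrow> 'i \<Rightarrow> real"
  assumes fin: "finite I"
    and V0: "0 \<in> V" and Vadd: "\<And>f g. f \<in> V \<Longrightarrow> g \<in> V \<Longrightarrow> f + g \<in> V"
    and TV: "\<And>i f. i \<in> I \<Longrightarrow> f \<in> V \<Longrightarrow> T i f \<in> V"
    and T'V: "\<And>i f. i \<in> I \<Longrightarrow> f \<in> V \<Longrightarrow> T' i f \<in> V"
    and Tadd: "\<And>i f g. i \<in> I \<Longrightarrow> f \<in> V \<Longrightarrow> g \<in> V \<Longrightarrow> T i (f + g) = T i f + T i g"
    and T'add: "\<And>i f g. i \<in> I \<Longrightarrow> f \<in> V \<Longrightarrow> g \<in> V \<Longrightarrow> T' i (f + g) = T' i f + T' i g"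
    and ip_add: "\<And>f g h. f \<in> V \<Longrightarrow> g \<in> V \<Longrightarrow> h \<in> V \<Longrightarrow> ip (f + g) h = ip f h + ip g h"
    and ip_sym: "\<And>f g. ip f g = ip g f"
    and ip_nm: "\<And>f. f \<in> V \<Longrightarrow> ip f f = (nm f)\<^sup>2" and nm0: "\<And>f. nm f \<ge> 0"
    and CS: "\<And>f g. f \<in> V \<Longrightarrow> g \<in> V \<Longrightarrow> \<bar>ip f g\<bar> \<le> nm f * nm g"
    and adj: "\<And>i f g. i \<in> I \<Longrightarrow> f \<in> V \<Longrightarrow> g \<in> V \<Longrightarrow> ip (T i f) g = ip f (T' i g)"
    and a0: "\<And>i j. a i j \<ge> 0"
    and row: "\<And>i. i \<in> I \<Longrightarrow> (\<Sum>j\<in>I. a i j) \<le> A" and A: "A > 0"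
    and b1: "\<And>i j f. i \<in> I \<Longrightarrow> j \<in> I \<Longrightarrow> f \<in> V \<Longrightarrow> nm (T' i (T j f)) \<le> (a i j)\<^sup>2 * nm f"
    and b2: "\<And>i j f. i \<in> I \<Longrightarrow> j \<in> I \<Longrightarrow> f \<in> V \<Longrightarrow> nm (T i (T' j f)) \<le> (a i j)\<^sup>2 * nm f"
    and b: "\<And>i f. i \<in> I \<Longrightarrow> f \<in> V \<Longrightarrow> nm (T i f) \<le> B * nm f"
    and b': "\<And>i f. i \<in> I \<Longrightarrow> f \<in> V \<Longrightarrow> nm (T' i f) \<le> B * nm f" and B0: "B \<ge> 0"
    and f: "f \<in> V"
  shows "nm (\<Sum>i\<in>I. T i f) \<le> A * nm f"
proof -
  note finL = finite_lists_of[OF fin]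
  have Vsum: "(\<Sum>x\<in>J. g x) \<in> V" if "\<And>x. x \<in> J \<Longrightarrow> g x \<in> V" for J and g :: "'c \<Rightarrow> 'f"
    using that by (induction J rule: infinite_finite_induct) (auto intro: V0 Vadd)
  have T0: "T i 0 = 0" if "i \<in> I" for i
    using Tadd[OF that V0 V0] by simp
  have T'0: "T' i 0 = 0" if "i \<in> I" for i
    using T'add[OF that V0 V0] by simp
  have Tsum: "T i (\<Sum>x\<in>J. g x) = (\<Sum>x\<in>J. T i (g x))"
    if "i \<in> I" "\<And>x. x \<in> J \<Longrightarrow> g x \<in> V" for i J and g :: "'c \<Rightarrow> 'f"
    using that(2)
  proof (induction J rule: infinite_finite_induct)
    case (insert x F)
    then show ?case using Tadd[OF that(1), of "g x" "sum g F"] Vsum[of F g] by simp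
  qed (auto simp: T0 that)
  have T'sum: "T' i (\<Sum>x\<in>J. g x) = (\<Sum>x\<in>J. T' i (g x))"
    if "i \<in> I" "\<And>x. x \<in> J \<Longrightarrow> g x \<in> V" for i J and g :: "'c \<Rightarrow> 'f"
    using that(2)
  proof (induction J rule: infinite_finite_induct)
    case (insert x F)
    then show ?case using T'add[OF that(1), of "g x" "sum g F"] Vsum[of F g] by simp
  qed (auto simp: T'0 that)
  have ip0: "ip 0 h = 0" if "h \<in> V" for h
    using ip_add[OF V0 V0 that] by simp
  have ip_sum: "ip (\<Sum>x\<in>J. g x) h = (\<Sum>x\<in>J. ip (g x) h)"
    if "h \<in> V" "\<And>x. x \<in> J \<Longrightarrow> g x \<in> V" for h J and g :: "'c \<Rightarrow> 'f"
    using that(2)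
  proof (induction J rule: infinite_finite_induct)
    case (insert x F)
    then show ?case using ip_add[of "g x" "sum g F" h] Vsum[of F g] that by simp
  qed (auto simp: ip0 that)
  let ?W = "alternating_word T T'"
  have WV: "?W w g \<in> V" if "set w \<subseteq> I" "g \<in> V" for w g
    using that by (induction w rule: induct_list012) (auto intro: TV T'V)
  \<comment> \<open>\<open>S\<close> is \<open>T* T\<close> for
    \<open>T = \<Sum>i\<in>I. T i\<close>; its quadratic form at \<open>f\<close> is the square of
    the norm to be bounded.\<close>
  define S where "S g = (\<Sum>i\<in>I. T' i (\<Sum>j\<in>I. T j g))" for g
  have SV: "S g \<in> V" if "g \<in> V" for g
    unfolding S_def using that by (intro Vsum T'V TV)
  have SnV: "(S ^^ n) g \<in> V" if "g \<in> V" for g n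
    using that by (induction n) (auto intro: SV)
  have S_expand: "(S ^^ n) g = (\<Sum>w\<in>lists_of I (2 * n). ?W w g)" if g: "g \<in> V" for n g
  proof (induction n)
    case (Suc n)
    have *: "?W w g \<in> V" if "w \<in> lists_of I (2 * n)" for w
      using that g WV by (auto simp: lists_of_def)
    have "(S ^^ Suc n) g = (\<Sum>i\<in>I. T' i (\<Sum>j\<in>I. \<Sum>w\<in>lists_of I (2 * n). T j (?W w g)))"
    proof -
      have "(S ^^ Suc n) g = S (\<Sum>w\<in>lists_of I (2 * n). ?W w g)"
        by (simp add: Suc)
      also have "\<dots> = (\<Sum>i\<in>I. T' i (\<Sum>j\<in>I. \<Sum>w\<in>lists_of I (2 * n). T j (?W w g)))"
        unfolding S_def by (simp add: Tsum *)
      finally show ?thesis .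
    qed
    also have "\<dots> = (\<Sum>i\<in>I. \<Sum>j\<in>I. \<Sum>w\<in>lists_of I (2 * n). T' i (T j (?W w g)))"
      by (intro sum.cong refl) (simp add: T'sum Vsum TV *)
    also have "\<dots> = (\<Sum>w\<in>lists_of I (2 * Suc n). ?W w g)"
      by (simp add: sum_lists_of_Suc[OF fin])
    finally show ?case .
  qed simp
  have S_sym: "ip (S g) h = ip g (S h)" if "g \<in> V" "h \<in> V" for g h
  proof -
    have "ip (S g) h = (\<Sum>i\<in>I. ip (T' i (\<Sum>j\<in>I. T j g)) h)"
      unfolding S_def using that by (intro ip_sum) (auto intro!: T'V Vsum TV)
    also have "\<dots> = (\<Sum>i\<in>I. ip (\<Sum>j\<in>I. T j g) (T i h))"
      using that adj[of _ h "\<Sum>j\<in>I. T j g"]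
      by (intro sum.cong refl) (metis Vsum TV ip_sym)
    also have "\<dots> = (\<Sum>i\<in>I. \<Sum>j\<in>I. ip (T j g) (T i h))"
      using that by (intro sum.cong refl ip_sum) (auto intro!: TV)
    also have "\<dots> = (\<Sum>j\<in>I. \<Sum>i\<in>I. ip (T i h) (T j g))"
      by (subst sum.swap) (simp add: ip_sym)
    also have "\<dots> = (\<Sum>i\<in>I. ip (\<Sum>j\<in>I. T j h) (T i g))"
      using that by (intro sum.cong refl ip_sum[symmetric]) (auto intro!: TV)
    also have "\<dots> = (\<Sum>i\<in>I. ip (T' i (\<Sum>j\<in>I. T j h)) g)"
      using that adj[of _ g "\<Sum>j\<in>I. T j h"]
      by (intro sum.cong refl) (metis Vsum TV ip_sym)
    also have "\<dots> = ip (S h) g"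
      unfolding S_def using that by (intro ip_sum[symmetric]) (auto intro!: T'V Vsum TV)
    finally show ?thesis by (simp add: ip_sym)
  qed
  have Sn_sym: "ip ((S ^^ n) g) h = ip g ((S ^^ n) h)" if "g \<in> V" "h \<in> V" for g h n
    using that
  proof (induction n arbitrary: h)
    case (Suc n)
    have "ip ((S ^^ Suc n) g) h = ip ((S ^^ n) g) (S h)"
      using S_sym[OF SnV[OF Suc.prems(1)] Suc.prems(2), of n] by simp
    also have "\<dots> = ip g ((S ^^ n) (S h))"
      using Suc SV by blast
    finally show ?case by (simp add: funpow_swap1)
  qed simp
  have T1: "ip (S f) f = (nm (\<Sum>i\<in>I. T i f))\<^sup>2"
  proof -
    let ?h = "\<Sum>j\<in>I. T j f"
    have h: "?h \<in> V" using f by (intro Vsum TV)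
    have "ip (S f) f = (\<Sum>i\<in>I. ip (T' i ?h) f)"
      unfolding S_def using f h by (intro ip_sum) (auto intro!: T'V)
    also have "\<dots> = (\<Sum>i\<in>I. ip (T i f) ?h)"
      using adj[OF _ f h] by (intro sum.cong refl) (metis ip_sym)
    also have "\<dots> = ip ?h ?h"
      using f h by (intro ip_sum[symmetric]) (auto intro!: TV)
    finally show ?thesis using ip_nm[OF h] by simp
  qed
  define p where "p n = ip ((S ^^ n) f) f" for n
  \<comment> \<open>Cauchy-Schwarz for \<open>S ^^ n\<close>, whose symmetry turns the square of its
    norm at \<open>f\<close> into the moment of order \<open>2 * n\<close>.\<close>
  have dbl: "(p n)\<^sup>2 \<le> p (2 * n) * (nm f)\<^sup>2" for n
  proof -
    have "\<bar>p n\<bar> \<le> nm ((S ^^ n) f) * nm f"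
      unfolding p_def by (intro CS SnV f)
    then have "\<bar>p n\<bar>\<^sup>2 \<le> (nm ((S ^^ n) f) * nm f)\<^sup>2"
      by (intro power_mono) auto
    moreover have "(nm ((S ^^ n) f))\<^sup>2 = p (2 * n)"
      using ip_nm[OF SnV[OF f], of n] Sn_sym[OF f SnV[OF f], of n n]
      by (simp add: p_def ip_sym mult_2 funpow_add)
    ultimately show ?thesis by (simp add: power_mult_distrib)
  qed
  \<comment> \<open>Iterated squaring compares the first moment, which is the squared norm of the
    sum of the \<open>T i f\<close>, with a high moment.\<close>
  have grow: "(p 1) ^ (2 ^ k) * (nm f)\<^sup>2 \<le> p (2 ^ k) * ((nm f)\<^sup>2) ^ (2 ^ k)" for k
  proof (induction k)
    case (Suc k)
    show ?case
    proof (cases "nm f = 0")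
      case False
      then have n0: "(nm f)\<^sup>2 > 0" by simp
      have "p 1 \<ge> 0" using T1 by (simp add: p_def)
      then have "((p 1) ^ (2 ^ k) * (nm f)\<^sup>2)\<^sup>2 \<le> (p (2 ^ k) * ((nm f)\<^sup>2) ^ (2 ^ k))\<^sup>2"
        by (intro power_mono Suc.IH) auto
      also have "\<dots> = (p (2 ^ k))\<^sup>2 * ((nm f)\<^sup>2) ^ (2 ^ Suc k)"
        by (simp add: power_mult_distrib power_mult[symmetric] mult.commute)
      also have "\<dots> \<le> p (2 ^ Suc k) * (nm f)\<^sup>2 * ((nm f)\<^sup>2) ^ (2 ^ Suc k)"
        using dbl[of "2 ^ k"] by (intro mult_right_mono) auto
      finally have calc: "((p 1) ^ (2 ^ k) * (nm f)\<^sup>2)\<^sup>2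
          \<le> p (2 ^ Suc k) * (nm f)\<^sup>2 * ((nm f)\<^sup>2) ^ (2 ^ Suc k)" .
      have "(p 1 ^ (2 ^ Suc k) * (nm f)\<^sup>2) * (nm f)\<^sup>2
          \<le> (p (2 ^ Suc k) * ((nm f)\<^sup>2) ^ (2 ^ Suc k)) * (nm f)\<^sup>2"
      proof -
        have "p 1 ^ (2 ^ Suc k) = (p 1 ^ (2 ^ k))\<^sup>2"
          by (simp add: power_mult[symmetric] mult.commute)
        then have "((p 1) ^ (2 ^ k) * (nm f)\<^sup>2)\<^sup>2 = (p 1 ^ (2 ^ Suc k) * (nm f)\<^sup>2) * (nm f)\<^sup>2"
          by (simp add: power_mult_distrib power2_eq_square)
        moreover have "p (2 ^ Suc k) * (nm f)\<^sup>2 * ((nm f)\<^sup>2) ^ (2 ^ Suc k)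
            = (p (2 ^ Suc k) * ((nm f)\<^sup>2) ^ (2 ^ Suc k)) * (nm f)\<^sup>2"
          by (simp only: mult_ac)
        ultimately show ?thesis using calc by argo
      qed
      then show ?thesis using n0 by (simp only: mult_le_cancel_right_pos)
    qed (simp add: power_0_left)
  qed simp
  have Wbound: "(nm (?W w f))\<^sup>2 \<le> B\<^sup>2 * (chain_weight a w)\<^sup>2 * (nm f)\<^sup>2"
    if w: "set w \<subseteq> I" "even (length w)" "w \<noteq> []" for w
  proof -
    \<comment> \<open>Both groupings run through one induction: \<open>s\<close> collects the pairs
      that start at odd positions, \<open>t\<close> those of the word without its first letter,
      where the last \<open>T\<close> is left over and costs \<open>B\<close>. Each adjacent pair is
      in exactly one of them.\<close>
    have *: "\<exists>s t. s \<ge> 0 \<and> t \<ge> 0 \<and> s * t \<le> B * (chain_weight a w)\<^sup>2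
        \<and> nm (?W w f) \<le> s * nm f \<and> nm (T (hd (tl w)) (?W (tl (tl w)) f)) \<le> t * nm f"
      using w
    proof (induction w rule: induct_list012)
      case (3 i j w)
      show ?case
      proof (cases "w = []")
        case True
        with 3 show ?thesis
          by (intro exI[of _ "(a i j)\<^sup>2"] exI[of _ B]) (auto intro: b1 b f B0)
      next
        case False
        then obtain i' w1 where w1: "w = i' # w1" by (cases w) auto
        then obtain j' u where w: "w = i' # j' # u"
          using "3.prems" by (cases w1) auto
        obtain s t where st: "s \<ge> 0" "t \<ge> 0" "s * t \<le> B * (chain_weight a w)\<^sup>2"
          "nm (?W w f) \<le> s * nm f" "nm (T j' (?W u f)) \<le> t * nm f"
          using "3.IH"(1) "3.prems" False w by auto
        have I: "i \<in> I" "j \<in> I" "i' \<in> I" "j' \<in> I" "set u \<subseteq> I" using "3.prems" w by auto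
        have "nm (?W (i # j # w) f) \<le> (a i j)\<^sup>2 * nm (?W w f)"
          using I "3.prems" by (auto intro!: b1 WV f)
        also have "\<dots> \<le> (a i j)\<^sup>2 * (s * nm f)"
          by (intro mult_left_mono st) auto
        finally have n1: "nm (?W (i # j # w) f) \<le> ((a i j)\<^sup>2 * s) * nm f" by simp
        have "nm (T j (?W w f)) \<le> (a j i')\<^sup>2 * nm (T j' (?W u f))"
          unfolding w alternating_word.simps using I by (intro b2 TV WV f) auto
        also have "\<dots> \<le> (a j i')\<^sup>2 * (t * nm f)"
          by (intro mult_left_mono st) auto
        finally have n2: "nm (T j (?W w f)) \<le> ((a j i')\<^sup>2 * t) * nm f" by simp
        have "((a i j)\<^sup>2 * s) * ((a j i')\<^sup>2 * t) = (a i j)\<^sup>2 * (a j i')\<^sup>2 * (s * t)"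
          by simp
        also have "\<dots> \<le> (a i j)\<^sup>2 * (a j i')\<^sup>2 * (B * (chain_weight a w)\<^sup>2)"
          by (intro mult_left_mono st) auto
        also have "\<dots> = B * (chain_weight a (i # j # w))\<^sup>2"
          unfolding w by (simp add: power_mult_distrib)
        finally show ?thesis
          using n1 n2 st by (intro exI[of _ "(a i j)\<^sup>2 * s"] exI[of _ "(a j i')\<^sup>2 * t"]) simp
      qed
    qed auto
    then obtain s t where st: "s \<ge> 0" "t \<ge> 0" "s * t \<le> B * (chain_weight a w)\<^sup>2"
        "nm (?W w f) \<le> s * nm f" "nm (T (hd (tl w)) (?W (tl (tl w)) f)) \<le> t * nm f"
      by blast
    obtain i w1 where w1: "w = i # w1" using w by (cases w) auto
    then obtain j u where u: "w = i # j # u" using w by (cases w1) auto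
    have I: "i \<in> I" "j \<in> I" "set u \<subseteq> I" using w u by auto
    \<comment> \<open>The first letter, left out of the second grouping, costs another
      \<open>B\<close>.\<close>
    have "nm (?W w f) \<le> B * nm (T j (?W u f))"
      unfolding u alternating_word.simps using I by (intro b' TV WV f) auto
    also have "\<dots> \<le> B * (t * nm f)"
      using st(5) u by (intro mult_left_mono B0) auto
    finally have "nm (?W w f) * nm (?W w f) \<le> (s * nm f) * (B * (t * nm f))"
      using st by (intro mult_mono nm0) (auto intro!: mult_nonneg_nonneg nm0)
    also have "\<dots> = B * (nm f)\<^sup>2 * (s * t)" by (simp add: power2_eq_square)
    also have "\<dots> \<le> B * (nm f)\<^sup>2 * (B * (chain_weight a w)\<^sup>2)"
      by (intro mult_left_mono st) (use B0 in auto)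
    finally show ?thesis by (simp add: power2_eq_square algebra_simps)
  qed
  \<comment> \<open>There are \<open>card I\<close> choices of the first letter and
    \<open>2 * n - 1\<close> row sums; the quotient by \<open>A\<close> completes the power, and the
    prefactor no longer depends on \<open>n\<close>.\<close>
  have pn: "p n \<le> (of_nat (card I) * B / A * (nm f)\<^sup>2) * (A\<^sup>2) ^ n" if n: "n \<ge> 1" for n
  proof -
    have "ip (?W w f) f \<le> B * chain_weight a w * (nm f)\<^sup>2" if "w \<in> lists_of I (2 * n)" for w
    proof -
      have w: "set w \<subseteq> I" "even (length w)" "w \<noteq> []"
        using that n by (auto simp: lists_of_def)
      have "nm (?W w f) \<le> B * chain_weight a w * nm f"
      proof (rule power2_le_imp_le)
        show "(nm (?W w f))\<^sup>2 \<le> (B * chain_weight a w * nm f)\<^sup>2"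
          using Wbound[OF w] by (simp add: power_mult_distrib)
        show "0 \<le> B * chain_weight a w * nm f"
          by (intro mult_nonneg_nonneg B0 nm0 chain_weight_nonneg a0)
      qed
      then have "nm (?W w f) * nm f \<le> B * chain_weight a w * nm f * nm f"
        by (intro mult_right_mono nm0)
      moreover have "ip (?W w f) f \<le> nm (?W w f) * nm f"
        using CS[OF WV[OF w(1) f] f] by linarith
      ultimately show ?thesis by (simp add: power2_eq_square algebra_simps)
    qed
    then have "p n \<le> (\<Sum>w\<in>lists_of I (2 * n). B * chain_weight a w * (nm f)\<^sup>2)"
      unfolding p_def S_expand[OF f]
      by (subst ip_sum[OF f]) (auto intro!: sum_mono WV f simp: lists_of_def)
    also have "\<dots> = B * (nm f)\<^sup>2 * (\<Sum>w\<in>lists_of I (2 * n). chain_weight a w)"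
      by (simp add: sum_distrib_left sum_distrib_right algebra_simps)
    also have "(\<Sum>w\<in>lists_of I (2 * n). chain_weight a w)
        = (\<Sum>i\<in>I. \<Sum>w\<in>lists_of I (2 * n - 1). chain_weight a (i # w))"
      using n sum_lists_of_Suc[OF fin, of "chain_weight a" "2 * n - 1"] by simp
    also have "B * (nm f)\<^sup>2 * \<dots> \<le> B * (nm f)\<^sup>2 * (\<Sum>i\<in>I. A ^ (2 * n - 1))"
      using B0 by (intro mult_left_mono sum_mono sum_chain_weight_le[OF fin a0 row]) auto
    also have "\<dots> = (of_nat (card I) * B / A * (nm f)\<^sup>2) * (A\<^sup>2) ^ n"
    proof -
      have "A ^ (2 * n - 1) = (A\<^sup>2) ^ n / A"
        using A n by (simp add: power_mult[symmetric] power_diff)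
      then show ?thesis by (simp add: algebra_simps)
    qed
    finally show ?thesis .
  qed
  show ?thesis
  proof (cases "nm f = 0 \<or> I = {}")
    case True
    then show ?thesis
    proof
      \<comment> \<open>\<open>nm\<close> is only a seminorm, so \<open>f\<close> need not vanish
        here.\<close>
      assume z: "nm f = 0"
      have "(nm (\<Sum>i\<in>I. T i f))\<^sup>2 \<le> nm (S f) * nm f"
        using CS[OF SV[OF f] f] T1 by linarith
      then show ?thesis using z nm0 by simp
    next
      assume "I = {}"
      then have "nm (\<Sum>i\<in>I. T i f) = 0"
        using ip_nm[OF V0] ip0[OF V0] by simp
      then show ?thesis using A nm0[of f] by simp
    qed
  next
    case False
    then have n0: "(nm f)\<^sup>2 > 0" and I: "I \<noteq> {}" by auto
    have "(p 1 / (nm f)\<^sup>2) ^ (2 ^ k) \<le> (of_nat (card I) * B / A) * (A\<^sup>2) ^ (2 ^ k)" for k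
    proof -
      have "(p 1) ^ (2 ^ k) * (nm f)\<^sup>2
          \<le> (of_nat (card I) * B / A * (nm f)\<^sup>2) * (A\<^sup>2) ^ (2 ^ k) * ((nm f)\<^sup>2) ^ (2 ^ k)"
        using order_trans[OF grow[of k] mult_right_mono[OF pn[of "2 ^ k"]]] by simp
      then have "(p 1) ^ (2 ^ k) * (nm f)\<^sup>2
          \<le> ((of_nat (card I) * B / A) * (A\<^sup>2) ^ (2 ^ k) * ((nm f)\<^sup>2) ^ (2 ^ k)) * (nm f)\<^sup>2"
        by (simp only: mult_ac)
      then have "(p 1) ^ (2 ^ k) \<le> (of_nat (card I) * B / A) * (A\<^sup>2) ^ (2 ^ k) * ((nm f)\<^sup>2) ^ (2 ^ k)"
        using n0 by (simp only: mult_le_cancel_right_pos)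
      then show ?thesis using n0
        unfolding power_divide by (subst pos_divide_le_eq) (auto simp only: zero_less_power)
    qed
    then have "p 1 / (nm f)\<^sup>2 \<le> A\<^sup>2"
      by (rule power_bound_imp_le[rotated]) auto
    then have "(nm (\<Sum>i\<in>I. T i f))\<^sup>2 \<le> (A * nm f)\<^sup>2"
      using n0 T1 by (simp add: p_def field_simps)
    then show ?thesis
      by (rule power2_le_imp_le) (use A nm0[of f] in auto)
  qed
qed

section \<open>The maximal function\<close>

lemma power2_add_le_ennreal: "((a::ennreal) + b)\<^sup>2 \<le> 2 * (a\<^sup>2 + b\<^sup>2)"
proof (cases "a = top \<or> b = top")
  case True
  then show ?thesis by (auto simp: power2_eq_square ennreal_top_mult ennreal_mult_top)
next
  case False
  then obtain x y where xy: "a = ennreal x" "b = ennreal y" "x \<ge> 0" "y \<ge> 0"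
    by (metis ennreal_cases)
  have "(x + y)\<^sup>2 \<le> 2 * (x\<^sup>2 + y\<^sup>2)"
    using sum_squares_bound[of x y] by (simp add: power2_sum)
  then show ?thesis
    unfolding xy using xy(3,4)
    by (simp add: ennreal_plus[symmetric] ennreal_power ennreal_mult'[symmetric] ennreal_numeral[symmetric]
        ennreal_leI del: ennreal_plus ennreal_numeral)
qed

lemma SUP_power2_ennreal:
  fixes u :: "nat \<Rightarrow> ennreal"
  assumes "incseq u"
  shows "(SUP n. u n)\<^sup>2 = (SUP n. (u n)\<^sup>2)"
proof (rule antisym)
  have "(SUP n. u n)\<^sup>2 = (SUP i. SUP j. u i * u j)"
    unfolding power2_eq_square
    by (subst SUP_mult_right_ennreal) (simp add: SUP_mult_left_ennreal)
  also have "\<dots> \<le> (SUP n. (u n)\<^sup>2)"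
  proof (intro SUP_least)
    fix i j
    have "u i * u j \<le> u (max i j) * u (max i j)"
      by (intro mult_mono incseqD[OF assms]) auto
    then show "u i * u j \<le> (SUP n. (u n)\<^sup>2)"
      by (intro SUP_upper2[of "max i j"]) (auto simp: power2_eq_square)
  qed
  finally show "(SUP n. u n)\<^sup>2 \<le> (SUP n. (u n)\<^sup>2)" .
  show "(SUP n. (u n)\<^sup>2) \<le> (SUP n. u n)\<^sup>2"
    by (intro SUP_least power_mono SUP_upper) auto
qed

text \<open>The distance is a parameter because the metric carried by the product type is the
  Euclidean one. The growth bound is demanded at every centre, on the support or off it.\<close>

locale growth_space = sigma_finite_measure M for M :: "'a measure" +
  fixes d :: "'a \<Rightarrow> 'a \<Rightarrow> real" and m :: nat and C :: real
  assumes space_UNIV: "space M = UNIV"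
    and d_borel: "(\<lambda>p. d (fst p) (snd p)) \<in> borel_measurable (M \<Otimes>\<^sub>M M)"
    and d_self: "d x x = 0" and d_sym: "d x y = d y x"
    and d_triangle: "d x z \<le> d x y + d y z"
    and C_pos: "C > 0"
    and growth: "r > 0 \<Longrightarrow> emeasure M {y. d x y < r} \<le> ennreal (C * r ^ m)"
begin

sublocale MM: pair_sigma_finite M M ..

lemma d_nonneg: "0 \<le> d x y"
  using d_triangle[of x x y] d_self[of x] d_sym[of x y] by linarith

lemma d_measurable [measurable (raw)]:
  "f \<in> measurable N M \<Longrightarrow> g \<in> measurable N M \<Longrightarrow> (\<lambda>z. d (f z) (g z)) \<in> borel_measurable N"
  using measurable_compose[OF measurable_Pair[of f N M g M] d_borel] by simp

definition weight :: "int \<Rightarrow> real" where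
  "weight j = 1 / (2 powi j) ^ m"

text \<open>Division by a power of the radius, not by the measure of the ball, keeps the kernel
  symmetric in its two points, so that \<open>ball_avg j\<close> is its own adjoint.\<close>

definition ball_kernel :: "int \<Rightarrow> 'a \<Rightarrow> 'a \<Rightarrow> ennreal" where
  "ball_kernel j x y = (if d x y < 2 powi j then ennreal (weight j) else 0)"

definition ball_avg :: "int \<Rightarrow> ('a \<Rightarrow> ennreal) \<Rightarrow> 'a \<Rightarrow> ennreal" where
  "ball_avg j f x = (\<integral>\<^sup>+ y. ball_kernel j x y * f y \<partial>M)"

definition maximal :: "('a \<Rightarrow> ennreal) \<Rightarrow> 'a \<Rightarrow> ennreal" where
  "maximal f x = (SUP j. ball_avg j f x)"

lemma weight_pos: "weight j > 0"
  by (simp add: weight_def)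

lemma weight_Suc: "weight j = 2 ^ m * weight (j + 1)"
  by (simp add: weight_def power_int_add power_mult_distrib)

lemma ball_kernel_measurable [measurable (raw)]:
  assumes [measurable]: "f \<in> measurable N M" "g \<in> measurable N M"
  shows "(\<lambda>z. ball_kernel j (f z) (g z)) \<in> borel_measurable N"
  unfolding ball_kernel_def by measurable

lemma ball_avg_measurable [measurable (raw)]:
  assumes [measurable]: "f \<in> borel_measurable M" "g \<in> measurable N M"
  shows "(\<lambda>z. ball_avg j f (g z)) \<in> borel_measurable N"
  unfolding ball_avg_def by measurable

lemma const_measurable [measurable]: "(\<lambda>y. x) \<in> measurable N M"
  by (simp add: space_UNIV)

lemma ball_measurable [measurable]: "{y. d x y < r} \<in> sets M"
proof -
  have "{y \<in> space M. d x y < r} \<in> sets M"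
    by measurable
  then show ?thesis by (simp add: space_UNIV)
qed

lemma ball_kernel_sym: "ball_kernel j x y = ball_kernel j y x"
  by (simp add: ball_kernel_def d_sym)

lemma ball_kernel_eq: "ball_kernel j x y = ennreal (weight j) * indicator {y. d x y < 2 powi j} y"
  by (simp add: ball_kernel_def)

lemma nn_integral_ball_kernel_le: "(\<integral>\<^sup>+ y. ball_kernel j x y \<partial>M) \<le> ennreal C"
proof -
  have "(\<integral>\<^sup>+ y. ball_kernel j x y \<partial>M) = ennreal (weight j) * emeasure M {y. d x y < 2 powi j}"
    unfolding ball_kernel_eq by (subst nn_integral_cmult_indicator) auto
  also have "\<dots> \<le> ennreal (weight j) * ennreal (C * (2 powi j) ^ m)"
    by (intro mult_left_mono growth) auto
  also have "\<dots> = ennreal C"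
    using weight_pos[of j] C_pos by (simp add: ennreal_mult'[symmetric] weight_def)
  finally show ?thesis .
qed

text \<open>The composition vanishes unless \<open>d x y < 2 powi i + 2 powi j\<close>, and it is at
  most \<open>C\<close> times the weight of the larger scale; passing to the next scale costs
  \<open>2 ^ m\<close>. The TT* argument for the maximal function rests on this stability under
  composition.\<close>

lemma nn_integral_ball_kernel_comp_le:
  "(\<integral>\<^sup>+ z. ball_kernel i x z * ball_kernel j z y \<partial>M) \<le> ennreal (C * 2 ^ m) * ball_kernel (max i j + 1) x y"
proof -
  have *: "(\<integral>\<^sup>+ z. ball_kernel i x z * ball_kernel j z y \<partial>M) \<le> ennreal (C * 2 ^ m) * ball_kernel (j + 1) x y"
    if ij: "i \<le> j" for i j x y
  proof (cases "d x y < 2 powi (j + 1)")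
    case True
    have "(\<integral>\<^sup>+ z. ball_kernel i x z * ball_kernel j z y \<partial>M) \<le> (\<integral>\<^sup>+ z. ball_kernel i x z * ennreal (weight j) \<partial>M)"
      by (intro nn_integral_mono mult_left_mono) (auto simp: ball_kernel_def)
    also have "\<dots> = (\<integral>\<^sup>+ z. ball_kernel i x z \<partial>M) * ennreal (weight j)"
      by (intro nn_integral_multc) (auto simp: space_UNIV)
    also have "\<dots> \<le> ennreal C * ennreal (weight j)"
      by (intro mult_right_mono nn_integral_ball_kernel_le) auto
    also have "\<dots> = ennreal (C * 2 ^ m) * ball_kernel (j + 1) x y"
      using True C_pos weight_pos[of "j + 1"] weight_Suc[of j]
      by (simp add: ball_kernel_def ennreal_mult'[symmetric] mult_ac)
    finally show ?thesis .
  next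
    case False
    have z0: "ball_kernel i x z * ball_kernel j z y = 0" for z
    proof (rule ccontr)
      assume "ball_kernel i x z * ball_kernel j z y \<noteq> 0"
      then have "d x z < 2 powi i" "d z y < 2 powi j"
        by (auto simp: ball_kernel_def split: if_splits)
      moreover have "(2::real) powi i \<le> 2 powi j" using ij by (intro power_int_increasing) auto
      ultimately have "d x y < 2 powi (j + 1)"
        using d_triangle[of x y z] by (simp add: power_int_add)
      with False show False by simp
    qed
    show ?thesis unfolding z0 by simp
  qed
  show ?thesis
  proof (cases "i \<le> j")
    case True
    then show ?thesis using *[OF True, of x y] by (simp add: max_def)
  next
    case False
    have "(\<integral>\<^sup>+ z. ball_kernel i x z * ball_kernel j z y \<partial>M) = (\<integral>\<^sup>+ z. ball_kernel j y z * ball_kernel i z x \<partial>M)"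
      by (intro nn_integral_cong) (simp add: ball_kernel_sym mult.commute)
    also have "\<dots> \<le> ennreal (C * 2 ^ m) * ball_kernel (i + 1) y x"
      using False by (intro *) auto
    finally show ?thesis using False by (simp add: max_def ball_kernel_sym)
  qed
qed

lemma ball_avg_sum:
  assumes "\<And>i. i \<in> F \<Longrightarrow> f i \<in> borel_measurable M"
  shows "ball_avg j (\<lambda>y. \<Sum>i\<in>F. f i y) x = (\<Sum>i\<in>F. ball_avg j (f i) x)"
  unfolding ball_avg_def sum_distrib_left using assms
  by (intro nn_integral_sum borel_measurable_times_ennreal) (auto simp: space_UNIV)

lemma ball_avg_comp_le:
  assumes [measurable]: "f \<in> borel_measurable M"
  shows "ball_avg i (ball_avg j f) x \<le> ennreal (C * 2 ^ m) * ball_avg (max i j + 1) f x"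
proof -
  have [measurable]: "(\<lambda>y. x) \<in> measurable N M" for N by (simp add: space_UNIV)
  have "ball_avg i (ball_avg j f) x = (\<integral>\<^sup>+ z. \<integral>\<^sup>+ y. ball_kernel i x z * ball_kernel j z y * f y \<partial>M \<partial>M)"
    unfolding ball_avg_def
    by (intro nn_integral_cong, subst nn_integral_cmult[symmetric]) (auto simp: mult_ac space_UNIV)
  also have "\<dots> = (\<integral>\<^sup>+ y. \<integral>\<^sup>+ z. ball_kernel i x z * ball_kernel j z y * f y \<partial>M \<partial>M)"
    by (intro MM.Fubini'[symmetric]) simp
  also have "\<dots> = (\<integral>\<^sup>+ y. (\<integral>\<^sup>+ z. ball_kernel i x z * ball_kernel j z y \<partial>M) * f y \<partial>M)"
    by (intro nn_integral_cong nn_integral_multc) (simp add: space_UNIV)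
  also have "\<dots> \<le> (\<integral>\<^sup>+ y. ennreal (C * 2 ^ m) * ball_kernel (max i j + 1) x y * f y \<partial>M)"
    by (intro nn_integral_mono mult_right_mono nn_integral_ball_kernel_comp_le) auto
  also have "\<dots> = ennreal (C * 2 ^ m) * ball_avg (max i j + 1) f x"
    unfolding ball_avg_def mult.assoc by (intro nn_integral_cmult) simp
  finally show ?thesis .
qed

lemma ball_avg_adjoint:
  assumes [measurable]: "f \<in> borel_measurable M" "g \<in> borel_measurable M"
  shows "(\<integral>\<^sup>+ x. g x * ball_avg j f x \<partial>M) = (\<integral>\<^sup>+ x. f x * ball_avg j g x \<partial>M)"
proof -
  have "(\<integral>\<^sup>+ x. g x * ball_avg j f x \<partial>M) = (\<integral>\<^sup>+ x. \<integral>\<^sup>+ y. g x * ball_kernel j x y * f y \<partial>M \<partial>M)"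
    unfolding ball_avg_def
    by (intro nn_integral_cong, subst nn_integral_cmult[symmetric]) (auto simp: mult_ac space_UNIV)
  also have "\<dots> = (\<integral>\<^sup>+ y. \<integral>\<^sup>+ x. g x * ball_kernel j x y * f y \<partial>M \<partial>M)"
    by (intro MM.Fubini'[symmetric]) simp
  also have "\<dots> = (\<integral>\<^sup>+ y. f y * ball_avg j g y \<partial>M)"
    unfolding ball_avg_def
    by (intro nn_integral_cong, subst nn_integral_cmult[symmetric])
       (auto simp: mult_ac space_UNIV ball_kernel_sym)
  finally show ?thesis .
qed

text \<open>Schur's test: Cauchy-Schwarz with respect to the kernel, then Tonelli together with the
  symmetry of the kernel. Each of the two marginals contributes a factor \<open>C\<close>.\<close>

lemma nn_integral_ball_avg_power2_le:
  assumes [measurable]: "f \<in> borel_measurable M"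
  shows "(\<integral>\<^sup>+ x. (ball_avg j f x)\<^sup>2 \<partial>M) \<le> ennreal (C\<^sup>2) * (\<integral>\<^sup>+ x. (f x)\<^sup>2 \<partial>M)"
proof -
  have pw: "(ball_avg j f x)\<^sup>2 \<le> ennreal C * ball_avg j (\<lambda>y. (f y)\<^sup>2) x" for x
  proof -
    let ?i = "indicator {y. d x y < 2 powi j} :: 'a \<Rightarrow> ennreal"
    have "ball_avg j f x = (\<integral>\<^sup>+ y. ?i y * (ball_kernel j x y * f y) \<partial>M)"
      unfolding ball_avg_def by (intro nn_integral_cong) (auto simp: ball_kernel_def indicator_def)
    then have "(ball_avg j f x)\<^sup>2 \<le> (\<integral>\<^sup>+ y. (?i y)\<^sup>2 \<partial>M) * (\<integral>\<^sup>+ y. (ball_kernel j x y * f y)\<^sup>2 \<partial>M)"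
      by (simp only:) (intro Cauchy_Schwarz_nn_integral, auto simp: space_UNIV)
    also have "(\<integral>\<^sup>+ y. (ball_kernel j x y * f y)\<^sup>2 \<partial>M) = ennreal (weight j) * ball_avg j (\<lambda>y. (f y)\<^sup>2) x"
      unfolding ball_avg_def
      by (subst nn_integral_cmult[symmetric], simp add: space_UNIV,
          intro nn_integral_cong) (auto simp: ball_kernel_def power2_eq_square mult_ac)
    also have "(\<integral>\<^sup>+ y. (?i y)\<^sup>2 \<partial>M) * (ennreal (weight j) * ball_avg j (\<lambda>y. (f y)\<^sup>2) x)
       = (\<integral>\<^sup>+ y. ball_kernel j x y \<partial>M) * ball_avg j (\<lambda>y. (f y)\<^sup>2) x"
    proof -
      have "(\<integral>\<^sup>+ y. ball_kernel j x y \<partial>M) = ennreal (weight j) * (\<integral>\<^sup>+ y. (?i y)\<^sup>2 \<partial>M)"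
        by (subst nn_integral_cmult[symmetric], simp,
            intro nn_integral_cong) (auto simp: ball_kernel_def indicator_def)
      then show ?thesis by (simp add: mult_ac)
    qed
    also have "\<dots> \<le> ennreal C * ball_avg j (\<lambda>y. (f y)\<^sup>2) x"
      by (intro mult_right_mono nn_integral_ball_kernel_le) auto
    finally show ?thesis .
  qed
  have "(\<integral>\<^sup>+ x. (ball_avg j f x)\<^sup>2 \<partial>M) \<le> (\<integral>\<^sup>+ x. ennreal C * ball_avg j (\<lambda>y. (f y)\<^sup>2) x \<partial>M)"
    by (intro nn_integral_mono pw)
  also have "\<dots> = ennreal C * (\<integral>\<^sup>+ x. 1 * ball_avg j (\<lambda>y. (f y)\<^sup>2) x \<partial>M)"
    by (simp add: nn_integral_cmult)
  also have "\<dots> = ennreal C * (\<integral>\<^sup>+ x. (f x)\<^sup>2 * ball_avg j (\<lambda>y. 1) x \<partial>M)"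
    by (subst ball_avg_adjoint) auto
  also have "\<dots> \<le> ennreal C * (\<integral>\<^sup>+ x. (f x)\<^sup>2 * ennreal C \<partial>M)"
    using nn_integral_ball_kernel_le
    by (intro mult_left_mono nn_integral_mono) (auto simp: ball_avg_def)
  also have "\<dots> = ennreal (C\<^sup>2) * (\<integral>\<^sup>+ x. (f x)\<^sup>2 \<partial>M)"
    using C_pos by (subst nn_integral_multc) (auto simp: ennreal_mult' power2_eq_square mult_ac)
  finally show ?thesis .
qed

definition maximal_on :: "int set \<Rightarrow> ('a \<Rightarrow> ennreal) \<Rightarrow> 'a \<Rightarrow> ennreal" where
  "maximal_on F f x = (SUP j\<in>F. ball_avg j f x)"

lemma maximal_on_measurable [measurable]:
  "f \<in> borel_measurable M \<Longrightarrow> maximal_on F f \<in> borel_measurable M"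
  unfolding maximal_on_def[abs_def] by (intro borel_measurable_SUP countableI_type ball_avg_measurable) auto

text \<open>The dependence on \<open>card F\<close> is harmless: the bound serves to know that the
  best constant is finite, without which the self-improving inequality could not be solved for
  it.\<close>

lemma maximal_on_crude:
  assumes fin: "finite F" and [measurable]: "f \<in> borel_measurable M"
  shows "(\<integral>\<^sup>+ x. (maximal_on F f x)\<^sup>2 \<partial>M) \<le> ennreal (card F * C\<^sup>2) * (\<integral>\<^sup>+ x. (f x)\<^sup>2 \<partial>M)"
proof -
  have "(maximal_on F f x)\<^sup>2 \<le> (\<Sum>j\<in>F. (ball_avg j f x)\<^sup>2)" for x
  proof (cases "F = {}")
    case False
    then obtain j where j: "j \<in> F" "maximal_on F f x = ball_avg j f x"
      using fin unfolding maximal_on_def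
      by (metis (no_types, lifting) cSup_eq_Max finite_imageI Max_in image_is_empty imageE)
    then show ?thesis using fin
      by (auto intro!: member_le_sum)
  qed (simp add: maximal_on_def bot_ennreal)
  then have "(\<integral>\<^sup>+ x. (maximal_on F f x)\<^sup>2 \<partial>M) \<le> (\<integral>\<^sup>+ x. (\<Sum>j\<in>F. (ball_avg j f x)\<^sup>2) \<partial>M)"
    by (intro nn_integral_mono)
  also have "\<dots> = (\<Sum>j\<in>F. \<integral>\<^sup>+ x. (ball_avg j f x)\<^sup>2 \<partial>M)"
    by (intro nn_integral_sum) auto
  also have "\<dots> \<le> (\<Sum>j\<in>F. ennreal (C\<^sup>2) * (\<integral>\<^sup>+ x. (f x)\<^sup>2 \<partial>M))"
    by (intro sum_mono nn_integral_ball_avg_power2_le) auto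
  also have "\<dots> = ennreal (card F * C\<^sup>2) * (\<integral>\<^sup>+ x. (f x)\<^sup>2 \<partial>M)"
    by (simp add: ennreal_mult ennreal_of_nat_eq_real_of_nat mult_ac)
  finally show ?thesis .
qed

text \<open>
  TT* argument: \<open>maximal_on\<close> is linearised as \<open>f \<mapsto> \<Sum>j. indicator (E j) * ball_avg j f\<close>.  The composition of this
  operator with its adjoint is again dominated by ball averages, whence a bound of the norm by the square
  root of itself.
\<close>

lemma maximal_on_self_improve:
  assumes a0: "a \<ge> 0"
    and bound: "\<And>f. f \<in> borel_measurable M \<Longrightarrow> (\<integral>\<^sup>+ x. (f x)\<^sup>2 \<partial>M) < top \<Longrightarrow>
      (\<integral>\<^sup>+ x. (maximal_on {l..u} f x)\<^sup>2 \<partial>M) \<le> ennreal a * (\<integral>\<^sup>+ x. (f x)\<^sup>2 \<partial>M)"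
    and [measurable]: "f \<in> borel_measurable M" and fin: "(\<integral>\<^sup>+ x. (f x)\<^sup>2 \<partial>M) < top"
  shows "(\<integral>\<^sup>+ x. (maximal_on {l..u} f x)\<^sup>2 \<partial>M)
    \<le> ennreal (2 * (C * 2 ^ m) * sqrt (2 * (a + C\<^sup>2))) * (\<integral>\<^sup>+ x. (f x)\<^sup>2 \<partial>M)"
proof (cases "l \<le> u")
  case False
  then show ?thesis by (simp add: maximal_on_def bot_ennreal)
next
  case lu: True
  define F where "F = {l..u}"
  have F: "finite F" "F \<noteq> {}" using lu by (auto simp: F_def)
  define N where "N g = (\<integral>\<^sup>+ x. (g x)\<^sup>2 \<partial>M)" for g :: "'a \<Rightarrow> ennreal"
  define K where "K = C * 2 ^ m"
  have K0: "K > 0" using C_pos by (simp add: K_def)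
  define h where "h = maximal_on F f"
  have [measurable]: "h \<in> borel_measurable M" unfolding h_def by simp
  \<comment> \<open>The smallest index attaining the maximum: the strict inequality breaks ties, so
    the sets \<open>E j\<close> with \<open>j\<close> in \<open>F\<close> partition the
    space.\<close>
  define E where "E j = {x. (\<forall>i\<in>F. ball_avg i f x \<le> ball_avg j f x) \<and> (\<forall>i\<in>F. i < j \<longrightarrow> ball_avg i f x < ball_avg j f x)}" for j
  have E_meas [measurable]: "E j \<in> sets M" for j
  proof -
    have "{x\<in>space M. (\<forall>i\<in>F. ball_avg i f x \<le> ball_avg j f x) \<and> (\<forall>i\<in>{i\<in>F. i < j}. ball_avg i f x < ball_avg j f x)} \<in> sets M"
      using F by measurable
    also have "{x\<in>space M. (\<forall>i\<in>F. ball_avg i f x \<le> ball_avg j f x) \<and> (\<forall>i\<in>{i\<in>F. i < j}. ball_avg i f x < ball_avg j f x)} = E j"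
      by (auto simp: E_def space_UNIV)
    finally show ?thesis .
  qed
  define hh where "hh j x = indicator (E j) x * h x" for j x
  have [measurable]: "hh j \<in> borel_measurable M" for j unfolding hh_def by measurable
  have h_on_E: "h x = ball_avg j f x" if "x \<in> E j" "j \<in> F" for x j
    unfolding h_def maximal_on_def
    by (intro antisym SUP_least SUP_upper that) (use that in \<open>auto simp: E_def\<close>)
  have one_E: "(\<Sum>j\<in>F. indicator (E j) x) = (1::ennreal)" for x
  proof -
    define S where "S = {j\<in>F. \<forall>i\<in>F. ball_avg i f x \<le> ball_avg j f x}"
    have "Max ((\<lambda>i. ball_avg i f x) ` F) \<in> (\<lambda>i. ball_avg i f x) ` F"
      using F by (intro Max_in) auto
    then obtain j where "j \<in> F" "ball_avg j f x = Max ((\<lambda>i. ball_avg i f x) ` F)" by auto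
    then have "j \<in> S" using F by (auto simp: S_def)
    then have S: "finite S" "S \<noteq> {}" using F by (auto simp: S_def)
    have "x \<in> E j \<longleftrightarrow> j = Min S" if "j \<in> F" for j
    proof
      assume "x \<in> E j"
      then have "j \<in> S" using that by (auto simp: E_def S_def)
      moreover have "j \<le> i" if "i \<in> S" for i
        using \<open>x \<in> E j\<close> \<open>j \<in> F\<close> that by (force simp: E_def S_def not_le[symmetric])
      ultimately show "j = Min S" using S by (intro Min_eqI[symmetric]) auto
    next
      assume j: "j = Min S"
      then have jS: "j \<in> S" using S Min_in by blast
      have "ball_avg i f x < ball_avg j f x" if "i \<in> F" "i < j" for i
      proof (rule ccontr)
        assume "\<not> ball_avg i f x < ball_avg j f x"
        then have "i \<in> S" using jS that by (auto simp: S_def not_less intro: order_trans)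
        then have "j \<le> i" using j S by simp
        then show False using that by simp
      qed
      then show "x \<in> E j" using jS by (auto simp: E_def S_def)
    qed
    then have "(\<Sum>j\<in>F. indicator (E j) x) = (\<Sum>j\<in>F. if j = Min S then 1 else (0::ennreal))"
      by (intro sum.cong) (auto simp: indicator_def)
    also have "\<dots> = 1" using F S Min_in[of S] by (auto simp: S_def)
    finally show ?thesis .
  qed
  have sum_hh: "(\<Sum>j\<in>F. hh j x) = h x" for x
    using one_E[of x] by (simp add: hh_def sum_distrib_right[symmetric])
  \<comment> \<open>The adjoint of the linearised operator, applied to \<open>h\<close>; it has this
    form because each \<open>ball_avg j\<close> is self-adjoint.\<close>
  define g where "g x = (\<Sum>j\<in>F. ball_avg j (hh j) x)" for x
  have [measurable]: "g \<in> borel_measurable M" unfolding g_def by measurable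
  have Nh: "N h = (\<integral>\<^sup>+ x. f x * g x \<partial>M)"
  proof -
    have "N h = (\<integral>\<^sup>+ x. (\<Sum>j\<in>F. hh j x * ball_avg j f x) \<partial>M)"
      unfolding N_def
    proof (intro nn_integral_cong)
      fix x
      have "(h x)\<^sup>2 = (\<Sum>j\<in>F. hh j x * h x)"
        using sum_hh[of x] by (simp add: power2_eq_square sum_distrib_right[symmetric])
      also have "\<dots> = (\<Sum>j\<in>F. hh j x * ball_avg j f x)"
        by (intro sum.cong refl) (auto simp: hh_def h_on_E indicator_def)
      finally show "(h x)\<^sup>2 = (\<Sum>j\<in>F. hh j x * ball_avg j f x)" .
    qed
    also have "\<dots> = (\<Sum>j\<in>F. \<integral>\<^sup>+ x. hh j x * ball_avg j f x \<partial>M)"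
      by (intro nn_integral_sum) measurable
    also have "\<dots> = (\<Sum>j\<in>F. \<integral>\<^sup>+ x. f x * ball_avg j (hh j) x \<partial>M)"
      by (intro sum.cong refl ball_avg_adjoint) auto
    also have "\<dots> = (\<integral>\<^sup>+ x. f x * g x \<partial>M)"
      unfolding g_def sum_distrib_left by (intro nn_integral_sum[symmetric]) measurable
    finally show ?thesis .
  qed
  \<comment> \<open>Composition raises the scale by one, so \<open>ball_avg (i + 1) h\<close> has to
    be dominated for all \<open>i\<close> in \<open>F\<close>. Only \<open>i = u\<close> leads out
    of \<open>F\<close>, whence the additional term.\<close>
  define GG where "GG x = maximal_on F h x + ball_avg (u + 1) h x" for x
  have [measurable]: "GG \<in> borel_measurable M" unfolding GG_def by measurable
  define P where "P = (\<integral>\<^sup>+ x. h x * GG x \<partial>M)"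
  have Ng: "N g \<le> ennreal (2 * K) * P"
  proof -
    define t where "t i j = (\<integral>\<^sup>+ x. hh i x * ball_avg (max i j + 1) (hh j) x \<partial>M)" for i j
    have t_sym: "t i j = t j i" for i j
      unfolding t_def by (subst ball_avg_adjoint) (auto simp: max.commute)
    have "N g = (\<integral>\<^sup>+ x. (\<Sum>i\<in>F. \<Sum>j\<in>F. ball_avg j (hh j) x * ball_avg i (hh i) x) \<partial>M)"
      unfolding N_def g_def by (simp add: power2_eq_square sum_product mult.commute)
    also have "\<dots> = (\<Sum>i\<in>F. \<Sum>j\<in>F. \<integral>\<^sup>+ x. ball_avg j (hh j) x * ball_avg i (hh i) x \<partial>M)"
      by (subst nn_integral_sum, measurable, intro sum.cong refl nn_integral_sum, measurable)
    also have "\<dots> = (\<Sum>i\<in>F. \<Sum>j\<in>F. \<integral>\<^sup>+ x. hh i x * ball_avg i (ball_avg j (hh j)) x \<partial>M)"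
      by (intro sum.cong refl ball_avg_adjoint) measurable
    also have "\<dots> \<le> (\<Sum>i\<in>F. \<Sum>j\<in>F. ennreal K * t i j)"
    proof (intro sum_mono)
      fix i j
      have "(\<integral>\<^sup>+ x. hh i x * ball_avg i (ball_avg j (hh j)) x \<partial>M)
          \<le> (\<integral>\<^sup>+ x. hh i x * (ennreal K * ball_avg (max i j + 1) (hh j) x) \<partial>M)"
        unfolding K_def by (intro nn_integral_mono mult_left_mono ball_avg_comp_le) auto
      also have "\<dots> = ennreal K * t i j"
        unfolding t_def by (subst nn_integral_cmult[symmetric]) (auto simp: mult_ac)
      finally show "(\<integral>\<^sup>+ x. hh i x * ball_avg i (ball_avg j (hh j)) x \<partial>M) \<le> ennreal K * t i j" .
    qed
    also have "\<dots> = ennreal K * (\<Sum>i\<in>F. \<Sum>j\<in>F. t i j)"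
      by (simp add: sum_distrib_left)
    \<comment> \<open>By symmetry the pairs with \<open>j \<le> i\<close> suffice. For them the
      scale depends on \<open>i\<close> alone, so the sum over \<open>j\<close> reassembles
      \<open>h\<close>. The diagonal is counted twice, which an upper bound allows.\<close>
    also have "(\<Sum>i\<in>F. \<Sum>j\<in>F. t i j)
        \<le> (\<Sum>i\<in>F. \<Sum>j\<in>F. (if j \<le> i then t i j else 0) + (if i \<le> j then t i j else 0))"
      by (intro sum_mono) auto
    also have "\<dots> = (\<Sum>i\<in>F. \<Sum>j\<in>F. if j \<le> i then t i j else 0) + (\<Sum>i\<in>F. \<Sum>j\<in>F. if i \<le> j then t i j else 0)"
      by (simp add: sum.distrib)
    also have "(\<Sum>i\<in>F. \<Sum>j\<in>F. if i \<le> j then t i j else 0) = (\<Sum>i\<in>F. \<Sum>j\<in>F. if j \<le> i then t i j else 0)"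
      by (subst sum.swap) (simp add: t_sym cong: if_cong)
    also have "(\<Sum>i\<in>F. \<Sum>j\<in>F. if j \<le> i then t i j else 0) \<le> P"
    proof -
      have "(\<Sum>i\<in>F. \<Sum>j\<in>F. if j \<le> i then t i j else 0)
          \<le> (\<Sum>i\<in>F. \<Sum>j\<in>F. \<integral>\<^sup>+ x. hh i x * ball_avg (i + 1) (hh j) x \<partial>M)"
        by (intro sum_mono) (auto simp: t_def max_def)
      also have "\<dots> = (\<integral>\<^sup>+ x. (\<Sum>i\<in>F. hh i x * (\<Sum>j\<in>F. ball_avg (i + 1) (hh j) x)) \<partial>M)"
        unfolding sum_distrib_left
        by (subst nn_integral_sum, measurable, intro sum.cong refl nn_integral_sum[symmetric], measurable)
      also have "\<dots> \<le> P"
        unfolding P_def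
      proof (intro nn_integral_mono)
        fix x
        have "(\<Sum>i\<in>F. hh i x * (\<Sum>j\<in>F. ball_avg (i + 1) (hh j) x)) \<le> (\<Sum>i\<in>F. hh i x * GG x)"
        proof (intro sum_mono mult_left_mono)
          fix i assume i: "i \<in> F"
          have "(\<Sum>j\<in>F. ball_avg (i + 1) (hh j) x) = ball_avg (i + 1) h x"
            using ball_avg_sum[of F hh "i + 1" x] sum_hh by simp
          also have "\<dots> \<le> GG x"
          proof (cases "i + 1 \<in> F")
            case True
            then have "ball_avg (i + 1) h x \<le> maximal_on F h x"
              unfolding maximal_on_def by (intro SUP_upper)
            then show ?thesis unfolding GG_def by (simp add: add_increasing2)
          next
            case False
            then have "i = u" using i by (auto simp: F_def)
            then show ?thesis unfolding GG_def by (simp add: add_increasing)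
          qed
          finally show "(\<Sum>j\<in>F. ball_avg (i + 1) (hh j) x) \<le> GG x" .
        qed auto
        also have "\<dots> = h x * GG x" by (simp add: sum_distrib_right[symmetric] sum_hh)
        finally show "(\<Sum>i\<in>F. hh i x * (\<Sum>j\<in>F. ball_avg (i + 1) (hh j) x)) \<le> h x * GG x" .
      qed
      finally show ?thesis .
    qed
    finally have "N g \<le> ennreal K * (P + P)" by (simp add: mult_left_mono add_mono)
    also have "\<dots> = ennreal (2 * K) * P"
      using K0 by (simp add: ennreal_mult' mult_2[symmetric] mult_ac)
    finally show ?thesis .
  qed
  \<comment> \<open>Finiteness lets \<open>bound\<close> be applied to \<open>h\<close> itself and,
    at the end, permits the cancellation of a factor.\<close>
  have Nfin: "N h < top"
  proof -
    have "N h \<le> ennreal (card F * C\<^sup>2) * N f"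
      unfolding N_def h_def by (intro maximal_on_crude F) auto
    also have "\<dots> < top" using fin by (simp add: ennreal_mult_less_top N_def)
    finally show ?thesis .
  qed
  have NG: "N GG \<le> ennreal (2 * (a + C\<^sup>2)) * N h"
  proof -
    have "N GG \<le> (\<integral>\<^sup>+ x. 2 * ((maximal_on F h x)\<^sup>2 + (ball_avg (u + 1) h x)\<^sup>2) \<partial>M)"
      unfolding N_def GG_def by (intro nn_integral_mono power2_add_le_ennreal)
    also have "\<dots> = 2 * (N (maximal_on F h) + N (ball_avg (u + 1) h))"
      unfolding N_def by (subst nn_integral_cmult, measurable, subst nn_integral_add, measurable)
    also have "\<dots> \<le> 2 * (ennreal a * N h + ennreal (C\<^sup>2) * N h)"
      using bound[of h] nn_integral_ball_avg_power2_le[of h "u + 1"] Nfin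
      by (intro mult_left_mono add_mono) (auto simp: N_def F_def)
    also have "\<dots> = ennreal (2 * (a + C\<^sup>2)) * N h"
      using a0 by (simp add: ennreal_mult' ennreal_plus distrib_right mult.assoc)
    finally show ?thesis .
  qed
  \<comment> \<open>Let \<open>H\<close> be the squared norm of \<open>h\<close>. The two instances
    of Cauchy-Schwarz bound \<open>H\<^sup>2\<close> by the squared norm of \<open>f\<close> times a
    multiple of \<open>H\<close>, and one factor \<open>H\<close> cancels.\<close>
  have PP: "P\<^sup>2 \<le> N h * N GG"
    unfolding P_def N_def by (intro Cauchy_Schwarz_nn_integral) auto
  have NN: "(N h)\<^sup>2 \<le> N f * N g"
    unfolding Nh unfolding N_def by (intro Cauchy_Schwarz_nn_integral) auto
  obtain H where H: "N h = ennreal H" "H \<ge> 0" using Nfin by (cases "N h") auto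
  obtain R where R: "N f = ennreal R" "R \<ge> 0" using fin by (cases "N f") (auto simp: N_def)
  have P2: "P\<^sup>2 \<le> ennreal (2 * (a + C\<^sup>2) * H\<^sup>2)"
  proof -
    have "P\<^sup>2 \<le> N h * (ennreal (2 * (a + C\<^sup>2)) * N h)"
      using PP NG by (meson mult_left_mono order_trans zero_le)
    also have "\<dots> = ennreal (2 * (a + C\<^sup>2) * H\<^sup>2)"
    proof -
      have "ennreal H * (ennreal c * ennreal H) = ennreal (c * H\<^sup>2)" if "c \<ge> 0" for c
        using that H by (simp add: ennreal_mult'[symmetric] power2_eq_square mult_ac)
      from this[of "2 * (a + C\<^sup>2)"] show ?thesis unfolding H using a0 by (simp del: ennreal_plus distrib_left_numeral)
    qed
    finally show ?thesis .
  qed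
  have "P < top"
  proof (rule ccontr)
    assume "\<not> P < top"
    then have "P = top" by (simp add: less_top[symmetric])
    then show False using P2 by (simp add: power2_eq_square ennreal_top_mult top_unique)
  qed
  then obtain p where p: "P = ennreal p" "p \<ge> 0" by (cases P) auto
  have "p\<^sup>2 \<le> 2 * (a + C\<^sup>2) * H\<^sup>2"
    using P2 p a0 H by (simp add: ennreal_power ennreal_le_iff)
  then have "p \<le> sqrt (2 * (a + C\<^sup>2)) * H"
    using H by (metis real_le_rsqrt real_sqrt_mult real_sqrt_unique)
  moreover have "H\<^sup>2 \<le> R * (2 * K * p)"
  proof -
    have "(N h)\<^sup>2 \<le> N f * (ennreal (2 * K) * P)"
      using NN Ng by (meson mult_left_mono order_trans zero_le)
    then show ?thesis unfolding H R p using H R p K0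
      by (simp add: ennreal_power ennreal_mult'[symmetric] ennreal_le_iff)
  qed
  ultimately have "H\<^sup>2 \<le> R * (2 * K * (sqrt (2 * (a + C\<^sup>2)) * H))"
    using R K0 by (smt (verit) mult_left_mono mult_nonneg_nonneg)
  then have "H * H \<le> (2 * K * sqrt (2 * (a + C\<^sup>2)) * R) * H"
    by (simp add: power2_eq_square mult_ac)
  then have "H \<le> 2 * K * sqrt (2 * (a + C\<^sup>2)) * R"
    using H R K0 a0 by (cases "H = 0") (auto simp: mult_le_cancel_right)
  then have "N h \<le> ennreal (2 * K * sqrt (2 * (a + C\<^sup>2))) * N f"
    unfolding H R using H R K0 a0 by (subst ennreal_mult'[symmetric]) (auto intro!: ennreal_leI)
  then show ?thesis by (simp add: N_def h_def K_def F_def)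
qed

text \<open>Every \<open>a\<close> with
  \<open>a\<^sup>2 \<le> 8 * K\<^sup>2 * (a + C\<^sup>2)\<close>, where
  \<open>K = C * 2 ^ m\<close>, is at most this number; the inequality is what
  \<open>maximal_on_self_improve\<close> says of the best constant.\<close>

definition maximal_const :: real where
  "maximal_const = 8 * (C * 2 ^ m)\<^sup>2 + C\<^sup>2"

lemma maximal_const_pos: "maximal_const > 0"
  using C_pos by (simp add: maximal_const_def add_nonneg_pos)

lemma maximal_on_bound:
  assumes meas: "f \<in> borel_measurable M" and fin: "(\<integral>\<^sup>+ x. (f x)\<^sup>2 \<partial>M) < top"
  shows "(\<integral>\<^sup>+ x. (maximal_on {l..u} f x)\<^sup>2 \<partial>M) \<le> ennreal maximal_const * (\<integral>\<^sup>+ x. (f x)\<^sup>2 \<partial>M)"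
proof -
  let ?ok = "\<lambda>a. \<forall>f. f \<in> borel_measurable M \<longrightarrow> (\<integral>\<^sup>+ x. (f x)\<^sup>2 \<partial>M) < top \<longrightarrow>
      (\<integral>\<^sup>+ x. (maximal_on {l..u} f x)\<^sup>2 \<partial>M) \<le> ennreal a * (\<integral>\<^sup>+ x. (f x)\<^sup>2 \<partial>M)"
  define S where "S = {a. a \<ge> 0 \<and> ?ok a}"
  have ne: "real (card {l..u}) * C\<^sup>2 \<in> S"
    unfolding S_def
    by (intro CollectI conjI allI impI maximal_on_crude) (auto simp del: card_atLeastAtMost_int)
  have bdd: "bdd_below S" by (intro bdd_belowI[of _ 0]) (auto simp: S_def)
  \<comment> \<open>The best constant. It is itself admissible, since the estimate survives the
    infimum, and the set is nonempty by the crude bound.\<close>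
  define a where "a = Inf S"
  have a0: "a \<ge> 0" unfolding a_def
  proof (rule cInf_greatest)
    show "S \<noteq> {}" using ne by blast
  qed (simp add: S_def)
  have ok: "?ok a"
  proof (intro allI impI)
    fix f :: "'a \<Rightarrow> ennreal" assume f: "f \<in> borel_measurable M" "(\<integral>\<^sup>+ x. (f x)\<^sup>2 \<partial>M) < top"
    obtain R where R: "(\<integral>\<^sup>+ x. (f x)\<^sup>2 \<partial>M) = ennreal R" "R \<ge> 0"
      using f(2) by (cases "(\<integral>\<^sup>+ x. (f x)\<^sup>2 \<partial>M)") auto
    have le: "(\<integral>\<^sup>+ x. (maximal_on {l..u} f x)\<^sup>2 \<partial>M) \<le> ennreal (b * R)" if "b \<in> S" for b
      using that f R by (auto simp: S_def ennreal_mult')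
    then have "(\<integral>\<^sup>+ x. (maximal_on {l..u} f x)\<^sup>2 \<partial>M) < top"
      using ne by (meson ennreal_less_top order_le_less_trans)
    then obtain H where H: "(\<integral>\<^sup>+ x. (maximal_on {l..u} f x)\<^sup>2 \<partial>M) = ennreal H" "H \<ge> 0"
      by (cases "(\<integral>\<^sup>+ x. (maximal_on {l..u} f x)\<^sup>2 \<partial>M)") auto
    have le': "H \<le> b * R" if "b \<in> S" for b
      using le[OF that] H R that by (simp add: S_def ennreal_le_iff)
    have "H \<le> a * R"
    proof (cases "R = 0")
      case True
      then show ?thesis using le'[OF ne] by simp
    next
      case False
      then have "R > 0" using R by simp
      then have "H / R \<le> a"
        unfolding a_def using ne le' by (intro cInf_greatest) (auto simp: field_simps)
      then show ?thesis using \<open>R > 0\<close> by (simp add: field_simps)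
    qed
    then show "(\<integral>\<^sup>+ x. (maximal_on {l..u} f x)\<^sup>2 \<partial>M) \<le> ennreal a * (\<integral>\<^sup>+ x. (f x)\<^sup>2 \<partial>M)"
      unfolding H R using a0 R by (simp add: ennreal_mult'[symmetric] ennreal_leI)
  qed
  define K where "K = C * 2 ^ m"
  have K0: "K > 0" using C_pos by (simp add: K_def)
  \<comment> \<open>The improved constant is admissible as well, so it cannot lie below
    \<open>a\<close>.\<close>
  have "2 * K * sqrt (2 * (a + C\<^sup>2)) \<in> S"
    unfolding S_def K_def using a0 C_pos ok
    by (intro CollectI conjI allI impI maximal_on_self_improve) auto
  then have "a \<le> 2 * K * sqrt (2 * (a + C\<^sup>2))"
    unfolding a_def using bdd by (intro cInf_lower)
  then have "a\<^sup>2 \<le> (2 * K * sqrt (2 * (a + C\<^sup>2)))\<^sup>2"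
    using a0 by (intro power_mono) auto
  then have sq: "a * a \<le> 8 * K\<^sup>2 * (a + C\<^sup>2)"
    using a0 by (simp add: power_mult_distrib power2_eq_square[of a] del: distrib_left_numeral)
  have "a \<le> 8 * K\<^sup>2 + C\<^sup>2"
  proof (rule ccontr)
    assume "\<not> a \<le> 8 * K\<^sup>2 + C\<^sup>2"
    then have lt: "8 * K\<^sup>2 + C\<^sup>2 < a" by simp
    then have apos: "a > 0" by (smt (verit) zero_le_power2)
    have "(8 * K\<^sup>2 + C\<^sup>2) * a < a * a" using lt apos by (intro mult_strict_right_mono)
    moreover have "8 * K\<^sup>2 * C\<^sup>2 \<le> a * C\<^sup>2"
      using lt by (intro mult_right_mono) (smt (verit) zero_le_power2)+
    ultimately show False using sq by (simp add: algebra_simps)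
  qed
  then have "ennreal a \<le> ennreal maximal_const"
    by (intro ennreal_leI) (simp add: maximal_const_def K_def)
  then show ?thesis
    using ok meas fin by (meson mult_right_mono order_trans zero_le)
qed

lemma maximal_measurable [measurable]:
  "f \<in> borel_measurable M \<Longrightarrow> maximal f \<in> borel_measurable M"
  unfolding maximal_def[abs_def] by (intro borel_measurable_SUP countableI_type ball_avg_measurable) auto

text \<open>The windows of scales increase to all of them while the constant stays fixed, so
  monotone convergence applies.\<close>

theorem maximal_bound:
  assumes [measurable]: "f \<in> borel_measurable M" and fin: "(\<integral>\<^sup>+ x. (f x)\<^sup>2 \<partial>M) < top"
  shows "(\<integral>\<^sup>+ x. (maximal f x)\<^sup>2 \<partial>M) \<le> ennreal maximal_const * (\<integral>\<^sup>+ x. (f x)\<^sup>2 \<partial>M)"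
proof -
  define u where "u n = maximal_on {- int n..int n} f" for n
  have inc: "incseq (\<lambda>n. u n x)" for x
    unfolding u_def maximal_on_def by (intro monoI SUP_subset_mono) auto
  have "maximal f x = (SUP n. u n x)" for x
    unfolding maximal_def u_def maximal_on_def
  proof (rule antisym)
    show "(SUP j. ball_avg j f x) \<le> (SUP n. SUP j\<in>{- int n..int n}. ball_avg j f x)"
    proof (rule SUP_least)
      fix j :: int
      show "ball_avg j f x \<le> (SUP n. SUP j\<in>{- int n..int n}. ball_avg j f x)"
        by (rule SUP_upper2[of "nat \<bar>j\<bar>"]) (auto intro!: SUP_upper)
    qed
  qed (auto intro!: SUP_least SUP_upper)
  then have "(maximal f x)\<^sup>2 = (SUP n. (u n x)\<^sup>2)" for x
    using SUP_power2_ennreal[OF inc] by simp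
  then have "(\<integral>\<^sup>+ x. (maximal f x)\<^sup>2 \<partial>M) = (SUP n. \<integral>\<^sup>+ x. (u n x)\<^sup>2 \<partial>M)"
    using inc
    by (simp only:) (intro nn_integral_monotone_convergence_SUP,
        auto simp: u_def incseq_def le_fun_def intro!: power_mono)
  also have "\<dots> \<le> ennreal maximal_const * (\<integral>\<^sup>+ x. (f x)\<^sup>2 \<partial>M)"
    unfolding u_def by (intro SUP_least maximal_on_bound fin) auto
  finally show ?thesis .
qed

end

section \<open>Dyadic families of kernels\<close>

text \<open>Each of the two sides of \<open>i\<close> is indexed injectively by its distance to
  \<open>i\<close> and so contributes at most one geometric series.\<close>

lemma sum_power_abs_diff_le:
  fixes s :: real and i :: int
  assumes s: "0 \<le> s" "s < 1" and F: "finite F"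
  shows "(\<Sum>j\<in>F. s ^ nat \<bar>i - j\<bar>) \<le> 2 / (1 - s)"
proof -
  have half: "(\<Sum>j\<in>G. s ^ nat \<bar>i - j\<bar>) \<le> 1 / (1 - s)"
    if G: "finite G" "inj_on (\<lambda>j. nat \<bar>i - j\<bar>) G" for G
  proof -
    have "(\<Sum>j\<in>G. s ^ nat \<bar>i - j\<bar>) = (\<Sum>n\<in>(\<lambda>j. nat \<bar>i - j\<bar>) ` G. s ^ n)"
      by (subst sum.reindex[OF G(2)]) simp
    also have "\<dots> \<le> (\<Sum>n. s ^ n)"
      using s G by (intro sum_le_suminf summable_geometric) auto
    also have "\<dots> = 1 / (1 - s)" using s by (intro suminf_geometric) simp
    finally show ?thesis .
  qed
  have "(\<Sum>j\<in>F. s ^ nat \<bar>i - j\<bar>) = (\<Sum>j\<in>{j\<in>F. j \<le> i}. s ^ nat \<bar>i - j\<bar>) + (\<Sum>j\<in>{j\<in>F. i < j}. s ^ nat \<bar>i - j\<bar>)"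
    using F by (subst sum.union_disjoint[symmetric]) (auto intro!: sum.cong)
  also have "\<dots> \<le> 1 / (1 - s) + 1 / (1 - s)"
    using F by (intro add_mono half) (auto simp: inj_on_def)
  finally show ?thesis by simp
qed

section \<open>Integral operators and square integrable functions\<close>

definition integral_op :: "'a measure \<Rightarrow> ('a \<Rightarrow> 'a \<Rightarrow> real) \<Rightarrow> ('a \<Rightarrow> real) \<Rightarrow> 'a \<Rightarrow> real" where
  "integral_op M k f x = (\<integral>y. k x y * f y \<partial>M)"

text \<open>Functions, not classes modulo null sets, because Cotlar's inequality is used pointwise.
  \<open>L2_norm\<close> is then a seminorm, which is why \<open>cotlar_stein\<close> is stated for
  an abstract form and seminorm.\<close>

definition L2 :: "'a measure \<Rightarrow> ('a \<Rightarrow> real) set" where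
  "L2 M = {f \<in> borel_measurable M. (\<integral>\<^sup>+x. ennreal ((f x)\<^sup>2) \<partial>M) < top}"

text \<open>\<open>enn2real\<close> sends infinity to 0, so the value is meaningful on
  \<open>L2\<close> only.\<close>

definition L2_norm :: "'a measure \<Rightarrow> ('a \<Rightarrow> real) \<Rightarrow> real" where
  "L2_norm M f = sqrt (enn2real (\<integral>\<^sup>+x. ennreal ((f x)\<^sup>2) \<partial>M))"

lemma L2_measurable: "f \<in> L2 M \<Longrightarrow> f \<in> borel_measurable M"
  by (simp add: L2_def)

lemma ennreal_abs_power2: "(ennreal \<bar>x\<bar>)\<^sup>2 = ennreal (x\<^sup>2)"
  by (simp add: ennreal_power)

lemma L2_norm_eq:
  "f \<in> L2 M \<Longrightarrow> (\<integral>\<^sup>+x. ennreal ((f x)\<^sup>2) \<partial>M) = ennreal ((L2_norm M f)\<^sup>2)"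
  by (simp add: L2_norm_def L2_def enn2real_nonneg)

lemma L2_norm_nonneg: "L2_norm M f \<ge> 0"
  by (simp add: L2_norm_def enn2real_nonneg)

text \<open>Going through the nonnegative integral yields membership along with the bound and so
  rules out the default value of \<open>enn2real\<close>.\<close>

lemma L2_normI:
  assumes f: "f \<in> borel_measurable M" and b: "b \<ge> 0"
    and le: "(\<integral>\<^sup>+x. ennreal ((f x)\<^sup>2) \<partial>M) \<le> ennreal (b\<^sup>2)"
  shows "f \<in> L2 M" "L2_norm M f \<le> b"
proof -
  show "f \<in> L2 M" using f le by (auto simp: L2_def intro: order_le_less_trans)
  have "enn2real (\<integral>\<^sup>+x. ennreal ((f x)\<^sup>2) \<partial>M) \<le> b\<^sup>2"
    using le by (intro enn2real_leI) auto
  then have "L2_norm M f \<le> sqrt (b\<^sup>2)"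
    unfolding L2_norm_def by (rule real_sqrt_le_mono)
  then show "L2_norm M f \<le> b" using b by simp
qed

lemma L2_zero: "(\<lambda>x. 0) \<in> L2 M"
  by (simp add: L2_def)

lemma L2_add:
  assumes "f \<in> L2 M" "g \<in> L2 M"
  shows "(\<lambda>x. f x + g x) \<in> L2 M"
proof -
  have [measurable]: "f \<in> borel_measurable M" "g \<in> borel_measurable M"
    using assms by (auto intro: L2_measurable)
  have "(\<integral>\<^sup>+x. ennreal ((f x + g x)\<^sup>2) \<partial>M) \<le> (\<integral>\<^sup>+x. 2 * (ennreal ((f x)\<^sup>2) + ennreal ((g x)\<^sup>2)) \<partial>M)"
  proof (intro nn_integral_mono)
    fix x
    have "ennreal ((f x + g x)\<^sup>2) = (ennreal \<bar>f x + g x\<bar>)\<^sup>2" by (simp add: ennreal_abs_power2)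
    also have "\<dots> \<le> (ennreal \<bar>f x\<bar> + ennreal \<bar>g x\<bar>)\<^sup>2"
      by (intro power_mono) (auto simp: ennreal_plus[symmetric] simp del: ennreal_plus intro!: ennreal_leI)
    also have "\<dots> \<le> 2 * ((ennreal \<bar>f x\<bar>)\<^sup>2 + (ennreal \<bar>g x\<bar>)\<^sup>2)" by (rule power2_add_le_ennreal)
    finally show "ennreal ((f x + g x)\<^sup>2) \<le> 2 * (ennreal ((f x)\<^sup>2) + ennreal ((g x)\<^sup>2))"
      by (simp add: ennreal_abs_power2)
  qed
  also have "\<dots> = 2 * ((\<integral>\<^sup>+x. ennreal ((f x)\<^sup>2) \<partial>M) + (\<integral>\<^sup>+x. ennreal ((g x)\<^sup>2) \<partial>M))"
    by (subst nn_integral_cmult, measurable, subst nn_integral_add, measurable)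
  also have "\<dots> < top"
    using assms by (simp add: L2_def ennreal_mult_less_top)
  finally show ?thesis by (simp add: L2_def)
qed

lemma L2_nn_product:
  assumes "f \<in> L2 M" "g \<in> L2 M"
  shows "(\<integral>\<^sup>+x. ennreal \<bar>f x * g x\<bar> \<partial>M) \<le> ennreal (L2_norm M f * L2_norm M g)"
proof -
  have [measurable]: "f \<in> borel_measurable M" "g \<in> borel_measurable M"
    using assms by (auto intro: L2_measurable)
  let ?P = "\<integral>\<^sup>+x. ennreal \<bar>f x * g x\<bar> \<partial>M"
  have "?P\<^sup>2 = (\<integral>\<^sup>+x. ennreal \<bar>f x\<bar> * ennreal \<bar>g x\<bar> \<partial>M)\<^sup>2"
    by (simp add: abs_mult ennreal_mult')
  also have "\<dots> \<le> (\<integral>\<^sup>+x. (ennreal \<bar>f x\<bar>)\<^sup>2 \<partial>M) * (\<integral>\<^sup>+x. (ennreal \<bar>g x\<bar>)\<^sup>2 \<partial>M)"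
    by (intro Cauchy_Schwarz_nn_integral) auto
  also have "\<dots> = ennreal ((L2_norm M f * L2_norm M g)\<^sup>2)"
    using assms by (simp add: ennreal_abs_power2 L2_norm_eq ennreal_mult'[symmetric] power_mult_distrib)
  finally have le: "?P\<^sup>2 \<le> ennreal ((L2_norm M f * L2_norm M g)\<^sup>2)" .
  show ?thesis
  proof (cases ?P)
    case (real r)
    then have "r\<^sup>2 \<le> (L2_norm M f * L2_norm M g)\<^sup>2"
      using le by (simp add: ennreal_power ennreal_le_iff)
    then have "r \<le> L2_norm M f * L2_norm M g"
      by (rule power2_le_imp_le) (simp add: L2_norm_nonneg)
    then show ?thesis unfolding real by (intro ennreal_leI)
  next
    case top
    then show ?thesis using le by (simp add: power2_eq_square ennreal_top_mult top_unique)
  qed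
qed

lemma L2_integrable_product:
  assumes "f \<in> L2 M" "g \<in> L2 M"
  shows "integrable M (\<lambda>x. f x * g x)"
proof (rule integrableI_bounded)
  show "(\<lambda>x. f x * g x) \<in> borel_measurable M"
    using L2_measurable[OF assms(1)] L2_measurable[OF assms(2)] by (intro borel_measurable_times)
  show "(\<integral>\<^sup>+x. ennreal (norm (f x * g x)) \<partial>M) < \<infinity>"
    using L2_nn_product[OF assms] by (auto intro: order_le_less_trans)
qed

lemma L2_Cauchy_Schwarz:
  assumes "f \<in> L2 M" "g \<in> L2 M"
  shows "\<bar>\<integral>x. f x * g x \<partial>M\<bar> \<le> L2_norm M f * L2_norm M g"
proof -
  have "ennreal \<bar>\<integral>x. f x * g x \<partial>M\<bar> \<le> (\<integral>\<^sup>+x. ennreal \<bar>f x * g x\<bar> \<partial>M)"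
    using integral_norm_bound_ennreal[OF L2_integrable_product[OF assms]] by simp
  also note L2_nn_product[OF assms]
  finally show ?thesis by (simp add: ennreal_le_iff L2_norm_nonneg)
qed

lemma L2_inner_self:
  assumes "f \<in> L2 M"
  shows "(\<integral>x. f x * f x \<partial>M) = (L2_norm M f)\<^sup>2"
proof -
  have "f \<in> borel_measurable M" using assms by (rule L2_measurable)
  then have "(\<integral>x. f x * f x \<partial>M) = enn2real (\<integral>\<^sup>+x. ennreal (f x * f x) \<partial>M)"
    by (intro integral_eq_nn_integral) auto
  then show ?thesis
    by (simp add: L2_norm_def enn2real_nonneg power2_eq_square)
qed

section \<open>Functions and kernels dominated by a single ball kernel\<close>

context growth_space
begin

text \<open>One inequality holds both the size and the support condition, and integrated against a
  function it gives a multiple of a ball average directly.\<close>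

definition bump_at :: "real \<Rightarrow> int \<Rightarrow> 'a \<Rightarrow> ('a \<Rightarrow> real) \<Rightarrow> bool" where
  "bump_at c j x p \<longleftrightarrow> p \<in> borel_measurable M \<and> (\<forall>z. ennreal \<bar>p z\<bar> \<le> ennreal c * ball_kernel j x z)"

lemma bump_atI:
  assumes "p \<in> borel_measurable M" "c \<ge> 0" "\<And>z. d x z < 2 powi j \<Longrightarrow> \<bar>p z\<bar> \<le> c * weight j"
    "\<And>z. d x z \<ge> 2 powi j \<Longrightarrow> p z = 0"
  shows "bump_at c j x p"
  using assms weight_pos[of j]
  by (auto simp: bump_at_def ball_kernel_def ennreal_mult'[symmetric] not_less intro!: ennreal_leI)

lemma bump_at_le: "bump_at c j x p \<Longrightarrow> c \<ge> 0 \<Longrightarrow> \<bar>p z\<bar> \<le> c * weight j"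
proof -
  assume b: "bump_at c j x p" and c: "c \<ge> 0"
  have "ennreal \<bar>p z\<bar> \<le> ennreal c * ball_kernel j x z" using b by (simp add: bump_at_def)
  also have "\<dots> \<le> ennreal c * ennreal (weight j)"
    by (intro mult_left_mono) (auto simp: ball_kernel_def)
  also have "\<dots> = ennreal (c * weight j)" using c by (simp add: ennreal_mult')
  finally show ?thesis using c weight_pos[of j] by (simp add: ennreal_le_iff)
qed

lemma bump_at_zero: "bump_at c j x p \<Longrightarrow> d x z \<ge> 2 powi j \<Longrightarrow> p z = 0"
  by (auto simp: bump_at_def ball_kernel_def dest!: spec[of _ z])

lemma bump_at_nn_integral_le:
  assumes b: "bump_at c j x p" and c: "c \<ge> 0"
  shows "(\<integral>\<^sup>+z. ennreal \<bar>p z\<bar> \<partial>M) \<le> ennreal (c * C)"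
proof -
  have "(\<integral>\<^sup>+z. ennreal \<bar>p z\<bar> \<partial>M) \<le> (\<integral>\<^sup>+z. ennreal c * ball_kernel j x z \<partial>M)"
    using b by (intro nn_integral_mono) (simp add: bump_at_def)
  also have "\<dots> = ennreal c * (\<integral>\<^sup>+z. ball_kernel j x z \<partial>M)" by (intro nn_integral_cmult) simp
  also have "\<dots> \<le> ennreal c * ennreal C" by (intro mult_left_mono nn_integral_ball_kernel_le) auto
  finally show ?thesis using c by (simp add: ennreal_mult')
qed

lemma bump_at_integrable:
  assumes b: "bump_at c j x p" and c: "c \<ge> 0"
  shows "integrable M p"
  using b bump_at_nn_integral_le[OF b c]
  by (intro integrableI_bounded) (auto simp: bump_at_def intro: order_le_less_trans)

lemma ball_avg_power2_le:
  assumes [measurable]: "g \<in> borel_measurable M"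
  shows "(ball_avg j g x)\<^sup>2 \<le> ennreal (weight j * C) * (\<integral>\<^sup>+y. (g y)\<^sup>2 \<partial>M)"
proof -
  have "(ball_avg j g x)\<^sup>2 \<le> (\<integral>\<^sup>+y. (ball_kernel j x y)\<^sup>2 \<partial>M) * (\<integral>\<^sup>+y. (g y)\<^sup>2 \<partial>M)"
    unfolding ball_avg_def by (intro Cauchy_Schwarz_nn_integral) auto
  also have "(\<integral>\<^sup>+y. (ball_kernel j x y)\<^sup>2 \<partial>M) = (\<integral>\<^sup>+y. ennreal (weight j) * ball_kernel j x y \<partial>M)"
    by (intro nn_integral_cong) (auto simp: ball_kernel_def power2_eq_square)
  also have "\<dots> = ennreal (weight j) * (\<integral>\<^sup>+y. ball_kernel j x y \<partial>M)"
    by (intro nn_integral_cmult) simp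
  also have "\<dots> \<le> ennreal (weight j) * ennreal C" by (intro mult_left_mono nn_integral_ball_kernel_le) auto
  also have "\<dots> = ennreal (weight j * C)" using C_pos weight_pos[of j] by (simp add: ennreal_mult')
  finally show ?thesis by (simp add: mult_right_mono)
qed

text \<open>Finite at every point, since the ball kernel is square integrable in each variable.
  Operators with bump kernels are therefore given by absolutely convergent integrals everywhere, and
  their sums may be formed pointwise.\<close>

lemma L2_ball_avg_finite:
  assumes f: "f \<in> L2 M"
  shows "ball_avg j (\<lambda>y. ennreal \<bar>f y\<bar>) x < top"
proof (rule ccontr)
  assume "\<not> ?thesis"
  then have "ball_avg j (\<lambda>y. ennreal \<bar>f y\<bar>) x = top" by (simp add: less_top[symmetric])
  moreover have "(ball_avg j (\<lambda>y. ennreal \<bar>f y\<bar>) x)\<^sup>2 \<le> ennreal (weight j * C) * (\<integral>\<^sup>+y. ennreal ((f y)\<^sup>2) \<partial>M)"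
    using ball_avg_power2_le[of "\<lambda>y. ennreal \<bar>f y\<bar>" j x] L2_measurable[OF f] by (simp add: ennreal_abs_power2)
  ultimately show False
    using f by (simp add: power2_eq_square ennreal_top_mult top_unique L2_def ennreal_mult_eq_top_iff)
qed

lemma bump_at_product:
  assumes b: "bump_at c j x p" and f: "f \<in> L2 M"
  shows "(\<integral>\<^sup>+y. ennreal \<bar>p y * f y\<bar> \<partial>M) \<le> ennreal c * ball_avg j (\<lambda>y. ennreal \<bar>f y\<bar>) x"
    and "integrable M (\<lambda>y. p y * f y)"
    and "ennreal \<bar>\<integral>y. p y * f y \<partial>M\<bar> \<le> ennreal c * ball_avg j (\<lambda>y. ennreal \<bar>f y\<bar>) x"
proof -
  have [measurable]: "f \<in> borel_measurable M" "p \<in> borel_measurable M"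
    using b f by (auto simp: bump_at_def L2_measurable)
  have "(\<integral>\<^sup>+y. ennreal \<bar>p y * f y\<bar> \<partial>M) \<le> (\<integral>\<^sup>+y. ennreal c * (ball_kernel j x y * ennreal \<bar>f y\<bar>) \<partial>M)"
    using b unfolding bump_at_def
    by (intro nn_integral_mono) (simp add: abs_mult ennreal_mult' mult.assoc[symmetric] mult_right_mono)
  also have "\<dots> = ennreal c * ball_avg j (\<lambda>y. ennreal \<bar>f y\<bar>) x"
    unfolding ball_avg_def by (intro nn_integral_cmult) simp
  finally show 1: "(\<integral>\<^sup>+y. ennreal \<bar>p y * f y\<bar> \<partial>M) \<le> ennreal c * ball_avg j (\<lambda>y. ennreal \<bar>f y\<bar>) x" .
  also have "\<dots> < top" using L2_ball_avg_finite[OF f] by (simp add: ennreal_mult_less_top)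
  finally show 2: "integrable M (\<lambda>y. p y * f y)"
    by (intro integrableI_bounded) auto
  show "ennreal \<bar>\<integral>y. p y * f y \<partial>M\<bar> \<le> ennreal c * ball_avg j (\<lambda>y. ennreal \<bar>f y\<bar>) x"
    using integral_norm_bound_ennreal[OF 2] 1 by simp
qed

definition bump_kernel :: "real \<Rightarrow> int \<Rightarrow> ('a \<Rightarrow> 'a \<Rightarrow> real) \<Rightarrow> bool" where
  "bump_kernel c j k \<longleftrightarrow> (\<lambda>p. k (fst p) (snd p)) \<in> borel_measurable (M \<Otimes>\<^sub>M M) \<and>
     (\<forall>x y. ennreal \<bar>k x y\<bar> \<le> ennreal c * ball_kernel j x y)"

lemma bump_kernel_measurable:
  assumes "bump_kernel c j k" "f \<in> measurable N M" "g \<in> measurable N M"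
  shows "(\<lambda>z. k (f z) (g z)) \<in> borel_measurable N"
proof -
  have "(\<lambda>p. k (fst p) (snd p)) \<in> borel_measurable (M \<Otimes>\<^sub>M M)" using assms(1) by (simp add: bump_kernel_def)
  from measurable_compose[OF measurable_Pair[OF assms(2,3)] this] show ?thesis by simp
qed

lemma bump_kernel_at:
  assumes k: "bump_kernel c j k"
  shows "bump_at c j x (k x)"
proof -
  have "(\<lambda>y. k x y) \<in> borel_measurable M"
    by (rule bump_kernel_measurable[OF k const_measurable measurable_ident_sets[OF refl]])
  then show ?thesis using k by (simp add: bump_at_def bump_kernel_def)
qed

lemma bump_kernel_transpose:
  assumes "bump_kernel c j k"
  shows "bump_kernel c j (\<lambda>x y. k y x)"
proof -
  have "(\<lambda>p. k (snd p) (fst p)) \<in> borel_measurable (M \<Otimes>\<^sub>M M)"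
    by (intro bump_kernel_measurable[OF assms]) auto
  moreover have "ennreal \<bar>k y x\<bar> \<le> ennreal c * ball_kernel j x y" for x y
    using assms ball_kernel_sym[of j x y] by (simp add: bump_kernel_def)
  ultimately show ?thesis by (simp add: bump_kernel_def)
qed

lemma integral_op_le_ball_avg:
  assumes "bump_kernel c j k" "f \<in> L2 M"
  shows "ennreal \<bar>integral_op M k f x\<bar> \<le> ennreal c * ball_avg j (\<lambda>y. ennreal \<bar>f y\<bar>) x"
  unfolding integral_op_def by (intro bump_at_product bump_kernel_at assms)

lemma integral_op_measurable:
  assumes k: "bump_kernel c j k" and f: "f \<in> borel_measurable M"
  shows "integral_op M k f \<in> borel_measurable M"
proof -
  note [measurable] = f
  have [measurable]: "(\<lambda>(x, y). k x y) \<in> borel_measurable (M \<Otimes>\<^sub>M M)"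
    using k by (simp add: bump_kernel_def case_prod_beta')
  show ?thesis unfolding integral_op_def[abs_def] by measurable
qed

lemma L2_of_ball_avg:
  assumes g: "g \<in> borel_measurable M" and f: "f \<in> L2 M" and c: "c \<ge> 0"
    and le: "AE x in M. ennreal \<bar>g x\<bar> \<le> ennreal c * ball_avg j (\<lambda>y. ennreal \<bar>f y\<bar>) x"
  shows "g \<in> L2 M" "L2_norm M g \<le> c * C * L2_norm M f"
proof -
  have [measurable]: "f \<in> borel_measurable M" using f by (rule L2_measurable)
  have "(\<integral>\<^sup>+x. ennreal ((g x)\<^sup>2) \<partial>M) \<le> (\<integral>\<^sup>+x. ennreal (c\<^sup>2) * (ball_avg j (\<lambda>y. ennreal \<bar>f y\<bar>) x)\<^sup>2 \<partial>M)"
  proof (rule nn_integral_mono_AE, use le in eventually_elim)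
    fix x assume "ennreal \<bar>g x\<bar> \<le> ennreal c * ball_avg j (\<lambda>y. ennreal \<bar>f y\<bar>) x"
    then have "(ennreal \<bar>g x\<bar>)\<^sup>2 \<le> (ennreal c * ball_avg j (\<lambda>y. ennreal \<bar>f y\<bar>) x)\<^sup>2"
      by (intro power_mono) auto
    then show "ennreal ((g x)\<^sup>2) \<le> ennreal (c\<^sup>2) * (ball_avg j (\<lambda>y. ennreal \<bar>f y\<bar>) x)\<^sup>2"
      using c by (simp add: ennreal_abs_power2 power_mult_distrib ennreal_power)
  qed
  also have "\<dots> = ennreal (c\<^sup>2) * (\<integral>\<^sup>+x. (ball_avg j (\<lambda>y. ennreal \<bar>f y\<bar>) x)\<^sup>2 \<partial>M)"
    by (intro nn_integral_cmult) simp
  also have "\<dots> \<le> ennreal (c\<^sup>2) * (ennreal (C\<^sup>2) * (\<integral>\<^sup>+x. (ennreal \<bar>f x\<bar>)\<^sup>2 \<partial>M))"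
    by (intro mult_left_mono nn_integral_ball_avg_power2_le) auto
  also have "\<dots> = ennreal ((c * C * L2_norm M f)\<^sup>2)"
    using L2_norm_eq[OF f] by (simp add: ennreal_abs_power2 ennreal_mult'[symmetric] power_mult_distrib mult.assoc)
  finally have *: "(\<integral>\<^sup>+x. ennreal ((g x)\<^sup>2) \<partial>M) \<le> ennreal ((c * C * L2_norm M f)\<^sup>2)" .
  from c C_pos have "c * C * L2_norm M f \<ge> 0" by (simp add: L2_norm_nonneg)
  from L2_normI[OF g this *] show "g \<in> L2 M" "L2_norm M g \<le> c * C * L2_norm M f" by auto
qed

lemma integral_op_L2:
  assumes k: "bump_kernel c j k" and f: "f \<in> L2 M" and c: "c \<ge> 0"
  shows "integral_op M k f \<in> L2 M" "L2_norm M (integral_op M k f) \<le> c * C * L2_norm M f"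
proof -
  have "AE x in M. ennreal \<bar>integral_op M k f x\<bar> \<le> ennreal c * ball_avg j (\<lambda>y. ennreal \<bar>f y\<bar>) x"
    using integral_op_le_ball_avg[OF k f] by simp
  from L2_of_ball_avg[OF integral_op_measurable[OF k L2_measurable[OF f]] f c this]
  show "integral_op M k f \<in> L2 M" "L2_norm M (integral_op M k f) \<le> c * C * L2_norm M f" by auto
qed

lemma integral_op_add:
  assumes k: "bump_kernel c j k" and f: "f \<in> L2 M" "g \<in> L2 M"
  shows "integral_op M k (\<lambda>x. f x + g x) = (\<lambda>x. integral_op M k f x + integral_op M k g x)"
  unfolding integral_op_def using bump_at_product(2)[OF bump_kernel_at[OF k]] f
  by (simp add: distrib_left fun_eq_iff)

text \<open>Fubini; the double integral converges absolutely by Cauchy-Schwarz and the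
  \<open>L2\<close> bound for \<open>ball_avg\<close>.\<close>

lemma integral_op_adjoint:
  assumes k: "bump_kernel c j k" and f: "f \<in> L2 M" and g: "g \<in> L2 M" and c: "c \<ge> 0"
  shows "(\<integral>x. integral_op M k f x * g x \<partial>M) = (\<integral>x. f x * integral_op M (\<lambda>x y. k y x) g x \<partial>M)"
proof -
  have [measurable]: "f \<in> borel_measurable M" "g \<in> borel_measurable M" using f g by (auto intro: L2_measurable)
  have [measurable]: "(\<lambda>(x, y). k x y) \<in> borel_measurable (M \<Otimes>\<^sub>M M)"
    using k by (simp add: bump_kernel_def case_prod_beta')
  let ?F = "\<lambda>x y. k x y * f y * g x"
  have "integrable (M \<Otimes>\<^sub>M M) (case_prod ?F)"
  proof (rule integrableI_bounded)
    show "case_prod ?F \<in> borel_measurable (M \<Otimes>\<^sub>M M)" by measurable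
    have "(\<integral>\<^sup>+p. ennreal (norm (case_prod ?F p)) \<partial>(M \<Otimes>\<^sub>M M)) = (\<integral>\<^sup>+x. \<integral>\<^sup>+y. ennreal \<bar>?F x y\<bar> \<partial>M \<partial>M)"
      by (subst nn_integral_fst[symmetric]) (auto simp: case_prod_beta)
    also have "\<dots> = (\<integral>\<^sup>+x. (\<integral>\<^sup>+y. ennreal \<bar>k x y * f y\<bar> \<partial>M) * ennreal \<bar>g x\<bar> \<partial>M)"
      by (intro nn_integral_cong) (simp add: nn_integral_multc[symmetric] abs_mult ennreal_mult' )
    also have "\<dots> \<le> (\<integral>\<^sup>+x. ennreal c * (ball_avg j (\<lambda>y. ennreal \<bar>f y\<bar>) x * ennreal \<bar>g x\<bar>) \<partial>M)"
      using bump_at_product(1)[OF bump_kernel_at[OF k] f]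
      by (intro nn_integral_mono) (simp add: mult.assoc[symmetric] mult_right_mono)
    also have "\<dots> = ennreal c * (\<integral>\<^sup>+x. ball_avg j (\<lambda>y. ennreal \<bar>f y\<bar>) x * ennreal \<bar>g x\<bar> \<partial>M)"
      by (intro nn_integral_cmult) simp
    also have "\<dots> < top"
    proof -
      let ?P = "\<integral>\<^sup>+x. ball_avg j (\<lambda>y. ennreal \<bar>f y\<bar>) x * ennreal \<bar>g x\<bar> \<partial>M"
      have "?P\<^sup>2 \<le> (\<integral>\<^sup>+x. (ball_avg j (\<lambda>y. ennreal \<bar>f y\<bar>) x)\<^sup>2 \<partial>M) * (\<integral>\<^sup>+x. (ennreal \<bar>g x\<bar>)\<^sup>2 \<partial>M)"
        by (intro Cauchy_Schwarz_nn_integral) auto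
      also have "\<dots> \<le> (ennreal (C\<^sup>2) * (\<integral>\<^sup>+x. (ennreal \<bar>f x\<bar>)\<^sup>2 \<partial>M)) * (\<integral>\<^sup>+x. (ennreal \<bar>g x\<bar>)\<^sup>2 \<partial>M)"
        by (intro mult_right_mono nn_integral_ball_avg_power2_le) auto
      also have "\<dots> < top"
        using L2_norm_eq[OF f] L2_norm_eq[OF g] by (simp add: ennreal_abs_power2 ennreal_mult_less_top)
      finally have "?P < top"
        by (cases ?P) (auto simp: power2_eq_square ennreal_top_mult)
      then show ?thesis by (simp add: ennreal_mult_less_top)
    qed
    finally show "(\<integral>\<^sup>+p. ennreal (norm (case_prod ?F p)) \<partial>(M \<Otimes>\<^sub>M M)) < \<infinity>" by simp
  qed
  then have "(\<integral>y. (\<integral>x. ?F x y \<partial>M) \<partial>M) = (\<integral>x. (\<integral>y. ?F x y \<partial>M) \<partial>M)"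
    by (rule MM.Fubini_integral)
  moreover have "(\<integral>x. ?F x y \<partial>M) = f y * integral_op M (\<lambda>x y. k y x) g y" for y
    unfolding integral_op_def by (subst integral_mult_right_zero[symmetric]) (simp add: mult_ac)
  moreover have "(\<integral>y. ?F x y \<partial>M) = integral_op M k f x * g x" for x
    unfolding integral_op_def by simp
  ultimately show ?thesis by (simp only:)
qed

text \<open>The outer factor is a single function, not a kernel, so that the same identity serves
  the rows of kernels and, later, the tent function against which Cotlar's inequality
  averages.\<close>

lemma integral_op_comp:
  assumes p: "bump_at c i x p" and k: "bump_kernel c' j k" and f: "f \<in> L2 M"
  shows "(\<integral>z. p z * integral_op M k f z \<partial>M) = (\<integral>y. (\<integral>z. p z * k z y \<partial>M) * f y \<partial>M)"
proof -
  have [measurable]: "f \<in> borel_measurable M" "p \<in> borel_measurable M" using f p by (auto simp: bump_at_def intro: L2_measurable)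
  have [measurable]: "(\<lambda>(x, y). k x y) \<in> borel_measurable (M \<Otimes>\<^sub>M M)"
    using k by (simp add: bump_kernel_def case_prod_beta')
  let ?F = "\<lambda>z y. p z * k z y * f y"
  let ?f = "\<lambda>y. ennreal \<bar>f y\<bar>"
  have "integrable (M \<Otimes>\<^sub>M M) (case_prod ?F)"
  proof (rule integrableI_bounded)
    show "case_prod ?F \<in> borel_measurable (M \<Otimes>\<^sub>M M)" by measurable
    have "(\<integral>\<^sup>+q. ennreal (norm (case_prod ?F q)) \<partial>(M \<Otimes>\<^sub>M M)) = (\<integral>\<^sup>+z. \<integral>\<^sup>+y. ennreal \<bar>?F z y\<bar> \<partial>M \<partial>M)"
      by (subst nn_integral_fst[symmetric]) (auto simp: case_prod_beta)
    also have "\<dots> = (\<integral>\<^sup>+z. ennreal \<bar>p z\<bar> * (\<integral>\<^sup>+y. ennreal \<bar>k z y * f y\<bar> \<partial>M) \<partial>M)"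
      by (intro nn_integral_cong) (simp add: nn_integral_cmult[symmetric] abs_mult ennreal_mult' mult.assoc)
    also have "\<dots> \<le> (\<integral>\<^sup>+z. (ennreal c * ball_kernel i x z) * (ennreal c' * ball_avg j ?f z) \<partial>M)"
      using p bump_at_product(1)[OF bump_kernel_at[OF k] f]
      by (intro nn_integral_mono mult_mono) (auto simp: bump_at_def)
    also have "\<dots> = ennreal c * ennreal c' * ball_avg i (ball_avg j ?f) x"
      unfolding ball_avg_def[of i] by (subst nn_integral_cmult[symmetric]) (auto simp: mult_ac)
    also have "\<dots> \<le> ennreal c * ennreal c' * (ennreal (C * 2 ^ m) * ball_avg (max i j + 1) ?f x)"
      by (intro mult_left_mono ball_avg_comp_le) auto
    also have "\<dots> < top" using L2_ball_avg_finite[OF f] by (simp add: ennreal_mult_less_top)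
    finally show "(\<integral>\<^sup>+p. ennreal (norm (case_prod ?F p)) \<partial>(M \<Otimes>\<^sub>M M)) < \<infinity>" by simp
  qed
  then have "(\<integral>y. (\<integral>z. ?F z y \<partial>M) \<partial>M) = (\<integral>z. (\<integral>y. ?F z y \<partial>M) \<partial>M)"
    by (rule MM.Fubini_integral)
  moreover have "(\<integral>y. ?F z y \<partial>M) = p z * integral_op M k f z" for z
    unfolding integral_op_def by (subst integral_mult_right_zero[symmetric]) (simp add: mult_ac)
  ultimately show ?thesis by simp
qed

text \<open>
  The only estimate in which regularity is traded for decay; the almost orthogonality of the dyadic
  pieces and both error terms in Cotlar's inequality come from it.
\<close>

lemma bump_oscillation:
  assumes p: "bump_at c i x p" and c: "c \<ge> 0" and r: "bump_at c' j y r" and c': "c' \<ge> 0" and ij: "i \<le> j"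
    and lip: "\<And>z. \<bar>r z - r x\<bar> \<le> c' * weight j * d z x / 2 powi j"
  shows "ennreal \<bar>\<integral>z. p z * (r z - r x) \<partial>M\<bar>
    \<le> ennreal (c * c' * C * 2 ^ m * (1/2) ^ nat \<bar>i - j\<bar>) * ball_kernel (j + 1) y x"
    and "integrable M (\<lambda>z. p z * r z)"
proof -
  have [measurable]: "p \<in> borel_measurable M" "r \<in> borel_measurable M"
    using p r by (auto simp: bump_at_def)
  have pint: "integrable M p" by (rule bump_at_integrable[OF p c])
  have "integrable M (\<lambda>z. r z * p z)"
    by (rule Bochner_Integration.integrable_bound[OF integrable_mult_right[OF pint, of "c' * weight j"]])
       (use bump_at_le[OF r c'] c' weight_pos[of j] in \<open>auto simp: abs_mult intro!: mult_right_mono\<close>)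
  then show "integrable M (\<lambda>z. p z * r z)" by (simp add: mult.commute)
  let ?e = "c * c' * C * 2 ^ m * (1/2) ^ nat \<bar>i - j\<bar>"
  \<comment> \<open>The Lipschitz bound at scale \<open>j\<close> is multiplied by the radius of the
    support of \<open>p\<close>: the gap between the scales becomes the decay.\<close>
  have scale: "(2::real) powi i / 2 powi j = (1/2) ^ nat \<bar>i - j\<bar>"
  proof -
    have "(2::real) powi j = 2 powi i * 2 powi (j - i)" by (simp add: power_int_add[symmetric])
    moreover have "(2::real) powi (j - i) = 2 ^ nat \<bar>i - j\<bar>" using ij by (simp add: power_int_def)
    ultimately show ?thesis by (simp add: power_divide)
  qed
  show "ennreal \<bar>\<integral>z. p z * (r z - r x) \<partial>M\<bar> \<le> ennreal ?e * ball_kernel (j + 1) y x"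
  proof (cases "d y x < 2 powi (j + 1)")
    case True
    have "norm (\<integral>z. p z * (r z - r x) \<partial>M) \<le> (\<integral>z. (c' * weight j * (1/2) ^ nat \<bar>i - j\<bar>) * \<bar>p z\<bar> \<partial>M)"
    proof (rule order_trans[OF integral_norm_bound integral_mono])
      show "integrable M (\<lambda>z. norm (p z * (r z - r x)))"
        using \<open>integrable M (\<lambda>z. p z * r z)\<close> pint
        by (intro integrable_norm) (simp add: right_diff_distrib)
      show "integrable M (\<lambda>z. c' * weight j * (1 / 2) ^ nat \<bar>i - j\<bar> * \<bar>p z\<bar>)" using pint by simp
      fix z
      show "norm (p z * (r z - r x)) \<le> c' * weight j * (1 / 2) ^ nat \<bar>i - j\<bar> * \<bar>p z\<bar>"
      proof (cases "d x z < 2 powi i")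
        case True
        have "\<bar>r z - r x\<bar> \<le> c' * weight j * d z x / 2 powi j" by (rule lip)
        also have "\<dots> \<le> c' * weight j * 2 powi i / 2 powi j"
          using True c' weight_pos[of j] by (intro divide_right_mono mult_left_mono) (auto simp: d_sym)
        also have "\<dots> = c' * weight j * (1 / 2) ^ nat \<bar>i - j\<bar>" by (metis scale times_divide_eq_right)
        finally show ?thesis by (simp add: abs_mult mult.commute mult_left_mono)
      next
        case False
        then show ?thesis using bump_at_zero[OF p, of z] by simp
      qed
    qed
    also have "\<dots> = (c' * weight j * (1/2) ^ nat \<bar>i - j\<bar>) * (\<integral>z. \<bar>p z\<bar> \<partial>M)" by simp
    also have "(\<integral>z. \<bar>p z\<bar> \<partial>M) \<le> c * C"
    proof -
      have "ennreal (\<integral>z. \<bar>p z\<bar> \<partial>M) = (\<integral>\<^sup>+z. ennreal \<bar>p z\<bar> \<partial>M)"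
        using pint by (intro nn_integral_eq_integral[symmetric]) auto
      then have "ennreal (\<integral>z. \<bar>p z\<bar> \<partial>M) \<le> ennreal (c * C)" using bump_at_nn_integral_le[OF p c] by simp
      then show ?thesis using c C_pos by (subst (asm) ennreal_le_iff) auto
    qed
    finally have "\<bar>\<integral>z. p z * (r z - r x) \<partial>M\<bar> \<le> (c' * weight j * (1/2) ^ nat \<bar>i - j\<bar>) * (c * C)"
      using c' weight_pos[of j] by (simp add: mult_left_mono)
    also have "\<dots> = ?e * weight (j + 1)" using weight_Suc[of j] by simp
    finally show ?thesis
      using True c c' C_pos weight_pos[of "j + 1"]
      by (simp add: ball_kernel_def ennreal_mult'[symmetric] ennreal_leI)
  next
    \<comment> \<open>If \<open>x\<close> is at least twice the radius of \<open>r\<close> away from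
      \<open>y\<close>, then \<open>r\<close> vanishes at \<open>x\<close> and on the support of
      \<open>p\<close>, whose radius is no larger; hence the ball of scale
      \<open>j + 1\<close>.\<close>
    case False
    have z0: "p z * (r z - r x) = 0" for z
    proof (cases "d x z < 2 powi i")
      case True
      have "(2::real) powi i \<le> 2 powi j" "(2::real) powi j > 0" using ij by (auto intro: power_int_increasing)
      moreover have "2 * 2 powi j \<le> d y x" using False by (simp add: power_int_add not_less mult.commute)
      ultimately have "d y z \<ge> 2 powi j" "d y x \<ge> 2 powi j"
        using True d_triangle[of y x z] d_sym[of x z] by linarith+
      then show ?thesis using bump_at_zero[OF r] by simp
    next
      case False
      then show ?thesis using bump_at_zero[OF p, of z] by simp
    qed
    show ?thesis unfolding z0 by simp
  qed
qed

end

lemma sum_fun_eq: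
  fixes g :: "'i \<Rightarrow> 'a \<Rightarrow> real"
  shows "(\<Sum>i\<in>I. g i) = (\<lambda>x. \<Sum>i\<in>I. g i x)"
  by (induction I rule: infinite_finite_induct) (auto simp: fun_eq_iff)

lemma L2_sum:
  assumes "\<And>i. i \<in> I \<Longrightarrow> g i \<in> L2 M"
  shows "(\<lambda>x. \<Sum>i\<in>I. g i x) \<in> L2 M"
  using assms by (induction I rule: infinite_finite_induct) (auto intro: L2_zero L2_add)

context growth_space
begin

text \<open>Cancellation holds off a null set, hence so do the estimates for composed kernels,
  whereas \<open>bump_at\<close> is a condition at every point; the kernel is set to 0 where its
  bound fails.\<close>

lemma bump_at_product_AE:
  assumes h: "h \<in> borel_measurable M" and f: "f \<in> L2 M"
    and le: "AE y in M. ennreal \<bar>h y\<bar> \<le> ennreal c * ball_kernel j x y"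
  shows "ennreal \<bar>\<integral>y. h y * f y \<partial>M\<bar> \<le> ennreal c * ball_avg j (\<lambda>y. ennreal \<bar>f y\<bar>) x"
proof -
  define h' where "h' y = (if ennreal \<bar>h y\<bar> \<le> ennreal c * ball_kernel j x y then h y else 0)" for y
  have q: "(\<lambda>y. ball_kernel j x y) \<in> borel_measurable M" by measurable
  have "{y \<in> space M. ennreal \<bar>h y\<bar> \<le> ennreal c * ball_kernel j x y} \<in> sets M"
    by (intro borel_measurable_le borel_measurable_times_ennreal borel_measurable_const q
        measurable_compose[OF _ measurable_ennreal] borel_measurable_abs h)
  then have h'm: "h' \<in> borel_measurable M"
    unfolding h'_def by (intro measurable_If h borel_measurable_const)
  then have "bump_at c j x h'" by (simp add: bump_at_def) (simp add: h'_def)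
  from bump_at_product(3)[OF this f]
  have "ennreal \<bar>\<integral>y. h' y * f y \<partial>M\<bar> \<le> ennreal c * ball_avg j (\<lambda>y. ennreal \<bar>f y\<bar>) x" .
  moreover have "(\<integral>y. h' y * f y \<partial>M) = (\<integral>y. h y * f y \<partial>M)"
  proof (rule integral_cong_AE)
    show "AE y in M. h' y * f y = h y * f y"
      using le by eventually_elim (simp add: h'_def)
  qed (intro borel_measurable_times h h'm L2_measurable[OF f])+
  ultimately show ?thesis by simp
qed

lemma integral_bump_kernel_measurable:
  assumes p: "p \<in> borel_measurable M" and k: "bump_kernel c j k"
  shows "(\<lambda>y. \<integral>z. p z * k z y \<partial>M) \<in> borel_measurable M"
proof -
  note [measurable] = p
  have [measurable]: "(\<lambda>(y, z). k z y) \<in> borel_measurable (M \<Otimes>\<^sub>M M)"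
    using bump_kernel_transpose[OF k] by (simp add: bump_kernel_def case_prod_beta')
  show ?thesis by measurable
qed

text \<open>The mean zero of \<open>p\<close> makes subtracting the constant \<open>r x\<close> free
  of charge.\<close>

lemma bump_oscillation':
  assumes p: "bump_at c i x p" and c: "c \<ge> 0" and r: "bump_at c' j y r" and c': "c' \<ge> 0" and ij: "i \<le> j"
    and lip: "\<And>z. \<bar>r z - r x\<bar> \<le> c' * weight j * d z x / 2 powi j"
    and cancel: "(\<integral>z. p z \<partial>M) = 0"
  shows "ennreal \<bar>\<integral>z. p z * r z \<partial>M\<bar>
    \<le> ennreal (c * c' * C * 2 ^ m * (1/2) ^ nat \<bar>i - j\<bar>) * ball_kernel (j + 1) y x"
proof -
  note * = bump_oscillation[OF p c r c' ij lip]
  have "(\<integral>z. p z * (r z - r x) \<partial>M) = (\<integral>z. p z * r z \<partial>M) - (\<integral>z. p z \<partial>M) * r x"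
    unfolding right_diff_distrib
    using *(2) bump_at_integrable[OF p c] by (subst Bochner_Integration.integral_diff) auto
  then show ?thesis using *(1) cancel by simp
qed

end

text \<open>All conditions are invariant under exchanging the two variables, so an estimate for
  \<open>T i (T' j f)\<close> gives the one for \<open>T' i (T j f)\<close> by passing to the
  transposed family.\<close>

locale kernel_family = growth_space M d m C
  for M :: "'a measure" and d m C +
  fixes k :: "int \<Rightarrow> 'a \<Rightarrow> 'a \<Rightarrow> real" and c :: real
  assumes c_pos: "c > 0"
    and bump: "bump_kernel c j (k j)"
    and lip1: "\<bar>k j x y - k j x' y\<bar> \<le> c * weight j * d x x' / 2 powi j"
    and lip2: "\<bar>k j y x - k j y x'\<bar> \<le> c * weight j * d x x' / 2 powi j"
    and cancel1: "AE x in M. (\<integral>y. k j x y \<partial>M) = 0"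
    and cancel2: "AE y in M. (\<integral>x. k j x y \<partial>M) = 0"
begin

lemma transpose: "kernel_family M d m C (\<lambda>j x y. k j y x) c"
  by unfold_locales (auto intro: c_pos bump_kernel_transpose bump lip1 lip2 cancel1 cancel2)

abbreviation T :: "int \<Rightarrow> ('a \<Rightarrow> real) \<Rightarrow> 'a \<Rightarrow> real" where
  "T j \<equiv> integral_op M (k j)"

abbreviation T' :: "int \<Rightarrow> ('a \<Rightarrow> real) \<Rightarrow> 'a \<Rightarrow> real" where
  "T' j \<equiv> integral_op M (\<lambda>x y. k j y x)"

lemma c_nonneg: "c \<ge> 0" using c_pos by simp

lemma T_L2: "f \<in> L2 M \<Longrightarrow> T j f \<in> L2 M" "f \<in> L2 M \<Longrightarrow> L2_norm M (T j f) \<le> c * C * L2_norm M f"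
  using integral_op_L2[OF bump _ c_nonneg] by auto

lemma T'_L2: "f \<in> L2 M \<Longrightarrow> T' j f \<in> L2 M" "f \<in> L2 M \<Longrightarrow> L2_norm M (T' j f) \<le> c * C * L2_norm M f"
  using integral_op_L2[OF bump_kernel_transpose[OF bump] _ c_nonneg] by auto

lemma T_at: "bump_at c j x (k j x)"
  by (rule bump_kernel_at[OF bump])

lemma T'_at: "bump_at c j y (\<lambda>x. k j x y)"
  by (rule bump_kernel_at[OF bump_kernel_transpose[OF bump]])

text \<open>The constant \<open>c * c * C * 2 ^ m\<close> of \<open>bump_oscillation'\<close> times
  the factor \<open>C\<close> with which a ball average acts on \<open>L2\<close>.\<close>

definition ortho_const :: real where
  "ortho_const = (c * C)\<^sup>2 * 2 ^ m"

lemma ortho_const_pos: "ortho_const > 0"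
  using c_pos C_pos by (simp add: ortho_const_def)

text \<open>In the composed kernel the piece of finer scale supplies the mean zero and the coarser
  one the regularity. For \<open>i \<le> j\<close> the exceptional null set lies in the variable
  \<open>x\<close> and is absorbed by the outer norm; otherwise it lies in \<open>y\<close>, where
  \<open>bump_at_product_AE\<close> deals with it.\<close>

lemma T_T'_norm:
  assumes f: "f \<in> L2 M"
  shows "L2_norm M (T i (T' j f)) \<le> ortho_const * (1/2) ^ nat \<bar>i - j\<bar> * L2_norm M f"
proof -
  define e where "e = c * c * C * 2 ^ m * (1/2) ^ nat \<bar>i - j\<bar>"
  have e0: "e \<ge> 0" using c_pos C_pos by (simp add: e_def)
  define h where "h x y = (\<integral>z. k i x z * k j y z \<partial>M)" for x y
  have hm: "h x \<in> borel_measurable M" for x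
    unfolding h_def
    using integral_bump_kernel_measurable[OF _ bump_kernel_transpose[OF bump[of j]], of "k i x"] T_at[of i x]
    by (simp add: bump_at_def)
  have eq: "T i (T' j f) x = (\<integral>y. h x y * f y \<partial>M)" for x
    using integral_op_comp[OF T_at[of i x] bump_kernel_transpose[OF bump[of j]] f]
    by (simp add: integral_op_def h_def)
  have "AE x in M. ennreal \<bar>T i (T' j f) x\<bar> \<le> ennreal e * ball_avg (max i j + 1) (\<lambda>y. ennreal \<bar>f y\<bar>) x"
  proof (cases "i \<le> j")
    case True
    show ?thesis
      using cancel1[of i]
    proof eventually_elim
      fix x assume x: "(\<integral>y. k i x y \<partial>M) = 0"
      have "ennreal \<bar>h x y\<bar> \<le> ennreal e * ball_kernel (j + 1) y x" for y
        unfolding h_def e_def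
        by (rule bump_oscillation'[OF T_at c_nonneg T_at c_nonneg True lip2 x])
      then have "AE y in M. ennreal \<bar>h x y\<bar> \<le> ennreal e * ball_kernel (j + 1) x y"
        by (simp add: ball_kernel_sym[of "j + 1" x])
      from bump_at_product_AE[OF hm f this]
      show "ennreal \<bar>T i (T' j f) x\<bar> \<le> ennreal e * ball_avg (max i j + 1) (\<lambda>y. ennreal \<bar>f y\<bar>) x"
        using True by (simp add: eq max_def)
    qed
  next
    case False
    then have ji: "j \<le> i" by simp
    have "ennreal \<bar>T i (T' j f) x\<bar> \<le> ennreal e * ball_avg (max i j + 1) (\<lambda>y. ennreal \<bar>f y\<bar>) x" for x
    proof -
      have "AE y in M. ennreal \<bar>h x y\<bar> \<le> ennreal e * ball_kernel (i + 1) x y"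
        using cancel1[of j]
      proof eventually_elim
        fix y assume y: "(\<integral>z. k j y z \<partial>M) = 0"
        have "ennreal \<bar>\<integral>z. k j y z * k i x z \<partial>M\<bar>
          \<le> ennreal (c * c * C * 2 ^ m * (1/2) ^ nat \<bar>j - i\<bar>) * ball_kernel (i + 1) x y"
          by (rule bump_oscillation'[OF T_at c_nonneg T_at c_nonneg ji lip2 y])
        then show "ennreal \<bar>h x y\<bar> \<le> ennreal e * ball_kernel (i + 1) x y"
          unfolding h_def e_def by (simp add: mult.commute[of "k j y _"] abs_minus_commute)
      qed
      from bump_at_product_AE[OF hm f this] show ?thesis
        using False by (simp add: eq max_def)
    qed
    then show ?thesis by simp
  qed
  from L2_of_ball_avg(2)[OF L2_measurable[OF T_L2(1)[OF T'_L2(1)[OF f]]] f e0 this]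
  show ?thesis by (simp add: e_def ortho_const_def power2_eq_square mult_ac)
qed

theorem T_sum_bound:
  assumes I: "finite I" and f: "f \<in> L2 M"
  shows "L2_norm M (\<lambda>x. \<Sum>i\<in>I. T i f x) \<le> 8 * sqrt ortho_const * L2_norm M f"
proof -
  interpret tr: kernel_family M d m C "\<lambda>j x y. k j y x" c by (rule transpose)
  \<comment> \<open>The hypotheses of \<open>cotlar_stein\<close> carry squares, so the root of the
    decay is left: its ratio \<open>sqrt (1/2)\<close> is at most 3/4, and
    \<open>2 / (1 - 3/4) = 8\<close> bounds the row sums.\<close>
  define a where "a i j = sqrt ortho_const * sqrt (1/2) ^ nat \<bar>i - j\<bar>" for i j :: int
  have a2: "(a i j)\<^sup>2 = ortho_const * (1/2) ^ nat \<bar>i - j\<bar>" for i j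
    using ortho_const_pos
    by (simp add: a_def power_mult_distrib power_mult[symmetric] mult.commute[of _ 2])
       (simp add: power_mult)
  have s: "sqrt (1/2) \<le> (3/4 :: real)"
    by (rule real_le_lsqrt) (auto simp: power2_eq_square)
  have "L2_norm M (\<Sum>i\<in>I. T i f) \<le> 8 * sqrt ortho_const * L2_norm M f"
  proof (rule cotlar_stein[where V = "L2 M" and T' = T' and ip = "\<lambda>f g. \<integral>x. f x * g x \<partial>M" and a = a and B = "c * C"])
    show "0 \<in> L2 M" using L2_zero by (simp add: zero_fun_def)
    show "f + g \<in> L2 M" if "f \<in> L2 M" "g \<in> L2 M" for f g
      using L2_add[OF that] by (simp add: plus_fun_def)
    show "T i (f + g) = T i f + T i g" if "f \<in> L2 M" "g \<in> L2 M" for i f g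
      using integral_op_add[OF bump that] by (simp add: plus_fun_def)
    show "T' i (f + g) = T' i f + T' i g" if "f \<in> L2 M" "g \<in> L2 M" for i f g
      using integral_op_add[OF bump_kernel_transpose[OF bump] that] by (simp add: plus_fun_def)
    show "(\<integral>x. (f + g) x * h x \<partial>M) = (\<integral>x. f x * h x \<partial>M) + (\<integral>x. g x * h x \<partial>M)"
      if "f \<in> L2 M" "g \<in> L2 M" "h \<in> L2 M" for f g h
      using L2_integrable_product[OF that(1,3)] L2_integrable_product[OF that(2,3)]
      by (simp add: distrib_right)
    show "(\<integral>x. T i f x * g x \<partial>M) = (\<integral>x. f x * T' i g x \<partial>M)" if "f \<in> L2 M" "g \<in> L2 M" for i f g
      by (rule integral_op_adjoint[OF bump that c_nonneg])
    show "(\<Sum>j\<in>I. a i j) \<le> 8 * sqrt ortho_const" if "i \<in> I" for i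
    proof -
      have "(\<Sum>j\<in>I. a i j) = sqrt ortho_const * (\<Sum>j\<in>I. sqrt (1/2) ^ nat \<bar>i - j\<bar>)"
        by (simp add: a_def sum_distrib_left)
      also have "\<dots> \<le> sqrt ortho_const * (2 / (1 - sqrt (1/2)))"
        using ortho_const_pos s by (intro mult_left_mono sum_power_abs_diff_le I) auto
      also have "2 / (1 - sqrt (1/2)) \<le> 2 / (1 - 3/4 :: real)"
        using s by (intro divide_left_mono mult_pos_pos) auto
      finally show ?thesis using ortho_const_pos by (simp add: mult_left_mono)
    qed
    show "L2_norm M (T' i (T j f)) \<le> (a i j)\<^sup>2 * L2_norm M f" if "f \<in> L2 M" for i j f
      using tr.T_T'_norm[OF that, of i j] by (simp add: a2 tr.ortho_const_def ortho_const_def)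
    show "L2_norm M (T i (T' j f)) \<le> (a i j)\<^sup>2 * L2_norm M f" if "f \<in> L2 M" for i j f
      using T_T'_norm[OF that, of i j] by (simp add: a2)
    show "a i j \<ge> 0" for i j using ortho_const_pos by (simp add: a_def)
    show "0 < 8 * sqrt ortho_const" using ortho_const_pos by simp
    show "0 \<le> c * C" using c_pos C_pos by simp
    show "(\<integral>x. f x * g x \<partial>M) = (\<integral>x. g x * f x \<partial>M)" for f g :: "'a \<Rightarrow> real"
      by (intro Bochner_Integration.integral_cong refl mult.commute)
  qed (auto intro: I f T_L2 T'_L2 L2_norm_nonneg L2_inner_self L2_Cauchy_Schwarz)
  then show ?thesis by (simp add: sum_fun_eq)
qed

end

section \<open>Cotlar's inequality and the truncated sums\<close>

context growth_space
begin

text \<open>The tent is at least 1/2 on the ball of half its radius, so the lower mass bound at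
  \<open>x\<close> keeps its integral above \<open>c0 * (2 powi N / 2) ^ m / 2\<close>; normalising
  produces the constant. Unlike a normalised indicator the result is Lipschitz, so it can play the
  regular factor against pieces of finer scale.\<close>

lemma tent_function:
  assumes c0: "c0 > 0" and lower: "\<And>r. r > 0 \<Longrightarrow> ennreal (c0 * r ^ m) \<le> emeasure M {y. d x y < r}"
  shows "\<exists>p. bump_at (2 * 2 ^ m / c0) N x p \<and> (\<integral>z. p z \<partial>M) = 1 \<and>
    (\<forall>z z'. \<bar>p z - p z'\<bar> \<le> (2 * 2 ^ m / c0) * weight N * d z z' / 2 powi N)"
proof -
  define R where "R = (2::real) powi N"
  have R0: "R > 0" by (simp add: R_def)
  define t where "t z = max 0 (1 - d x z / R)" for z
  have [measurable]: "t \<in> borel_measurable M" unfolding t_def by measurable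
  have t: "t z \<ge> 0" "t z \<le> 1" "d x z \<ge> R \<Longrightarrow> t z = 0" for z
    using R0 d_nonneg[of x z] by (auto simp: t_def max_def field_simps)
  have t_lip: "\<bar>t z - t z'\<bar> \<le> d z z' / R" for z z'
  proof -
    have "\<bar>t z - t z'\<bar> \<le> \<bar>d x z / R - d x z' / R\<bar>" unfolding t_def by linarith
    also have "\<dots> = \<bar>d x z - d x z'\<bar> / R" using R0 by (simp add: diff_divide_distrib[symmetric])
    also have "\<bar>d x z - d x z'\<bar> \<le> d z z'"
      using d_triangle[of x z z'] d_triangle[of x z' z] d_sym[of z z'] by linarith
    finally show ?thesis using R0 by (simp add: divide_right_mono)
  qed
  have tb: "bump_at (R ^ m) N x t"
    using R0 t by (intro bump_atI) (auto simp: weight_def R_def)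
  then have tint: "integrable M t" using R0 by (intro bump_at_integrable[OF tb]) simp
  define I where "I = (\<integral>z. t z \<partial>M)"
  have I_ge: "I \<ge> c0 * R ^ m / (2 * 2 ^ m)"
  proof -
    have "ennreal (c0 * R ^ m / (2 * 2 ^ m)) = ennreal (1/2) * ennreal (c0 * (R / 2) ^ m)"
      using c0 R0 by (subst ennreal_mult'[symmetric]) (auto simp: power_divide)
    also have "\<dots> \<le> ennreal (1/2) * emeasure M {y. d x y < R / 2}"
      using R0 by (intro mult_left_mono lower) auto
    also have "\<dots> = (\<integral>\<^sup>+z. ennreal (1/2) * indicator {y. d x y < R / 2} z \<partial>M)"
      by (rule nn_integral_cmult_indicator[OF ball_measurable, symmetric])
    also have "\<dots> \<le> (\<integral>\<^sup>+z. ennreal (t z) \<partial>M)"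
    proof (intro nn_integral_mono)
      fix z
      show "ennreal (1/2) * indicator {y. d x y < R / 2} z \<le> ennreal (t z)"
      proof (cases "d x z < R / 2")
        case True
        then have "1 / 2 \<le> t z" using R0 by (simp add: t_def field_simps)
        then show ?thesis using True by (simp add: ennreal_leI del: ennreal_half)
      qed simp
    qed
    also have "\<dots> = ennreal I" unfolding I_def using t by (intro nn_integral_eq_integral tint) auto
    finally show ?thesis using t unfolding I_def by (subst (asm) ennreal_le_iff) auto
  qed
  have I0: "I > 0" using I_ge c0 R0 by (smt (verit) divide_pos_pos mult_pos_pos zero_less_power)
  have inv: "1 / I \<le> (2 * 2 ^ m / c0) * weight N"
  proof -
    have "1 / I \<le> 1 / (c0 * R ^ m / (2 * 2 ^ m))"
      using I_ge I0 c0 R0 by (intro divide_left_mono mult_pos_pos) auto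
    then show ?thesis by (simp add: weight_def R_def)
  qed
  have b0: "2 * 2 ^ m / c0 \<ge> 0" using c0 by simp
  show ?thesis
  proof (intro exI[of _ "\<lambda>z. t z / I"] conjI allI)
    show "bump_at (2 * 2 ^ m / c0) N x (\<lambda>z. t z / I)"
    proof (rule bump_atI)
      fix z
      have "\<bar>t z / I\<bar> \<le> 1 / I" using t[of z] I0 by (simp add: divide_right_mono)
      then show "\<bar>t z / I\<bar> \<le> 2 * 2 ^ m / c0 * weight N" using inv by linarith
    qed (use t c0 in \<open>auto simp: R_def\<close>)
    show "(\<integral>z. t z / I \<partial>M) = 1" using I0 by (simp add: I_def)
    fix z z'
    have "\<bar>t z / I - t z' / I\<bar> = (1 / I) * \<bar>t z - t z'\<bar>"
      using I0 by (simp add: diff_divide_distrib[symmetric])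
    also have "\<dots> \<le> ((2 * 2 ^ m / c0) * weight N) * (d z z' / R)"
      using I0 t_lip[of z z'] inv mult_nonneg_nonneg[OF b0 less_imp_le[OF weight_pos[of N]]]
      by (intro mult_mono) auto
    finally show "\<bar>t z / I - t z' / I\<bar> \<le> 2 * 2 ^ m / c0 * weight N * d z z' / 2 powi N"
      by (simp add: R_def)
  qed
qed

end

context kernel_family
begin

text \<open>
  Compare with the average against the tent function about \<open>x\<close>: averaging hardly changes the pieces at
  scales above \<open>N\<close>, and by cancellation it nearly annihilates those below \<open>N\<close>.
\<close>

lemma pointwise_cotlar:
  assumes c0: "c0 > 0" and lower: "\<And>r. r > 0 \<Longrightarrow> ennreal (c0 * r ^ m) \<le> emeasure M {y. d x y < r}"
    and f: "f \<in> L2 M" and N: "N0 \<le> N"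
  defines "b \<equiv> 2 * 2 ^ m / c0"
  shows "ennreal \<bar>\<Sum>j\<in>{N..N1}. T j f x\<bar>
    \<le> ennreal b * maximal (\<lambda>y. ennreal \<bar>\<Sum>j\<in>{N0..N1}. T j f y\<bar>) x
      + ennreal (4 * (b * c * C * 2 ^ m)) * maximal (\<lambda>y. ennreal \<bar>f y\<bar>) x"
proof (cases "N \<le> N1")
  case True
  let ?mf = "maximal (\<lambda>y. ennreal \<bar>f y\<bar>) x"
  define g where "g y = (\<Sum>j\<in>{N0..N1}. T j f y)" for y
  have g: "g \<in> L2 M" unfolding g_def by (intro L2_sum T_L2 f)
  have b0: "b \<ge> 0" using c0 by (simp add: b_def)
  define e where "e j = b * c * C * 2 ^ m * (1/2) ^ nat \<bar>N - j\<bar>" for j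
  have e0: "e j \<ge> 0" for j using b0 c_pos C_pos by (simp add: e_def)
  obtain p where p: "bump_at b N x p" "(\<integral>z. p z \<partial>M) = 1"
    "\<And>z z'. \<bar>p z - p z'\<bar> \<le> b * weight N * d z z' / 2 powi N"
    using tent_function[OF c0 lower, of N] unfolding b_def by blast
  have pm: "p \<in> borel_measurable M" using p(1) by (simp add: bump_at_def)
  have pint: "integrable M p" by (rule bump_at_integrable[OF p(1) b0])
  define h where "h j y = (\<integral>z. p z * k j z y \<partial>M)" for j y
  have hm: "h j \<in> borel_measurable M" for j
    unfolding h_def by (rule integral_bump_kernel_measurable[OF pm bump])
  define P where "P j = (\<integral>z. p z * T j f z \<partial>M)" for j
  have P_eq: "P j = (\<integral>y. h j y * f y \<partial>M)" for j
    unfolding P_def h_def by (rule integral_op_comp[OF p(1) bump f])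
  have Pg: "(\<integral>z. p z * g z \<partial>M) = (\<Sum>j\<in>{N0..N1}. P j)"
    unfolding g_def P_def sum_distrib_left
    by (intro Bochner_Integration.integral_sum bump_at_product(2)[OF p(1)] T_L2 f)
  \<comment> \<open>Scales below \<open>N\<close>: the piece is the finer factor and has mean zero
    in its first variable, while the tent is the regular one.\<close>
  have low: "ennreal \<bar>P j\<bar> \<le> ennreal (e j) * ?mf" if j: "j < N" for j
  proof -
    have "AE y in M. ennreal \<bar>h j y\<bar> \<le> ennreal (e j) * ball_kernel (N + 1) x y"
      using cancel2[of j]
    proof eventually_elim
      fix y assume y: "(\<integral>z. k j z y \<partial>M) = 0"
      have "ennreal \<bar>\<integral>z. k j z y * p z \<partial>M\<bar>
          \<le> ennreal (c * b * C * 2 ^ m * (1/2) ^ nat \<bar>j - N\<bar>) * ball_kernel (N + 1) x y"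
        using j by (intro bump_oscillation'[OF T'_at c_nonneg p(1) b0 _ p(3) y]) simp
      then show "ennreal \<bar>h j y\<bar> \<le> ennreal (e j) * ball_kernel (N + 1) x y"
        unfolding h_def e_def by (simp add: mult.commute[of "k j _ y"] mult.commute[of c] abs_minus_commute)
    qed
    from bump_at_product_AE[OF hm f this]
    have "ennreal \<bar>P j\<bar> \<le> ennreal (e j) * ball_avg (N + 1) (\<lambda>y. ennreal \<bar>f y\<bar>) x" by (simp add: P_eq)
    also have "\<dots> \<le> ennreal (e j) * ?mf"
      unfolding maximal_def by (intro mult_left_mono SUP_upper) auto
    finally show ?thesis .
  qed
  \<comment> \<open>Scales from \<open>N\<close> on: now the tent is the finer factor. It has mean
    one, not zero, so averaging a piece against it changes the value at \<open>x\<close> only by the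
    oscillation of the piece.\<close>
  have high: "ennreal \<bar>T j f x - P j\<bar> \<le> ennreal (e j) * ?mf" if j: "N \<le> j" for j
  proof -
    have kx: "k j x y - h j y = - (\<integral>z. p z * (k j z y - k j x y) \<partial>M)"
      and osc: "ennreal \<bar>\<integral>z. p z * (k j z y - k j x y) \<partial>M\<bar> \<le> ennreal (e j) * ball_kernel (j + 1) y x" for y
    proof -
      note * = bump_oscillation[OF p(1) b0 T'_at[of j y] c_nonneg j lip1]
      have "(\<integral>z. p z * (k j z y - k j x y) \<partial>M) = h j y - (\<integral>z. p z \<partial>M) * k j x y"
        unfolding right_diff_distrib h_def using *(2) pint by (subst Bochner_Integration.integral_diff) auto
      then show "k j x y - h j y = - (\<integral>z. p z * (k j z y - k j x y) \<partial>M)" using p(2) by simp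
      show "ennreal \<bar>\<integral>z. p z * (k j z y - k j x y) \<partial>M\<bar> \<le> ennreal (e j) * ball_kernel (j + 1) y x"
        using *(1) by (simp add: e_def)
    qed
    have km: "k j x \<in> borel_measurable M" using T_at[of j x] by (simp add: bump_at_def)
    have ba: "bump_at (e j) (j + 1) x (\<lambda>y. k j x y - h j y)"
      unfolding bump_at_def
    proof (intro conjI allI)
      show "(\<lambda>y. k j x y - h j y) \<in> borel_measurable M" using km hm by measurable
      show "ennreal \<bar>k j x y - h j y\<bar> \<le> ennreal (e j) * ball_kernel (j + 1) x y" for y
        using osc[of y] unfolding kx by (simp add: ball_kernel_sym[of "j + 1" x])
    qed
    have "integrable M (\<lambda>y. k j x y * f y)" by (rule bump_at_product(2)[OF T_at f])
    moreover have "integrable M (\<lambda>y. k j x y * f y - (k j x y - h j y) * f y)"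
      by (intro Bochner_Integration.integrable_diff bump_at_product(2)[OF T_at f] bump_at_product(2)[OF ba f])
    then have "integrable M (\<lambda>y. h j y * f y)" by (simp add: algebra_simps)
    ultimately have "T j f x - P j = (\<integral>y. (k j x y - h j y) * f y \<partial>M)"
      unfolding P_eq integral_op_def left_diff_distrib by (intro Bochner_Integration.integral_diff[symmetric])
    then have "ennreal \<bar>T j f x - P j\<bar> \<le> ennreal (e j) * ball_avg (j + 1) (\<lambda>y. ennreal \<bar>f y\<bar>) x"
      using bump_at_product(3)[OF ba f] by simp
    also have "\<dots> \<le> ennreal (e j) * ?mf"
      unfolding maximal_def by (intro mult_left_mono SUP_upper) auto
    finally show ?thesis .
  qed
  have split: "{N0..N1} = {N0..<N} \<union> {N..N1}" "{N0..<N} \<inter> {N..N1} = {}" using N True by auto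
  \<comment> \<open>All the averages \<open>P j\<close> enter together as the pairing of
    \<open>p\<close> with \<open>g\<close>, and those below \<open>N\<close> are taken away
    again.\<close>
  have "(\<Sum>j\<in>{N..N1}. T j f x) = (\<integral>z. p z * g z \<partial>M) + ((\<Sum>j\<in>{N..N1}. T j f x - P j) - (\<Sum>j\<in>{N0..<N}. P j))"
    unfolding Pg split(1) by (subst sum.union_disjoint) (auto simp: split(2) sum_subtractf)
  then have "\<bar>\<Sum>j\<in>{N..N1}. T j f x\<bar>
      \<le> \<bar>\<integral>z. p z * g z \<partial>M\<bar> + ((\<Sum>j\<in>{N0..<N}. \<bar>P j\<bar>) + (\<Sum>j\<in>{N..N1}. \<bar>T j f x - P j\<bar>))"
    using sum_abs[of "\<lambda>j. T j f x - P j" "{N..N1}"] sum_abs[of P "{N0..<N}"] by linarith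
  then have "ennreal \<bar>\<Sum>j\<in>{N..N1}. T j f x\<bar>
      \<le> ennreal \<bar>\<integral>z. p z * g z \<partial>M\<bar> + ((\<Sum>j\<in>{N0..<N}. ennreal \<bar>P j\<bar>) + (\<Sum>j\<in>{N..N1}. ennreal \<bar>T j f x - P j\<bar>))"
    by (simp add: sum_nonneg ennreal_plus[symmetric] ennreal_leI del: ennreal_plus)
  also have "\<dots> \<le> ennreal b * ball_avg N (\<lambda>y. ennreal \<bar>g y\<bar>) x
      + ((\<Sum>j\<in>{N0..<N}. ennreal (e j) * ?mf) + (\<Sum>j\<in>{N..N1}. ennreal (e j) * ?mf))"
    by (intro add_mono sum_mono bump_at_product(3)[OF p(1) g] low high) auto
  also have "(\<Sum>j\<in>{N0..<N}. ennreal (e j) * ?mf) + (\<Sum>j\<in>{N..N1}. ennreal (e j) * ?mf)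
      = ennreal (\<Sum>j\<in>{N0..N1}. e j) * ?mf"
    using e0 unfolding split(1) by (subst sum.union_disjoint[symmetric]) (auto simp: sum_distrib_right[symmetric])
  also have "ennreal b * ball_avg N (\<lambda>y. ennreal \<bar>g y\<bar>) x + ennreal (\<Sum>j\<in>{N0..N1}. e j) * ?mf
      \<le> ennreal b * maximal (\<lambda>y. ennreal \<bar>g y\<bar>) x + ennreal (4 * (b * c * C * 2 ^ m)) * ?mf"
  proof (intro add_mono mult_left_mono mult_right_mono ennreal_leI)
    show "ball_avg N (\<lambda>y. ennreal \<bar>g y\<bar>) x \<le> maximal (\<lambda>y. ennreal \<bar>g y\<bar>) x"
      unfolding maximal_def by (intro SUP_upper) auto
    have "(\<Sum>j\<in>{N0..N1}. e j) = (b * c * C * 2 ^ m) * (\<Sum>j\<in>{N0..N1}. (1/2) ^ nat \<bar>N - j\<bar>)"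
      by (simp add: e_def sum_distrib_left)
    also have "\<dots> \<le> (b * c * C * 2 ^ m) * (2 / (1 - 1/2))"
      using b0 c_pos C_pos by (intro mult_left_mono sum_power_abs_diff_le) auto
    finally show "(\<Sum>j\<in>{N0..N1}. e j) \<le> 4 * (b * c * C * 2 ^ m)" by simp
  qed auto
  finally show ?thesis unfolding g_def .
qed simp

text \<open>The 2 comes from squaring a sum of two terms, \<open>maximal_const\<close> from the
  maximal function in each of them, and \<open>8 * sqrt ortho_const\<close> from the Cotlar-Stein
  bound in the first.\<close>

definition truncation_const :: "real \<Rightarrow> real" where
  "truncation_const c0 = (let b = 2 * 2 ^ m / c0 in
     2 * maximal_const * (b\<^sup>2 * (8 * sqrt ortho_const)\<^sup>2 + (4 * (b * c * C * 2 ^ m))\<^sup>2))"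

text \<open>The constant is free of \<open>N0\<close> and \<open>N1\<close>, as the passage to all
  scales by Fatou's lemma requires. The supremum runs over the smallest scale, since truncation
  removes a neighbourhood of the diagonal.\<close>

theorem truncations_bound:
  assumes c0: "c0 > 0"
    and lower: "AE x in M. \<forall>r>0. ennreal (c0 * r ^ m) \<le> emeasure M {y. d x y < r}"
    and f: "f \<in> L2 M"
  shows "(\<integral>\<^sup>+x. (SUP N\<in>{N0..N1}. ennreal \<bar>\<Sum>j\<in>{N..N1}. T j f x\<bar>)\<^sup>2 \<partial>M)
    \<le> ennreal (truncation_const c0) * (\<integral>\<^sup>+x. ennreal ((f x)\<^sup>2) \<partial>M)"
proof -
  define b where "b = 2 * 2 ^ m / c0"
  define e where "e = 4 * (b * c * C * 2 ^ m)"
  have be: "b \<ge> 0" "e \<ge> 0" using c0 c_pos C_pos by (auto simp: b_def e_def)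
  define g where "g y = (\<Sum>j\<in>{N0..N1}. T j f y)" for y
  have g: "g \<in> L2 M" unfolding g_def by (intro L2_sum T_L2 f)
  note [measurable] = L2_measurable[OF f] L2_measurable[OF g]
  let ?mf = "maximal (\<lambda>y. ennreal \<bar>f y\<bar>)"
  let ?mg = "maximal (\<lambda>y. ennreal \<bar>g y\<bar>)"
  have max_le: "(\<integral>\<^sup>+x. (maximal (\<lambda>y. ennreal \<bar>u y\<bar>) x)\<^sup>2 \<partial>M) \<le> ennreal (maximal_const * (L2_norm M u)\<^sup>2)"
    if u: "u \<in> L2 M" for u
    using maximal_bound[of "\<lambda>y. ennreal \<bar>u y\<bar>"] L2_measurable[OF u] L2_norm_eq[OF u] maximal_const_pos
    by (simp add: ennreal_abs_power2 ennreal_mult')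
  have "(\<integral>\<^sup>+x. (SUP N\<in>{N0..N1}. ennreal \<bar>\<Sum>j\<in>{N..N1}. T j f x\<bar>)\<^sup>2 \<partial>M)
      \<le> (\<integral>\<^sup>+x. 2 * (ennreal (b\<^sup>2) * (?mg x)\<^sup>2 + ennreal (e\<^sup>2) * (?mf x)\<^sup>2) \<partial>M)"
  proof (rule nn_integral_mono_AE, use lower in eventually_elim)
    fix x assume low: "\<forall>r>0. ennreal (c0 * r ^ m) \<le> emeasure M {y. d x y < r}"
    have "(SUP N\<in>{N0..N1}. ennreal \<bar>\<Sum>j\<in>{N..N1}. T j f x\<bar>) \<le> ennreal b * ?mg x + ennreal e * ?mf x"
      unfolding g_def b_def e_def using low
      by (intro SUP_least pointwise_cotlar[OF c0 _ f]) auto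
    then have "(SUP N\<in>{N0..N1}. ennreal \<bar>\<Sum>j\<in>{N..N1}. T j f x\<bar>)\<^sup>2 \<le> (ennreal b * ?mg x + ennreal e * ?mf x)\<^sup>2"
      by (intro power_mono) auto
    also have "\<dots> \<le> 2 * ((ennreal b * ?mg x)\<^sup>2 + (ennreal e * ?mf x)\<^sup>2)" by (rule power2_add_le_ennreal)
    finally show "(SUP N\<in>{N0..N1}. ennreal \<bar>\<Sum>j\<in>{N..N1}. T j f x\<bar>)\<^sup>2
        \<le> 2 * (ennreal (b\<^sup>2) * (?mg x)\<^sup>2 + ennreal (e\<^sup>2) * (?mf x)\<^sup>2)"
      using be by (simp add: power_mult_distrib ennreal_power)
  qed
  also have "\<dots> = 2 * (ennreal (b\<^sup>2) * (\<integral>\<^sup>+x. (?mg x)\<^sup>2 \<partial>M) + ennreal (e\<^sup>2) * (\<integral>\<^sup>+x. (?mf x)\<^sup>2 \<partial>M))"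
    by (subst nn_integral_cmult, measurable, subst nn_integral_add, measurable,
        subst nn_integral_cmult, measurable, subst nn_integral_cmult, measurable)
  also have "\<dots> \<le> 2 * (ennreal (b\<^sup>2) * ennreal (maximal_const * (8 * sqrt ortho_const * L2_norm M f)\<^sup>2)
      + ennreal (e\<^sup>2) * ennreal (maximal_const * (L2_norm M f)\<^sup>2))"
  proof (intro mult_left_mono add_mono max_le[OF f])
    have "L2_norm M g \<le> 8 * sqrt ortho_const * L2_norm M f"
      unfolding g_def by (rule T_sum_bound[OF _ f]) simp
    then have "(L2_norm M g)\<^sup>2 \<le> (8 * sqrt ortho_const * L2_norm M f)\<^sup>2"
      by (intro power_mono L2_norm_nonneg)
    then have "ennreal (maximal_const * (L2_norm M g)\<^sup>2)
        \<le> ennreal (maximal_const * (8 * sqrt ortho_const * L2_norm M f)\<^sup>2)"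
      using maximal_const_pos by (intro ennreal_leI mult_left_mono) auto
    then show "(\<integral>\<^sup>+x. (?mg x)\<^sup>2 \<partial>M) \<le> ennreal (maximal_const * (8 * sqrt ortho_const * L2_norm M f)\<^sup>2)"
      using max_le[OF g] by (rule order_trans[rotated])
  qed auto
  also have "\<dots> = ennreal (truncation_const c0 * (L2_norm M f)\<^sup>2)"
  proof -
    have "2 * (ennreal (b\<^sup>2) * ennreal u + ennreal (e\<^sup>2) * ennreal v) = ennreal (2 * (b\<^sup>2 * u + e\<^sup>2 * v))"
      if "u \<ge> 0" "v \<ge> 0" for u v
      using that by (simp add: ennreal_mult'[symmetric] ennreal_plus[symmetric] ennreal_numeral[symmetric]
          del: ennreal_plus ennreal_numeral)
    moreover have "truncation_const c0 * (L2_norm M f)\<^sup>2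
        = 2 * (b\<^sup>2 * (maximal_const * (8 * sqrt ortho_const * L2_norm M f)\<^sup>2) + e\<^sup>2 * (maximal_const * (L2_norm M f)\<^sup>2))"
      unfolding truncation_const_def Let_def b_def[symmetric] e_def[symmetric]
      by (simp add: power_mult_distrib algebra_simps)
    ultimately show ?thesis using maximal_const_pos by simp
  qed
  also have "\<dots> = ennreal (truncation_const c0) * (\<integral>\<^sup>+x. ennreal ((f x)\<^sup>2) \<partial>M)"
  proof -
    have "truncation_const c0 \<ge> 0"
      unfolding truncation_const_def Let_def using maximal_const_pos by (intro mult_nonneg_nonneg add_nonneg_nonneg) auto
    then show ?thesis by (simp add: L2_norm_eq[OF f] ennreal_mult')
  qed
  finally show ?thesis .
qed

end

section \<open>Hausdorff measure\<close>

lemma suminf_split_ennreal_tail: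
  fixes u :: "nat \<Rightarrow> ennreal"
  assumes fin: "(\<Sum>n. u n) < top" and e: "e > (0::real)"
  shows "\<exists>N. (\<Sum>i. u (i + N)) \<le> ennreal e"
proof -
  have "u n < top" for n
    using fin by (metis ennreal_suminf_lessD)
  then have "\<exists>r. \<forall>n. u n = ennreal (r n) \<and> r n \<ge> 0"
    by (intro choice allI) (metis less_top_ennreal)
  then obtain r where r: "\<And>n. u n = ennreal (r n)" "\<And>n. r n \<ge> 0" by blast
  have "summable r"
    using fin r by (intro summable_suminf_not_top) (auto simp: less_top)
  then obtain N where "norm (\<Sum>i. r (i + N)) < e" using suminf_exist_split[OF e, of r] by blast
  moreover have "(\<Sum>i. u (i + N)) = ennreal (\<Sum>i. r (i + N))"
    using r \<open>summable r\<close> by (simp add: suminf_ennreal2 summable_iff_shift)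
  ultimately show ?thesis by (intro exI[of _ N]) (auto intro!: ennreal_leI)
qed

section \<open>Hausdorff outer measure: subadditivity and Caratheodory's criterion\<close>

definition hausdorff_pre :: "nat \<Rightarrow> real \<Rightarrow> 'a::metric_space set \<Rightarrow> ennreal" where
  "hausdorff_pre m \<delta> E =
     (INF A\<in>{A :: nat \<Rightarrow> 'a set. E \<subseteq> (\<Union>i. A i) \<and> (\<forall>i. bounded (A i) \<and> diameter (A i) \<le> \<delta>)}.
          \<Sum>i. hausdorff_content m (A i))"

lemma hausdorff_outer_eq: "hausdorff_outer m E = (SUP \<delta>\<in>{0<..}. hausdorff_pre m \<delta> E)"
  by (simp add: hausdorff_outer_def hausdorff_pre_def)

lemma hausdorff_content_empty [simp]: "hausdorff_content m {} = 0"
  by (simp add: hausdorff_content_def)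

lemma hausdorff_content_mono:
  assumes "A \<subseteq> B" "bounded B"
  shows "hausdorff_content m A \<le> hausdorff_content m B"
proof (cases "A = {}")
  case False
  then show ?thesis
    using assms diameter_subset[OF assms] diameter_ge_0[OF bounded_subset[OF assms(2,1)]]
    by (auto simp: hausdorff_content_def intro!: ennreal_leI mult_left_mono power_mono)
qed simp

lemma hausdorff_pre_le:
  assumes "E \<subseteq> (\<Union>i. A i)" "\<And>i. bounded (A i)" "\<And>i. diameter (A i) \<le> \<delta>"
  shows "hausdorff_pre m \<delta> E \<le> (\<Sum>i. hausdorff_content m (A i))"
  unfolding hausdorff_pre_def using assms by (intro INF_lower) auto

lemma hausdorff_pre_greatest:
  assumes "\<And>A. E \<subseteq> (\<Union>i. A i) \<Longrightarrow> (\<And>i. bounded (A i)) \<Longrightarrow> (\<And>i. diameter (A i) \<le> \<delta>)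
    \<Longrightarrow> x \<le> (\<Sum>i. hausdorff_content m (A i))"
  shows "x \<le> hausdorff_pre m \<delta> E"
  unfolding hausdorff_pre_def using assms by (intro INF_greatest) auto

lemma hausdorff_pre_mono: "E \<subseteq> F \<Longrightarrow> hausdorff_pre m \<delta> E \<le> hausdorff_pre m \<delta> F"
  by (rule hausdorff_pre_greatest) (intro hausdorff_pre_le, auto)

lemma hausdorff_pre_antimono: "\<delta> \<le> \<epsilon> \<Longrightarrow> hausdorff_pre m \<epsilon> E \<le> hausdorff_pre m \<delta> E"
  by (rule hausdorff_pre_greatest) (intro hausdorff_pre_le, auto intro: order_trans)

lemma hausdorff_pre_le_outer: "\<delta> > 0 \<Longrightarrow> hausdorff_pre m \<delta> E \<le> hausdorff_outer m E"
  unfolding hausdorff_outer_eq by (intro SUP_upper) auto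

lemma hausdorff_outer_leI: "(\<And>\<delta>. \<delta> > 0 \<Longrightarrow> hausdorff_pre m \<delta> E \<le> x) \<Longrightarrow> hausdorff_outer m E \<le> x"
  unfolding hausdorff_outer_eq by (intro SUP_least) auto

lemma hausdorff_outer_mono: "E \<subseteq> F \<Longrightarrow> hausdorff_outer m E \<le> hausdorff_outer m F"
  by (meson hausdorff_outer_leI hausdorff_pre_le_outer hausdorff_pre_mono order_trans)

lemma hausdorff_outer_empty [simp]: "hausdorff_outer m {} = 0"
proof -
  have "hausdorff_pre m \<delta> {} \<le> 0" if "\<delta> > 0" for \<delta>
    using hausdorff_pre_le[of "{}" "\<lambda>_. {}" \<delta> m] that by simp
  then show ?thesis
    using hausdorff_outer_leI[of m "{}" 0] by (metis le_zero_eq)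
qed

text \<open>Nearly optimal covers with errors forming a geometric series are merged into one
  sequence by the pairing function.\<close>

lemma hausdorff_pre_subadditive:
  fixes E :: "nat \<Rightarrow> 'a::metric_space set"
  shows "hausdorff_pre m \<delta> (\<Union>n. E n) \<le> (\<Sum>n. hausdorff_pre m \<delta> (E n))"
proof (cases "(\<Sum>n. hausdorff_pre m \<delta> (E n)) = top")
  case False
  show ?thesis
  proof (rule ennreal_le_epsilon)
    fix e :: real assume e: "e > 0"
    have "\<exists>A. E n \<subseteq> (\<Union>i. A i) \<and> (\<forall>i. bounded (A i) \<and> diameter (A i) \<le> \<delta>)
        \<and> (\<Sum>i. hausdorff_content m (A i)) \<le> hausdorff_pre m \<delta> (E n) + ennreal (e * (1/2) ^ Suc n)" for n
    proof -
      have "hausdorff_pre m \<delta> (E n) < top"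
        using False by (metis ennreal_suminf_lessD less_top)
      then have "hausdorff_pre m \<delta> (E n) < hausdorff_pre m \<delta> (E n) + ennreal (e * (1/2) ^ Suc n)"
        using e by (simp add: ennreal_add_left_cancel_less[of _ 0, simplified] less_top)
      then show ?thesis
        unfolding hausdorff_pre_def[of m \<delta> "E n"] INF_less_iff by (auto intro: less_imp_le)
    qed
    then obtain A where A: "\<And>n. E n \<subseteq> (\<Union>i. A n i)" "\<And>n i. bounded (A n i)" "\<And>n i. diameter (A n i) \<le> \<delta>"
      "\<And>n. (\<Sum>i. hausdorff_content m (A n i)) \<le> hausdorff_pre m \<delta> (E n) + ennreal (e * (1/2) ^ Suc n)"
      by metis
    define B where "B i = case_prod A (prod_decode i)" for i
    have "hausdorff_pre m \<delta> (\<Union>n. E n) \<le> (\<Sum>i. hausdorff_content m (B i))"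
    proof (rule hausdorff_pre_le)
      show "(\<Union>n. E n) \<subseteq> (\<Union>i. B i)"
      proof (rule UN_least)
        fix n
        show "E n \<subseteq> (\<Union>i. B i)"
        proof
          fix x assume "x \<in> E n"
          then obtain i where "x \<in> A n i" using A(1) by blast
          then have "x \<in> B (prod_encode (n, i))" by (simp add: B_def)
          then show "x \<in> (\<Union>i. B i)" by blast
        qed
      qed
    qed (auto simp: B_def A split: prod.split)
    also have "\<dots> = (\<Sum>n. \<Sum>i. hausdorff_content m (A n i))"
      using suminf_ennreal_2dimen[of "\<lambda>n. \<Sum>i. hausdorff_content m (A n i)" "\<lambda>(n, i). hausdorff_content m (A n i)"]
      by (simp add: B_def case_prod_beta)
    also have "\<dots> \<le> (\<Sum>n. hausdorff_pre m \<delta> (E n) + ennreal (e * (1/2) ^ Suc n))"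
      by (intro suminf_le A(4)) auto
    also have "\<dots> = (\<Sum>n. hausdorff_pre m \<delta> (E n)) + (\<Sum>n. ennreal (e * (1/2) ^ Suc n))"
      by (intro suminf_add[symmetric]) auto
    also have "(\<Sum>n. ennreal (e * (1/2) ^ Suc n)) = ennreal e"
      using e power_half_series sums_mult[OF power_half_series, of e]
      by (intro suminf_ennreal_eq) auto
    finally show "hausdorff_pre m \<delta> (\<Union>n. E n) \<le> (\<Sum>n. hausdorff_pre m \<delta> (E n)) + ennreal e" .
  qed
qed simp

lemma hausdorff_outer_subadditive:
  fixes E :: "nat \<Rightarrow> 'a::metric_space set"
  shows "hausdorff_outer m (\<Union>n. E n) \<le> (\<Sum>n. hausdorff_outer m (E n))"
proof (rule hausdorff_outer_leI)
  fix \<delta> :: real assume d: "\<delta> > 0"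
  have "hausdorff_pre m \<delta> (\<Union>n. E n) \<le> (\<Sum>n. hausdorff_pre m \<delta> (E n))"
    by (rule hausdorff_pre_subadditive)
  also have "\<dots> \<le> (\<Sum>n. hausdorff_outer m (E n))"
    by (intro suminf_le hausdorff_pre_le_outer d) auto
  finally show "hausdorff_pre m \<delta> (\<Union>n. E n) \<le> (\<Sum>n. hausdorff_outer m (E n))" .
qed

lemma hausdorff_outer_Un_le:
  "hausdorff_outer m (A \<union> B) \<le> hausdorff_outer m A + hausdorff_outer m B"
proof -
  let ?E = "\<lambda>n::nat. if n = 0 then A else if n = 1 then B else {}"
  have "hausdorff_outer m (A \<union> B) \<le> hausdorff_outer m (\<Union>n. ?E n)"
    by (intro hausdorff_outer_mono) (auto split: if_splits intro: exI[of _ 0] exI[of _ 1])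
  also have "\<dots> \<le> (\<Sum>n. hausdorff_outer m (?E n))" by (rule hausdorff_outer_subadditive)
  also have "\<dots> = (\<Sum>n\<in>{0, 1}. hausdorff_outer m (?E n))"
    by (intro suminf_finite) auto
  finally show ?thesis by simp
qed

text \<open>A covering set of diameter below \<open>e\<close> cannot meet both \<open>A\<close> and
  \<open>B\<close>, so a fine cover of the union splits into two covers.\<close>

lemma hausdorff_outer_separated:
  assumes e: "e > 0" and sep: "\<And>x y. x \<in> A \<Longrightarrow> y \<in> B \<Longrightarrow> dist x y \<ge> e"
  shows "hausdorff_outer m A + hausdorff_outer m B \<le> hausdorff_outer m (A \<union> B)"
proof -
  have pre: "hausdorff_pre m \<delta> A + hausdorff_pre m \<delta> B \<le> hausdorff_pre m \<delta> (A \<union> B)"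
    if d: "\<delta> < e" for \<delta>
  proof (rule hausdorff_pre_greatest)
    fix U :: "nat \<Rightarrow> 'a set"
    assume U: "A \<union> B \<subseteq> (\<Union>i. U i)" "\<And>i. bounded (U i)" "\<And>i. diameter (U i) \<le> \<delta>"
    have sub: "hausdorff_pre m \<delta> X \<le> (\<Sum>i. hausdorff_content m (U i \<inter> X))" if "X \<subseteq> A \<union> B" for X
    proof (rule hausdorff_pre_le)
      show "X \<subseteq> (\<Union>i. U i \<inter> X)" using U(1) that by blast
      show "bounded (U i \<inter> X)" for i using U(2) bounded_subset by blast
      show "diameter (U i \<inter> X) \<le> \<delta>" for i
        using diameter_subset[of "U i \<inter> X" "U i"] U(2)[of i] U(3)[of i] by simp
    qed
    have "hausdorff_pre m \<delta> A + hausdorff_pre m \<delta> B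
        \<le> (\<Sum>i. hausdorff_content m (U i \<inter> A)) + (\<Sum>i. hausdorff_content m (U i \<inter> B))"
      by (intro add_mono sub) auto
    also have "\<dots> = (\<Sum>i. hausdorff_content m (U i \<inter> A) + hausdorff_content m (U i \<inter> B))"
      by (intro suminf_add) auto
    also have "\<dots> \<le> (\<Sum>i. hausdorff_content m (U i))"
    proof (intro suminf_le)
      fix i
      have "U i \<inter> A = {} \<or> U i \<inter> B = {}"
      proof (rule ccontr)
        assume "\<not> ?thesis"
        then obtain x y where xy: "x \<in> U i" "x \<in> A" "y \<in> U i" "y \<in> B" by blast
        then have "dist x y \<le> \<delta>"
          using diameter_bounded_bound[OF U(2)[of i], of x y] U(3)[of i] by linarith
        with sep[of x y] xy d show False by linarith
      qed
      then show "hausdorff_content m (U i \<inter> A) + hausdorff_content m (U i \<inter> B) \<le> hausdorff_content m (U i)"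
        using U(2)[of i] by (auto intro!: hausdorff_content_mono)
    qed auto
    finally show "hausdorff_pre m \<delta> A + hausdorff_pre m \<delta> B \<le> (\<Sum>i. hausdorff_content m (U i))" .
  qed
  have "hausdorff_pre m \<delta> A + hausdorff_pre m \<epsilon> B \<le> hausdorff_outer m (A \<union> B)"
    if "\<delta> > 0" "\<epsilon> > 0" for \<delta> \<epsilon>
  proof -
    \<comment> \<open>The two suprema run over independent scales; refining both to a common scale
      below \<open>e\<close> only increases the premeasures.\<close>
    define \<eta> where "\<eta> = min (min \<delta> \<epsilon>) (e / 2)"
    have \<eta>: "\<eta> > 0" "\<eta> < e" "\<eta> \<le> \<delta>" "\<eta> \<le> \<epsilon>" using that e by (auto simp: \<eta>_def)
    have "hausdorff_pre m \<delta> A + hausdorff_pre m \<epsilon> B \<le> hausdorff_pre m \<eta> A + hausdorff_pre m \<eta> B"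
      by (intro add_mono hausdorff_pre_antimono \<eta>)
    also have "\<dots> \<le> hausdorff_pre m \<eta> (A \<union> B)" by (rule pre[OF \<eta>(2)])
    also have "\<dots> \<le> hausdorff_outer m (A \<union> B)" by (rule hausdorff_pre_le_outer[OF \<eta>(1)])
    finally show ?thesis .
  qed
  then show ?thesis
    unfolding hausdorff_outer_eq[of m A] hausdorff_outer_eq[of m B]
    by (simp add: ennreal_SUP_add_left[symmetric] ennreal_SUP_add_right SUP_le_iff)
qed

text \<open>Caratheodory's criterion for metric outer measures. The part of \<open>E\<close> at
  distance at least \<open>1 / (n + 1)\<close> from \<open>F\<close> is separated from
  \<open>E \<inter> F\<close>. These parts exhaust \<open>E - F\<close> in measure because rings of
  non-adjacent index are separated, which bounds the sum of the ring measures by twice the measure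
  of \<open>E\<close>.\<close>

lemma closed_in_lambda_system:
  fixes F :: "'a::metric_space set"
  assumes F: "closed F"
  shows "hausdorff_outer m (E \<inter> F) + hausdorff_outer m (E - F) \<le> hausdorff_outer m E"
proof (cases "F = {} \<or> hausdorff_outer m E = top")
  case False
  then have ne: "F \<noteq> {}" and fin: "hausdorff_outer m E < top" by (auto simp: less_top)
  define S where "S n = {x \<in> E - F. infdist x F \<ge> 1 / real (Suc n)}" for n
  define R where "R n = S (Suc n) - S n" for n
  have inf_pos: "infdist x F > 0" if "x \<notin> F" for x
    using that F ne infdist_nonneg[of x F] in_closed_iff_infdist_zero[OF F ne, of x] by force
  have S_mono: "S n \<subseteq> S (Suc n)" for n
    using divide_left_mono[of "real (Suc n)" "real (Suc (Suc n))" 1] by (auto simp: S_def)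
  have S_mono': "S n \<subseteq> S k" if "n \<le> k" for n k
    using that S_mono lift_Suc_mono_le[of S] by blast
  have cover: "E - F \<subseteq> S n \<union> (\<Union>i. R (i + n))" for n
  proof
    fix x assume x: "x \<in> E - F"
    then have "infdist x F > 0" using inf_pos by simp
    then obtain k where "inverse (real (Suc k)) < infdist x F" using reals_Archimedean by blast
    then have "x \<in> S k" using x by (auto simp: S_def inverse_eq_divide)
    define l where "l = (LEAST k. x \<in> S k)"
    have l: "x \<in> S l" unfolding l_def using \<open>x \<in> S k\<close> by (rule LeastI)
    show "x \<in> S n \<union> (\<Union>i. R (i + n))"
    proof (cases "l \<le> n")
      case True
      then show ?thesis using S_mono' l by blast
    next
      case False
      then obtain p where p: "l = Suc p" "n \<le> p" by (cases l) auto
      have "x \<notin> S p" using not_less_Least[of p "\<lambda>k. x \<in> S k"] p by (simp add: l_def)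
      then have "x \<in> R (p - n + n)" using l p by (simp add: R_def)
      then show ?thesis by blast
    qed
  qed
  \<comment> \<open>Points of ring \<open>n\<close> are at least \<open>1 / (n + 2)\<close> away
    from \<open>F\<close>, those of ring \<open>k\<close> less than
    \<open>1 / (n + 3)\<close>.\<close>
  have R_sep: "dist x y \<ge> 1 / real (n + 2) - 1 / real (n + 3)"
    if x: "x \<in> R n" and y: "y \<in> R k" and k: "k \<ge> n + 2" for x y n k
  proof -
    have "y \<notin> S k" "y \<in> E - F" using y by (auto simp: R_def S_def)
    then have "infdist y F < 1 / real (Suc k)" by (auto simp: S_def)
    also have "\<dots> \<le> 1 / real (n + 3)" using k by (intro divide_left_mono) auto
    finally have "infdist y F < 1 / real (n + 3)" .
    moreover have "infdist x F \<ge> 1 / real (n + 2)" using x by (auto simp: R_def S_def)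
    moreover have "infdist x F \<le> infdist y F + dist x y" by (rule infdist_triangle)
    ultimately show ?thesis by linarith
  qed
  \<comment> \<open>\<open>c\<close> will be 0 and 1: rings of equal parity are pairwise
    separated.\<close>
  have half: "(\<Sum>k<N. hausdorff_outer m (R (2 * k + c))) \<le> hausdorff_outer m E" for N c
  proof -
    have "(\<Sum>k<N. hausdorff_outer m (R (2 * k + c))) \<le> hausdorff_outer m (\<Union>k<N. R (2 * k + c))"
    proof (induction N)
      case (Suc N)
      have "hausdorff_outer m (\<Union>k<N. R (2 * k + c)) + hausdorff_outer m (R (2 * N + c))
          \<le> hausdorff_outer m ((\<Union>k<N. R (2 * k + c)) \<union> R (2 * N + c))"
      proof (rule hausdorff_outer_separated)
        show "1 / real (2 * N + c + 2) - 1 / real (2 * N + c + 3) > 0"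
          by (intro diff_gt_0_iff_gt[THEN iffD2] divide_strict_left_mono) auto
        fix x y assume "x \<in> (\<Union>k<N. R (2 * k + c))" and y: "y \<in> R (2 * N + c)"
        then obtain k where k: "k < N" "x \<in> R (2 * k + c)" by auto
        define a where "a = 2 * k + c"
        define b where "b = 2 * N + c"
        have ab: "a \<le> b" using k by (simp add: a_def b_def)
        \<comment> \<open>The gaps decrease with the index, so the gap belonging to the newest ring
          works for all earlier ones.\<close>
        have "1 / real (b + 2) - 1 / real (b + 3) = 1 / (real (b + 2) * real (b + 3))"
          by (simp add: field_simps)
        also have "\<dots> \<le> 1 / (real (a + 2) * real (a + 3))"
          using ab by (intro divide_left_mono mult_mono) auto
        also have "\<dots> = 1 / real (a + 2) - 1 / real (a + 3)"
          by (simp add: field_simps)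
        also have "\<dots> \<le> dist x y" using R_sep[of x a y b] k y by (simp add: a_def b_def)
        finally show "1 / real (2 * N + c + 2) - 1 / real (2 * N + c + 3) \<le> dist x y" by (simp add: b_def)
      qed
      also have "(\<Union>k<N. R (2 * k + c)) \<union> R (2 * N + c) = (\<Union>k<Suc N. R (2 * k + c))"
        by (auto simp: lessThan_Suc)
      finally show ?case using Suc.IH
        by (metis (no_types, lifting) add_right_mono order_trans sum.lessThan_Suc)
    qed simp
    also have "\<dots> \<le> hausdorff_outer m E" by (intro hausdorff_outer_mono) (auto simp: R_def S_def)
    finally show ?thesis .
  qed
  have "(\<Sum>n. hausdorff_outer m (R n)) \<le> hausdorff_outer m E + hausdorff_outer m E"
  proof (rule suminf_le_const)
    fix n
    have split: "(\<Sum>k<2 * N. u k) = (\<Sum>k<N. u (2 * k)) + (\<Sum>k<N. u (2 * k + 1))"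
      for N and u :: "nat \<Rightarrow> ennreal"
      by (induction N) (auto simp: add_ac)
    have "(\<Sum>k<n. hausdorff_outer m (R k)) \<le> (\<Sum>k<2 * n. hausdorff_outer m (R k))"
      by (intro sum_mono2) auto
    also have "\<dots> \<le> hausdorff_outer m E + hausdorff_outer m E"
      unfolding split using half[where c = 0] half[where c = 1] by (intro add_mono) auto
    finally show "(\<Sum>k<n. hausdorff_outer m (R k)) \<le> hausdorff_outer m E + hausdorff_outer m E" .
  qed simp
  also have "\<dots> < top" using fin by simp
  finally have sumfin: "(\<Sum>n. hausdorff_outer m (R n)) < top" .
  show ?thesis
  proof (rule ennreal_le_epsilon)
    fix e :: real assume "e > 0"
    then obtain N where N: "(\<Sum>i. hausdorff_outer m (R (i + N))) \<le> ennreal e"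
      using suminf_split_ennreal_tail[OF sumfin] by blast
    have "hausdorff_outer m (E - F) \<le> hausdorff_outer m (S N) + hausdorff_outer m (\<Union>i. R (i + N))"
      using hausdorff_outer_mono[OF cover[of N]] hausdorff_outer_Un_le order_trans by blast
    also have "\<dots> \<le> hausdorff_outer m (S N) + ennreal e"
      using order_trans[OF hausdorff_outer_subadditive N] by (intro add_left_mono)
    finally have "hausdorff_outer m (E \<inter> F) + hausdorff_outer m (E - F)
        \<le> (hausdorff_outer m (E \<inter> F) + hausdorff_outer m (S N)) + ennreal e"
      by (simp add: add.assoc add_left_mono)
    also have "hausdorff_outer m (E \<inter> F) + hausdorff_outer m (S N) \<le> hausdorff_outer m ((E \<inter> F) \<union> S N)"
    proof (rule hausdorff_outer_separated[of "1 / real (Suc N)"])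
      fix x y assume x: "x \<in> E \<inter> F" and y: "y \<in> S N"
      have "infdist y F \<le> dist y x" using x by (intro infdist_le) auto
      then show "1 / real (Suc N) \<le> dist x y" using y by (auto simp: S_def dist_commute)
    qed simp
    also have "\<dots> \<le> hausdorff_outer m E" by (intro hausdorff_outer_mono) (auto simp: S_def)
    finally show "hausdorff_outer m (E \<inter> F) + hausdorff_outer m (E - F) \<le> hausdorff_outer m E + ennreal e"
      by (simp add: add_right_mono)
  qed
qed (auto simp: hausdorff_outer_mono)

text \<open>\<open>measure_of\<close> yields the zero measure when its function is not a measure, so
  the values of \<open>hausdorff_measure\<close> become available only through this fact.\<close>

lemma measure_space_hausdorff_outer:
  "measure_space UNIV (sets (borel :: 'a::metric_space measure)) (hausdorff_outer m)"
proof -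
  let ?f = "hausdorff_outer m :: 'a set \<Rightarrow> ennreal"
  interpret P: sigma_algebra UNIV "Pow UNIV :: 'a set set" by (rule sigma_algebra_Pow)
  let ?L = "lambda_system UNIV (Pow UNIV) ?f"
  have "outer_measure_space (Pow UNIV) ?f"
    unfolding outer_measure_space_def positive_def increasing_def countably_subadditive_def
    by (auto intro: hausdorff_outer_mono hausdorff_outer_subadditive)
  then have ms: "measure_space UNIV ?L ?f" by (rule P.caratheodory_lemma)
  then have sig: "sigma_algebra UNIV ?L" by (simp add: measure_space_def)
  have "closed F \<Longrightarrow> F \<in> ?L" for F :: "'a set"
  proof -
    assume F: "closed F"
    have "?f (E \<inter> F) + ?f (E - F) = ?f E" for E
    proof (rule antisym)
      show "?f E \<le> ?f (E \<inter> F) + ?f (E - F)"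
        using hausdorff_outer_Un_le[of m "E \<inter> F" "E - F"] by (simp add: Int_Diff_Un)
    qed (rule closed_in_lambda_system[OF F])
    then show "F \<in> ?L" unfolding P.lambda_system_eq by simp
  qed
  then have "open U \<Longrightarrow> U \<in> ?L" for U :: "'a set"
    using P.lambda_system_Compl[of "- U" ?f] by (simp add: closed_Compl Compl_eq_Diff_UNIV[symmetric])
  then have "sigma_sets UNIV {U :: 'a set. open U} \<subseteq> ?L"
    by (intro sigma_algebra.sigma_sets_subset[OF sig]) auto
  then have "sets borel \<subseteq> ?L" by (simp add: borel_def)
  then show ?thesis
    by (intro measure_down[OF ms]) (auto intro: sets.sigma_algebra_axioms[of borel, simplified])
qed

lemma sets_hausdorff_measure [simp, measurable_cong]: "sets (hausdorff_measure m) = sets borel"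
  unfolding hausdorff_measure_def by (metis sets.sets_measure_of_eq space_borel)

lemma emeasure_hausdorff_measure:
  "A \<in> sets borel \<Longrightarrow> emeasure (hausdorff_measure m) A = hausdorff_outer m A"
  using measure_space_hausdorff_outer[of m]
  by (intro emeasure_measure_of[OF hausdorff_measure_def]) (auto simp: measure_space_def)

lemma sets_hausdorff_on [simp, measurable_cong]: "sets (hausdorff_on m L) = sets borel"
  by (simp add: hausdorff_on_def)

lemma emeasure_hausdorff_on:
  assumes "closed L" "A \<in> sets borel"
  shows "emeasure (hausdorff_on m L) A = hausdorff_outer m (L \<inter> A)"
  unfolding hausdorff_on_def using assms
  by (subst emeasure_restricted) (auto simp: emeasure_hausdorff_measure)

section \<open>Lipschitz images and isometries\<close>

lemma hausdorff_outer_lipschitz: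
  fixes f :: "'a::metric_space \<Rightarrow> 'b::metric_space"
  assumes c: "c > 0" and lip: "\<And>x y. x \<in> E \<Longrightarrow> y \<in> E \<Longrightarrow> dist (f x) (f y) \<le> c * dist x y"
  shows "hausdorff_outer m (f ` E) \<le> ennreal (c ^ m) * hausdorff_outer m E"
proof (rule hausdorff_outer_leI)
  fix \<delta> :: real assume d: "\<delta> > 0"
  \<comment> \<open>The factor is moved to the left so that the infimum over covers of
    \<open>E\<close> stands alone on the right.\<close>
  have "hausdorff_pre m \<delta> (f ` E) / ennreal (c ^ m) \<le> hausdorff_pre m (\<delta> / c) E"
  proof (rule hausdorff_pre_greatest)
    fix A :: "nat \<Rightarrow> 'a set"
    assume A: "E \<subseteq> (\<Union>i. A i)" "\<And>i. bounded (A i)" "\<And>i. diameter (A i) \<le> \<delta> / c"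
    \<comment> \<open>Intersecting with \<open>E\<close> first, because the Lipschitz bound is
      available only there.\<close>
    let ?B = "\<lambda>i. f ` (A i \<inter> E)"
    have B: "dist (f x) (f y) \<le> c * diameter (A i)" if "x \<in> A i \<inter> E" "y \<in> A i \<inter> E" for x y i
      using lip[of x y] that diameter_bounded_bound[OF A(2)[of i], of x y] c
      by (meson IntD1 IntD2 mult_left_mono less_imp_le order_trans)
    have dB: "diameter (?B i) \<le> c * diameter (A i)" for i
    proof (cases "?B i = {}")
      case False
      then show ?thesis using B unfolding diameter_def[of "?B i"] by (auto intro!: cSUP_least)
    next
      case True
      then show ?thesis using c diameter_ge_0[OF A(2)] by (simp add: diameter_def)
    qed
    have bB: "bounded (?B i)" for i
    proof (cases "A i \<inter> E = {}")
      case False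
      then obtain x where "x \<in> A i \<inter> E" by blast
      then show ?thesis using B unfolding bounded_def by blast
    qed simp
    have "hausdorff_pre m \<delta> (f ` E) \<le> (\<Sum>i. hausdorff_content m (?B i))"
    proof (rule hausdorff_pre_le)
      show "f ` E \<subseteq> (\<Union>i. ?B i)" using A(1) by blast
      show "bounded (?B i)" for i by (rule bB)
      show "diameter (?B i) \<le> \<delta>" for i
        using dB[of i] A(3)[of i] c by (simp add: field_simps)
    qed
    also have "\<dots> \<le> (\<Sum>i. ennreal (c ^ m) * hausdorff_content m (A i))"
    proof (intro suminf_le)
      fix i
      show "hausdorff_content m (?B i) \<le> ennreal (c ^ m) * hausdorff_content m (A i)"
      proof (cases "A i \<inter> E = {}")
        case False
        have "hausdorff_content m (?B i) \<le> ennreal (unit_ball_vol (real m) * (c * diameter (A i) / 2) ^ m)"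
          using False dB[of i] diameter_ge_0[OF bB[of i]]
          by (auto simp: hausdorff_content_def intro!: ennreal_leI mult_left_mono power_mono)
        also have "\<dots> = ennreal (c ^ m) * hausdorff_content m (A i)"
          using False c diameter_ge_0[OF A(2)[of i]]
          by (auto simp: hausdorff_content_def ennreal_mult'[symmetric] power_mult_distrib power_divide mult_ac)
        finally show ?thesis .
      qed simp
    qed auto
    finally have "hausdorff_pre m \<delta> (f ` E) \<le> ennreal (c ^ m) * (\<Sum>i. hausdorff_content m (A i))"
      by simp
    then show "hausdorff_pre m \<delta> (f ` E) / ennreal (c ^ m) \<le> (\<Sum>i. hausdorff_content m (A i))"
      using c by (intro divide_le_posI_ennreal) auto
  qed
  also have "\<dots> \<le> hausdorff_outer m E" using d c by (intro hausdorff_pre_le_outer) simp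
  finally have "hausdorff_pre m \<delta> (f ` E) / ennreal (c ^ m) \<le> hausdorff_outer m E" .
  then have "hausdorff_pre m \<delta> (f ` E) / ennreal (c ^ m) * ennreal (c ^ m) \<le> hausdorff_outer m E * ennreal (c ^ m)"
    by (rule mult_right_mono) simp
  moreover have "hausdorff_pre m \<delta> (f ` E) / ennreal (c ^ m) * ennreal (c ^ m) = hausdorff_pre m \<delta> (f ` E)"
    using c by (simp add: ennreal_divide_times)
  ultimately show "hausdorff_pre m \<delta> (f ` E) \<le> ennreal (c ^ m) * hausdorff_outer m E"
    by (simp add: mult.commute)
qed

text \<open>Both the map and its inverse are Lipschitz with constant 1.\<close>

lemma hausdorff_outer_isometry:
  assumes iso: "\<And>x y. x \<in> E \<Longrightarrow> y \<in> E \<Longrightarrow> dist (f x) (f y) = dist x y"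
  shows "hausdorff_outer m (f ` E) = hausdorff_outer m E"
proof (rule antisym)
  show "hausdorff_outer m (f ` E) \<le> hausdorff_outer m E"
    using hausdorff_outer_lipschitz[of 1 E f m] iso by simp
  have "inj_on f E" using iso by (metis dist_eq_0_iff inj_onI)
  then have eq: "inv_into E f ` (f ` E) = E" by (rule inv_into_image_cancel) simp
  have "hausdorff_outer m (inv_into E f ` (f ` E)) \<le> ennreal (1 ^ m) * hausdorff_outer m (f ` E)"
  proof (rule hausdorff_outer_lipschitz)
    fix x y assume "x \<in> f ` E" "y \<in> f ` E"
    then show "dist (inv_into E f x) (inv_into E f y) \<le> 1 * dist x y"
      using iso[of "inv_into E f x" "inv_into E f y"] by (simp add: inv_into_into f_inv_into_f)
  qed simp
  then show "hausdorff_outer m E \<le> hausdorff_outer m (f ` E)" by (simp add: eq)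
qed

section \<open>Hausdorff measure on planes\<close>

text \<open>The finite cover is padded to a sequence by empty sets, whose content is 0 even for
  \<open>m = 0\<close>.\<close>

lemma hausdorff_pre_finite_le:
  assumes I: "finite I" and cov: "E \<subseteq> (\<Union>i\<in>I. A i)" and b: "\<And>i. i \<in> I \<Longrightarrow> bounded (A i)"
    and diam: "\<And>i. i \<in> I \<Longrightarrow> diameter (A i) \<le> \<delta>" and d0: "\<delta> \<ge> 0"
  shows "hausdorff_pre m \<delta> E \<le> (\<Sum>i\<in>I. hausdorff_content m (A i))"
proof -
  obtain e where e: "bij_betw e {0..<card I} I" using ex_bij_betw_nat_finite[OF I] by blast
  define B where "B n = (if n < card I then A (e n) else {})" for n
  have eI: "e n \<in> I" if "n < card I" for n using bij_betw_apply[OF e] that by auto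
  have "hausdorff_pre m \<delta> E \<le> (\<Sum>n. hausdorff_content m (B n))"
  proof (rule hausdorff_pre_le)
    show "E \<subseteq> (\<Union>n. B n)"
    proof
      fix x assume "x \<in> E"
      then obtain i where i: "i \<in> I" "x \<in> A i" using cov by blast
      then have "i \<in> e ` {0..<card I}" using bij_betw_imp_surj_on[OF e] by simp
      then obtain n where "n < card I" "i = e n" by auto
      then have "x \<in> B n" using i by (simp add: B_def)
      then show "x \<in> (\<Union>n. B n)" by blast
    qed
  qed (auto simp: B_def eI b diam d0)
  also have "\<dots> = (\<Sum>n\<in>{0..<card I}. hausdorff_content m (B n))"
    by (intro suminf_finite) (auto simp: B_def)
  also have "\<dots> = (\<Sum>n\<in>{0..<card I}. hausdorff_content m (A (e n)))"
    by (intro sum.cong) (auto simp: B_def)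
  also have "\<dots> = (\<Sum>i\<in>I. hausdorff_content m (A i))"
    by (rule sum.reindex_bij_betw[OF e])
  finally show ?thesis .
qed

text \<open>The span of \<open>D\<close> when \<open>D\<close> consists of coordinate vectors: the
  model to which every plane is reduced by an isometry.\<close>

definition coord_subspace :: "'a::euclidean_space set \<Rightarrow> 'a set" where
  "coord_subspace D = {x. \<forall>b\<in>Basis. b \<notin> D \<longrightarrow> x \<bullet> b = 0}"

lemma norm_coord_subspace_le:
  assumes D: "D \<subseteq> Basis" and x: "x \<in> coord_subspace D" and le: "\<And>b. b \<in> D \<Longrightarrow> \<bar>x \<bullet> b\<bar> \<le> s"
  shows "norm x \<le> real (card D) * s"
proof -
  have "norm x \<le> (\<Sum>b\<in>Basis. \<bar>x \<bullet> b\<bar>)" by (rule norm_le_l1)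
  also have "\<dots> = (\<Sum>b\<in>D. \<bar>x \<bullet> b\<bar>)"
    using D x by (intro sum.mono_neutral_right) (auto simp: coord_subspace_def)
  also have "\<dots> \<le> (\<Sum>b\<in>D. s)" by (intro sum_mono le)
  finally show ?thesis by simp
qed

text \<open>A grid of \<open>N ^ m\<close> cells of side \<open>2 / N\<close> covers the disc.
  Bounding the norm by the sum of the coordinates, each cell has diameter at most
  \<open>2 * m / N\<close>, so the bound on the total content does not depend on
  \<open>N\<close>.\<close>

lemma hausdorff_outer_coord_finite:
  fixes D :: "'a::euclidean_space set"
  assumes D: "D \<subseteq> Basis" and card: "card D = m" and m: "m \<ge> 1"
  shows "hausdorff_outer m (coord_subspace D \<inter> ball 0 1) < top"
proof -
  have finD: "finite D" using D finite_subset finite_Basis by blast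
  let ?K = "ennreal (unit_ball_vol (real m) * real m ^ m)"
  have "hausdorff_outer m (coord_subspace D \<inter> ball 0 1) \<le> ?K"
  proof (rule hausdorff_outer_leI)
    fix \<delta> :: real assume d: "\<delta> > 0"
    obtain N :: nat where N: "2 * real m / \<delta> < real N" using reals_Archimedean2 by blast
    moreover have "2 * real m / \<delta> > 0" using d m by simp
    ultimately have N0: "real N > 0" by linarith
    have Nd: "real m * (2 / real N) \<le> \<delta>" using N N0 d by (simp add: field_simps)
    define cell where "cell g = {x \<in> coord_subspace D. \<forall>b\<in>D. -1 + 2 * real (g b) / real N \<le> x \<bullet> b \<and> x \<bullet> b \<le> -1 + 2 * (real (g b) + 1) / real N}"
      for g :: "'a \<Rightarrow> nat"
    let ?I = "D \<rightarrow>\<^sub>E {0..<N}"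
    have close: "norm (x - y) \<le> real m * (2 / real N)" if "x \<in> cell g" "y \<in> cell g" for x y g
      unfolding card[symmetric]
    proof (rule norm_coord_subspace_le[OF D])
      show "x - y \<in> coord_subspace D"
        using that by (auto simp: cell_def coord_subspace_def inner_diff_left)
      fix b assume b: "b \<in> D"
      have e: "2 * (real (g b) + 1) / real N = 2 * real (g b) / real N + 2 / real N"
        by (simp add: add_divide_distrib)
      have "-1 + 2 * real (g b) / real N \<le> x \<bullet> b" "x \<bullet> b \<le> -1 + 2 * (real (g b) + 1) / real N"
        "-1 + 2 * real (g b) / real N \<le> y \<bullet> b" "y \<bullet> b \<le> -1 + 2 * (real (g b) + 1) / real N"
        using that b unfolding cell_def by blast+
      then show "\<bar>(x - y) \<bullet> b\<bar> \<le> 2 / real N" unfolding inner_diff_left e by linarith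
    qed
    have cell_diam: "diameter (cell g) \<le> real m * (2 / real N)" for g
      using close N0 by (intro diameter_le) auto
    have cell_bdd: "bounded (cell g)" for g
      unfolding bounded_def dist_norm using close by (cases "cell g = {}") blast+
    have cont: "hausdorff_content m (cell g) \<le> ennreal (unit_ball_vol (real m) * (real m / real N) ^ m)" for g
    proof -
      have "diameter (cell g) / 2 \<le> real m / real N" using cell_diam[of g] by simp
      then show ?thesis
        using diameter_ge_0[OF cell_bdd[of g]] unfolding hausdorff_content_def
        by (auto intro!: ennreal_leI mult_left_mono power_mono)
    qed
    have "hausdorff_pre m \<delta> (coord_subspace D \<inter> ball 0 1) \<le> (\<Sum>g\<in>?I. hausdorff_content m (cell g))"
    proof (rule hausdorff_pre_finite_le)
      show "finite ?I" using finD by (intro finite_PiE) auto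
      show "bounded (cell g)" for g by (rule cell_bdd)
      show "diameter (cell g) \<le> \<delta>" for g using cell_diam[of g] Nd by linarith
      show "coord_subspace D \<inter> ball 0 1 \<subseteq> (\<Union>g\<in>?I. cell g)"
      proof
        fix x :: 'a assume x: "x \<in> coord_subspace D \<inter> ball 0 1"
        \<comment> \<open>The coordinate lies strictly between -1 and 1, so the floor is a natural
          number below \<open>N\<close>.\<close>
        define g where "g = (\<lambda>b\<in>D. nat \<lfloor>(x \<bullet> b + 1) * real N / 2\<rfloor>)"
        have xb: "-1 < x \<bullet> b" "x \<bullet> b < 1" if "b \<in> D" for b
        proof -
          have "\<bar>x \<bullet> b\<bar> \<le> norm x" using that D by (intro Basis_le_norm) auto
          moreover have "norm x < 1" using x by simp
          ultimately show "-1 < x \<bullet> b" "x \<bullet> b < 1" by linarith+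
        qed
        have gN: "real (g b) \<le> (x \<bullet> b + 1) * real N / 2" "(x \<bullet> b + 1) * real N / 2 < real (g b) + 1"
          if "b \<in> D" for b
        proof -
          have "0 \<le> (x \<bullet> b + 1) * real N / 2"
            using xb[OF that] by (intro divide_nonneg_nonneg mult_nonneg_nonneg) linarith+
          then have "real (g b) = real_of_int \<lfloor>(x \<bullet> b + 1) * real N / 2\<rfloor>"
            unfolding g_def using that by simp
          then show "real (g b) \<le> (x \<bullet> b + 1) * real N / 2" "(x \<bullet> b + 1) * real N / 2 < real (g b) + 1"
            by linarith+
        qed
        have "g \<in> ?I"
        proof (rule PiE_I)
          fix b assume b: "b \<in> D"
          have "(x \<bullet> b + 1) * real N < 2 * real N"
            using xb[OF b] N0 by (intro mult_strict_right_mono) linarith+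
          then have "real (g b) < real N" using gN(1)[OF b] by linarith
          then show "g b \<in> {0..<N}" by simp
        qed (simp add: g_def)
        moreover have "x \<in> cell g"
          unfolding cell_def
        proof (intro CollectI conjI ballI)
          fix b assume b: "b \<in> D"
          show "-1 + 2 * real (g b) / real N \<le> x \<bullet> b" "x \<bullet> b \<le> -1 + 2 * (real (g b) + 1) / real N"
            using gN[OF b] N0 by (auto simp: field_simps)
        qed (use x in auto)
        ultimately show "x \<in> (\<Union>g\<in>?I. cell g)" by blast
      qed
    qed (use d in simp)
    also have "\<dots> \<le> (\<Sum>g\<in>?I. ennreal (unit_ball_vol (real m) * (real m / real N) ^ m))"
      by (intro sum_mono cont)
    also have "\<dots> = ennreal (real N ^ m * (unit_ball_vol (real m) * (real m / real N) ^ m))"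
      using finD card by (simp add: card_PiE ennreal_mult ennreal_of_nat_eq_real_of_nat flip: ennreal_power)
    also have "\<dots> = ?K" using N0 by (simp add: power_divide)
    finally show "hausdorff_pre m \<delta> (coord_subspace D \<inter> ball 0 1) \<le> ?K" .
  qed
  then show ?thesis by (rule order_le_less_trans) simp
qed

lemma prod_Basis_two_valued:
  fixes D :: "'a::euclidean_space set" and u v :: real
  assumes "D \<subseteq> Basis"
  shows "(\<Prod>b\<in>Basis. if b \<in> D then u else v) = u ^ card D * v ^ card (Basis - D :: 'a set)"
  using assms by (simp add: prod.If_cases Int_absorb1 Int_absorb2 Diff_eq[symmetric] Int_commute)

text \<open>
  Thickening the covering sets in the directions normal to the coordinate plane turns a
  cover of the unit disc into a cover of a box, whose volume is known.
\<close>

lemma hausdorff_outer_coord_pos: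
  fixes D :: "'a::euclidean_space set"
  assumes D: "D \<subseteq> Basis" and card: "card D = m" and m: "m \<ge> 1"
  shows "hausdorff_outer m (coord_subspace D \<inter> ball 0 1) > 0"
proof -
  have finD: "finite D" using D finite_subset finite_Basis by blast
  let ?U = "coord_subspace D \<inter> ball 0 (1::real)"
  let ?n = "card (Basis - D)"
  let ?v = "unit_ball_vol (real m)"
  have v0: "?v > 0" by simp
  then have vn: "?v \<noteq> 0" by (rule less_imp_neq[symmetric])
  \<comment> \<open>With this width the projection of a point of the box to the plane has norm at
    most \<open>m * s = 1/2\<close> and so lies in the disc.\<close>
  define s where "s = 1 / (2 * real m)"
  have s0: "s > 0" using m by (simp add: s_def)
  \<comment> \<open>Half-width \<open>w\<close> along \<open>D\<close> and 1 across; the thickness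
    is the same for all boxes and cancels in the comparison.\<close>
  define bx where "bx a w = cbox (\<Sum>b\<in>Basis. (if b \<in> D then a \<bullet> b - w else -1) *\<^sub>R b)
     (\<Sum>b\<in>Basis. (if b \<in> D then a \<bullet> b + w else 1) *\<^sub>R b)" for a :: 'a and w :: real
  have mem_bx: "x \<in> bx a w \<longleftrightarrow> (\<forall>b\<in>Basis. if b \<in> D then \<bar>x \<bullet> b - a \<bullet> b\<bar> \<le> w else \<bar>x \<bullet> b\<bar> \<le> 1)" for x a w
    unfolding bx_def mem_box by (auto simp: abs_le_iff split: if_splits)
  have vol: "emeasure lborel (bx a w) = ennreal ((2 * w) ^ m * 2 ^ ?n)" if "w \<ge> 0" for a w
  proof -
    have "emeasure lborel (bx a w) = (\<Prod>b\<in>Basis. if b \<in> D then 2 * w else 2)"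
      unfolding bx_def emeasure_lborel_cbox_eq using that
      by (auto simp: inner_diff_left intro!: arg_cong[of _ _ ennreal] prod.cong)
    then show ?thesis by (simp add: prod_Basis_two_valued[OF D] card)
  qed
  \<comment> \<open>The volume \<open>(2 * s) ^ m * 2 ^ ?n\<close> is at most
    \<open>4 ^ m * 2 ^ ?n / ?v\<close> times the total content of a cover; a factor
    \<open>2 ^ m\<close> is given away.\<close>
  define K where "K = ?v * s ^ m / 4 ^ m"
  have K0: "K > 0" using v0 s0 by (simp add: K_def)
  have "ennreal K \<le> hausdorff_pre m 1 ?U"
  proof (rule hausdorff_pre_greatest)
    fix A :: "nat \<Rightarrow> 'a set"
    assume A: "?U \<subseteq> (\<Union>i. A i)" "\<And>i. bounded (A i)" "\<And>i. diameter (A i) \<le> 1"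
    \<comment> \<open>A reference point in the plane for each covering set; sets that miss the plane
      are discarded in \<open>B\<close>.\<close>
    define a where "a i = (SOME x. x \<in> A i \<inter> coord_subspace D)" for i
    have a: "a i \<in> A i \<inter> coord_subspace D" if "A i \<inter> coord_subspace D \<noteq> {}" for i
    proof -
      have "\<exists>x. x \<in> A i \<inter> coord_subspace D" using that by blast
      then show ?thesis unfolding a_def by (rule someI_ex)
    qed
    define B where "B i = (if A i \<inter> coord_subspace D = {} then {} else bx (a i) (diameter (A i)))" for i
    have cov: "bx 0 s \<subseteq> (\<Union>i. B i)"
    proof
      fix x :: 'a assume x: "x \<in> bx 0 s"
      define y where "y = (\<Sum>b\<in>D. (x \<bullet> b) *\<^sub>R b)"
      have yb: "y \<bullet> b = (if b \<in> D then x \<bullet> b else 0)" if "b \<in> Basis" for b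
      proof -
        have "y \<bullet> b = (\<Sum>c\<in>D. if c = b then x \<bullet> b else 0)"
          unfolding y_def inner_sum_left using that D
          by (intro sum.cong refl) (auto simp: inner_Basis subset_iff)
        then show ?thesis using finD by simp
      qed
      have yT: "y \<in> coord_subspace D" using yb by (simp add: coord_subspace_def)
      have "norm y \<le> real (card D) * s"
      proof (rule norm_coord_subspace_le[OF D yT])
        fix b assume b: "b \<in> D"
        then have "b \<in> Basis" using D by blast
        then show "\<bar>y \<bullet> b\<bar> \<le> s" using x[unfolded mem_bx, rule_format, of b] yb[of b] b by simp
      qed
      also have "\<dots> < 1" using m by (simp add: card s_def)
      finally have "y \<in> ?U" using yT by simp
      then obtain i where i: "y \<in> A i" using A(1) by blast
      then have ne: "A i \<inter> coord_subspace D \<noteq> {}" using yT by blast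
      have dy: "dist y (a i) \<le> diameter (A i)"
        using a[OF ne] i by (intro diameter_bounded_bound A) auto
      have "x \<in> bx (a i) (diameter (A i))"
        unfolding mem_bx
      proof
        fix b :: 'a assume b: "b \<in> Basis"
        show "if b \<in> D then \<bar>x \<bullet> b - a i \<bullet> b\<bar> \<le> diameter (A i) else \<bar>x \<bullet> b\<bar> \<le> 1"
        proof (cases "b \<in> D")
          case True
          have "\<bar>(y - a i) \<bullet> b\<bar> \<le> norm (y - a i)" by (rule Basis_le_norm[OF b])
          then show ?thesis using True dy yb[OF b] by (simp add: inner_diff_left dist_norm)
        next
          case False
          then show ?thesis using x b by (auto simp: mem_bx)
        qed
      qed
      then have "x \<in> B i" using ne by (simp add: B_def)
      then show "x \<in> (\<Union>i. B i)" by blast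
    qed
    have Bm: "B i \<in> sets lborel" for i by (simp add: B_def bx_def)
    have "ennreal ((2 * s) ^ m * 2 ^ ?n) = emeasure lborel (bx 0 s)" using s0 by (simp add: vol)
    also have "\<dots> \<le> emeasure lborel (\<Union>i. B i)" using Bm cov by (intro emeasure_mono) auto
    also have "\<dots> \<le> (\<Sum>i. emeasure lborel (B i))" using Bm by (intro emeasure_subadditive_countably) auto
    also have "\<dots> \<le> (\<Sum>i. ennreal (4 ^ m * 2 ^ ?n / ?v) * hausdorff_content m (A i))"
    proof (intro suminf_le)
      fix i
      show "emeasure lborel (B i) \<le> ennreal (4 ^ m * 2 ^ ?n / ?v) * hausdorff_content m (A i)"
      proof (cases "A i \<inter> coord_subspace D = {}")
        case False
        then have ne: "A i \<noteq> {}" by blast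
        have d0: "diameter (A i) \<ge> 0" by (rule diameter_ge_0[OF A(2)])
        have "emeasure lborel (B i) = ennreal ((2 * diameter (A i)) ^ m * 2 ^ ?n)"
          using False d0 by (simp add: B_def vol)
        also have "(2 * diameter (A i)) ^ m * 2 ^ ?n = (4 ^ m * 2 ^ ?n / ?v) * (?v * (diameter (A i) / 2) ^ m)"
        proof -
          have "(2 * diameter (A i)) ^ m = 4 ^ m * (diameter (A i) / 2) ^ m"
            by (subst power_mult_distrib[symmetric]) simp
          then show ?thesis using vn by simp
        qed
        also have "ennreal ((4 ^ m * 2 ^ ?n / ?v) * (?v * (diameter (A i) / 2) ^ m))
            = ennreal (4 ^ m * 2 ^ ?n / ?v) * ennreal (?v * (diameter (A i) / 2) ^ m)"
          using v0 by (intro ennreal_mult') simp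
        finally show ?thesis using ne by (simp only: hausdorff_content_def if_False order_refl)
      qed (simp add: B_def)
    qed auto
    finally have *: "ennreal ((2 * s) ^ m * 2 ^ ?n) \<le> ennreal (4 ^ m * 2 ^ ?n / ?v) * (\<Sum>i. hausdorff_content m (A i))"
      by simp
    have "ennreal K \<le> ennreal (?v / (4 ^ m * 2 ^ ?n)) * ennreal ((2 * s) ^ m * 2 ^ ?n)"
    proof -
      have "K \<le> ?v / (4 ^ m * 2 ^ ?n) * ((2 * s) ^ m * 2 ^ ?n)"
        using v0 s0 by (simp add: K_def power_mult_distrib divide_right_mono)
      then show ?thesis using v0 s0 by (simp add: ennreal_mult'[symmetric] ennreal_leI)
    qed
    also have "\<dots> \<le> ennreal (?v / (4 ^ m * 2 ^ ?n)) * (ennreal (4 ^ m * 2 ^ ?n / ?v) * (\<Sum>i. hausdorff_content m (A i)))"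
      by (intro mult_left_mono *) auto
    also have "\<dots> = (\<Sum>i. hausdorff_content m (A i))"
    proof -
      have "ennreal (?v / (4 ^ m * 2 ^ ?n)) * ennreal (4 ^ m * 2 ^ ?n / ?v) = 1"
        using v0 vn by (subst ennreal_mult'[symmetric]) auto
      then show ?thesis by (simp add: mult.assoc[symmetric])
    qed
    finally show "ennreal K \<le> (\<Sum>i. hausdorff_content m (A i))" .
  qed
  also have "\<dots> \<le> hausdorff_outer m ?U" by (intro hausdorff_pre_le_outer) simp
  finally show ?thesis using K0 by (metis ennreal_less_zero_iff order_less_le_trans)
qed

text \<open>A translation and a linear isometry lead to a coordinate plane. The value of
  \<open>K\<close> is left open: by the isodiametric inequality it would be the volume of the unit
  ball, but comparability is all that regularity asks for.\<close>

lemma hausdorff_outer_plane: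
  fixes L :: "'a::euclidean_space set"
  assumes L: "is_plane m L" and m: "m \<ge> 1"
  shows "\<exists>K>0. \<forall>x\<in>L. \<forall>r>0. hausdorff_outer m (L \<inter> ball x r) = ennreal (K * r ^ m)"
proof -
  have aff: "affine L" and dim: "aff_dim L = int m" using L by (auto simp: is_plane_def)
  then have "L \<noteq> {}" using m by auto
  then obtain a where a: "a \<in> L" by blast
  define V where "V = (\<lambda>x. x - a) ` L"
  have V: "subspace V" unfolding V_def using affine_diffs_subspace_subtract[OF aff a] by simp
  have V_memI: "x - y \<in> V" if "x \<in> L" "y \<in> L" for x y
  proof -
    have "x - a \<in> V" "y - a \<in> V" using that by (auto simp: V_def)
    then have "(x - a) - (y - a) \<in> V" by (rule subspace_diff[OF V])
    then show ?thesis by simp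
  qed
  have V_add: "x + v \<in> L" if "x \<in> L" "v \<in> V" for x v
  proof -
    have "x - a \<in> V" using that by (auto simp: V_def)
    then have "(x - a) + v \<in> V" using that(2) by (rule subspace_add[OF V])
    then show ?thesis by (auto simp: V_def algebra_simps)
  qed
  have dimV: "dim V = m"
  proof -
    have "int (dim V) = aff_dim L"
      unfolding V_def using a by (intro aff_dim_eq_dim_subtract[symmetric] hull_inc)
    then show ?thesis using dim by simp
  qed
  then have "m \<le> card (Basis :: 'a set)" using dim_subset_UNIV[of V] by simp
  then obtain D :: "'a set" where D: "D \<subseteq> Basis" "card D = m"
    using obtain_subset_with_card_n by metis
  have dimT: "dim (coord_subspace D) = m" and T: "subspace (coord_subspace D)"
    using dim_substandard[OF D(1)] D by (auto simp: coord_subspace_def subspace_def inner_add_left)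
  obtain f g where fg: "linear f" "f ` V = coord_subspace D" "\<And>x. x \<in> V \<Longrightarrow> norm (f x) = norm x"
    using isometries_subspaces[OF V T] dimV dimT by metis
  define h0 where "h0 = hausdorff_outer m (V \<inter> ball 0 1)"
  have img: "f ` (V \<inter> ball 0 1) = coord_subspace D \<inter> ball 0 1"
  proof (intro equalityI subsetI)
    fix z assume "z \<in> f ` (V \<inter> ball 0 1)"
    then obtain v where v: "v \<in> V \<inter> ball 0 1" "z = f v" by (rule imageE)
    then have "z \<in> f ` V" "norm z < 1" using fg(3)[of v] by auto
    then show "z \<in> coord_subspace D \<inter> ball 0 1" using fg(2) by simp
  next
    fix z assume z: "z \<in> coord_subspace D \<inter> ball 0 1"
    then have "z \<in> f ` V" using fg(2) by simp
    then obtain v where v: "z = f v" "v \<in> V" by (rule imageE)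
    then have "v \<in> V \<inter> ball 0 1" using z fg(3)[of v] by simp
    then show "z \<in> f ` (V \<inter> ball 0 1)" using v(1) by (rule rev_image_eqI)
  qed
  have "hausdorff_outer m (f ` (V \<inter> ball 0 1)) = h0"
    unfolding h0_def
  proof (rule hausdorff_outer_isometry)
    fix x y assume "x \<in> V \<inter> ball 0 1" "y \<in> V \<inter> ball 0 1"
    then have "norm (f (x - y)) = norm (x - y)" by (intro fg(3) subspace_diff V) auto
    then show "dist (f x) (f y) = dist x y" using fg(1) by (simp add: dist_norm linear_diff)
  qed
  then have "h0 > 0" "h0 < top"
    using hausdorff_outer_coord_pos[OF D m] hausdorff_outer_coord_finite[OF D m] img by auto
  then obtain K where K: "h0 = ennreal K" "K > 0"
    by (cases h0) auto
  have "hausdorff_outer m (L \<inter> ball x r) = ennreal (K * r ^ m)" if x: "x \<in> L" and r: "r > 0" for x r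
  proof (rule antisym)
    \<comment> \<open>Dilation by \<open>r\<close> and its inverse are Lipschitz with constants
      \<open>r\<close> and \<open>1 / r\<close>; the two resulting inequalities make the scaling
      exact.\<close>
    have i1: "(\<lambda>v. x + r *\<^sub>R v) ` (V \<inter> ball 0 1) = L \<inter> ball x r"
    proof (intro equalityI subsetI)
      fix y assume "y \<in> (\<lambda>v. x + r *\<^sub>R v) ` (V \<inter> ball 0 1)"
      then obtain v where "v \<in> V \<inter> ball 0 1" and yv: "y = x + r *\<^sub>R v" by (rule imageE) simp
      then have v: "y = x + r *\<^sub>R v" "v \<in> V" "norm v < 1" by simp_all
      then show "y \<in> L \<inter> ball x r" using r x
        by (auto intro!: V_add subspace_scale V simp: dist_norm)
    next
      fix y assume y: "y \<in> L \<inter> ball x r"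
      have "(1 / r) *\<^sub>R (y - x) \<in> V \<inter> ball 0 1"
        using y r x by (auto intro!: subspace_scale V V_memI simp: dist_norm norm_minus_commute)
      moreover have "y = x + r *\<^sub>R ((1 / r) *\<^sub>R (y - x))" using r by simp
      ultimately show "y \<in> (\<lambda>v. x + r *\<^sub>R v) ` (V \<inter> ball 0 1)" by blast
    qed
    have i2: "(\<lambda>y. (1 / r) *\<^sub>R (y - x)) ` (L \<inter> ball x r) = V \<inter> ball 0 1"
      unfolding i1[symmetric] image_image using r by simp
    have "hausdorff_outer m (L \<inter> ball x r) \<le> ennreal (r ^ m) * h0"
      unfolding i1[symmetric] h0_def using r
      by (intro hausdorff_outer_lipschitz) (auto simp: dist_norm scaleR_diff_right[symmetric])
    then show "hausdorff_outer m (L \<inter> ball x r) \<le> ennreal (K * r ^ m)"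
      using K r by (simp add: ennreal_mult'[symmetric] mult.commute)
    have "h0 \<le> ennreal ((1 / r) ^ m) * hausdorff_outer m (L \<inter> ball x r)"
      unfolding h0_def i2[symmetric] using r
      by (intro hausdorff_outer_lipschitz) (auto simp: dist_norm scaleR_diff_right[symmetric])
    then have "ennreal (r ^ m) * h0 \<le> ennreal (r ^ m) * (ennreal ((1 / r) ^ m) * hausdorff_outer m (L \<inter> ball x r))"
      by (rule mult_left_mono) simp
    also have "\<dots> = hausdorff_outer m (L \<inter> ball x r)"
      using r by (simp add: mult.assoc[symmetric] ennreal_mult'[symmetric] power_divide)
    finally show "ennreal (K * r ^ m) \<le> hausdorff_outer m (L \<inter> ball x r)"
      using K r by (simp add: ennreal_mult'[symmetric] mult.commute)
  qed
  then show ?thesis using K by blast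
qed

section \<open>Admissible kernels\<close>

lemma pnorm_nonneg: "pnorm X \<ge> 0"
  by (simp add: pnorm_def)

lemma pnorm_power2: "(pnorm X)\<^sup>2 = (norm (fst X))\<^sup>2 + \<bar>snd X\<bar>"
  by (simp add: pnorm_def)

lemma pnorm_eq_0_iff: "pnorm X = 0 \<longleftrightarrow> X = 0"
proof
  assume "pnorm X = 0"
  then have "(norm (fst X))\<^sup>2 + \<bar>snd X\<bar> = 0" using pnorm_power2[of X] by simp
  then have "(norm (fst X))\<^sup>2 = 0" "\<bar>snd X\<bar> = 0" using zero_le_power2[of "norm (fst X)"] by linarith+
  then show "X = 0" by (simp add: prod_eq_iff)
qed (simp add: pnorm_def)

lemma pnorm_minus: "pnorm (- X) = pnorm X"
  by (simp add: pnorm_def)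

lemma pnorm_minus_commute: "pnorm (X - Y) = pnorm (Y - X)"
  using pnorm_minus[of "X - Y"] by simp

text \<open>After squaring, the time parts add up by the triangle inequality, and the spatial cross
  term is at most twice the product of the two parabolic norms.\<close>

lemma pnorm_add_le: "pnorm (X + Y) \<le> pnorm X + pnorm Y"
proof (rule power2_le_imp_le)
  have "norm (fst X) \<le> pnorm X" "norm (fst Y) \<le> pnorm Y"
    unfolding pnorm_def by (auto intro!: real_le_rsqrt)
  then have "norm (fst X) * norm (fst Y) \<le> pnorm X * pnorm Y"
    by (intro mult_mono) (auto simp: pnorm_nonneg)
  moreover have "(norm (fst X + fst Y))\<^sup>2 \<le> (norm (fst X) + norm (fst Y))\<^sup>2"
    by (intro power_mono norm_triangle_ineq) auto
  moreover have "\<bar>snd X + snd Y\<bar> \<le> \<bar>snd X\<bar> + \<bar>snd Y\<bar>" by (rule abs_triangle_ineq)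
  ultimately show "(pnorm (X + Y))\<^sup>2 \<le> (pnorm X + pnorm Y)\<^sup>2"
    unfolding power2_sum pnorm_power2 by (simp add: algebra_simps)
qed (simp add: pnorm_nonneg)

lemma pnorm_triangle: "pnorm (X - Z) \<le> pnorm (X - Y) + pnorm (Y - Z)"
  using pnorm_add_le[of "X - Y" "Y - Z"] by simp

lemma pnorm_diff_le: "\<bar>pnorm X - pnorm Y\<bar> \<le> pnorm (X - Y)"
  using pnorm_add_le[of "X - Y" Y] pnorm_add_le[of "Y - X" X] pnorm_minus_commute[of X Y] by simp

lemma continuous_on_pnorm [continuous_intros]:
  "continuous_on S f \<Longrightarrow> continuous_on S (\<lambda>x. pnorm (f x))"
  unfolding pnorm_def by (intro continuous_intros)

lemma pnorm_measurable [measurable]: "pnorm \<in> borel_measurable borel"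
  by (intro borel_measurable_continuous_onI continuous_intros)

section \<open>Size and regularity of admissible kernels\<close>

lemma mvt_dir_deriv:
  fixes K :: "'a::real_normed_vector \<Rightarrow> real"
  assumes diff: "\<And>s. 0 \<le> s \<Longrightarrow> s \<le> 1 \<Longrightarrow> K differentiable at (X + s *\<^sub>R V)"
  shows "\<exists>s. 0 < s \<and> s < 1 \<and> K (X + V) - K X = dir_deriv V K (X + s *\<^sub>R V)"
proof -
  have "DERIV (\<lambda>s. K (X + s *\<^sub>R V)) s :> dir_deriv V K (X + s *\<^sub>R V)" if "0 \<le> s" "s \<le> 1" for s
  proof -
    let ?D = "frechet_derivative K (at (X + s *\<^sub>R V))"
    have K: "(K has_derivative ?D) (at (X + s *\<^sub>R V))"
      using diff[OF that] by (simp add: frechet_derivative_works)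
    have i: "((\<lambda>s. X + s *\<^sub>R V) has_derivative (\<lambda>h. h *\<^sub>R V)) (at s)"
      by (auto intro!: derivative_eq_intros)
    have "((\<lambda>s. K (X + s *\<^sub>R V)) has_derivative (\<lambda>h. ?D (h *\<^sub>R V))) (at s)"
      using has_derivative_compose[OF i K] .
    moreover have "?D (h *\<^sub>R V) = dir_deriv V K (X + s *\<^sub>R V) * h" for h
      using linear_scale[OF has_derivative_linear[OF K], of h V] by (simp add: dir_deriv_def)
    ultimately show ?thesis by (simp add: has_field_derivative_def mult_commute_abs)
  qed
  from MVT2[of 0 1, OF _ this] show ?thesis by auto
qed

text \<open>Bounds on tensors of partial derivatives become bounds in arbitrary directions: an entry
  is at most the norm of its tensor, and a spatial direction is expanded in the coordinate basis, at
  the price of the number of coordinates.\<close>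

lemma admissible_kernelD:
  fixes K :: "(real^'n) \<times> real \<Rightarrow> real"
  assumes "admissible_kernel m K"
  shows "\<And>X. X \<noteq> 0 \<Longrightarrow> K differentiable at X"
    and "\<And>x t. (x, t) \<noteq> 0 \<Longrightarrow> K (x, t) = - K (- x, t)"
    and "\<exists>A\<ge>0. \<forall>X. X \<noteq> 0 \<longrightarrow> \<bar>K X\<bar> \<le> A / pnorm X ^ m"
    and "\<exists>A\<ge>0. \<forall>X v. X \<noteq> 0 \<longrightarrow> \<bar>dir_deriv (v, 0) K X\<bar> \<le> A * norm v / pnorm X ^ (m + 1)"
    and "\<exists>A\<ge>0. \<forall>X s. X \<noteq> 0 \<longrightarrow> \<bar>dir_deriv (0, s) K X\<bar> \<le> A * \<bar>s\<bar> / pnorm X ^ (m + 2)"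
proof -
  show diff: "K differentiable at X" if "X \<noteq> 0" for X
    using assms that unfolding admissible_kernel_def smooth_on_open_def
    by (metis Compl_iff foldr.simps(1) id_apply list.set(1) singletonD empty_subsetI)
  show "K (x, t) = - K (- x, t)" if "(x, t) \<noteq> 0" for x t
    using assms that by (simp add: admissible_kernel_def)
  have bound: "\<exists>A\<ge>0. \<forall>X. X \<noteq> 0 \<longrightarrow> deriv_norm l j K X \<le> A / pnorm X ^ (m + l + 2 * j)" for l j
  proof -
    obtain A where A: "\<And>X. X \<noteq> 0 \<Longrightarrow> deriv_norm l j K X \<le> A / pnorm X ^ (m + l + 2 * j)"
      using assms unfolding admissible_kernel_def by blast
    have "deriv_norm l j K X \<le> max A 0 / pnorm X ^ (m + l + 2 * j)" if "X \<noteq> 0" for X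
      using A[OF that] by (rule order_trans) (auto intro!: divide_right_mono simp: pnorm_nonneg)
    then show ?thesis by (intro exI[of _ "max A 0"]) auto
  qed
  have le_deriv_norm: "\<bar>foldr dir_deriv (map (\<lambda>v. (v, 0)) vs @ replicate j (0, 1)) K X\<bar> \<le> deriv_norm l j K X"
    if "set vs \<subseteq> Basis" "length vs = l" for vs l j X
    unfolding deriv_norm_def real_sqrt_abs[symmetric]
    by (intro real_sqrt_le_mono member_le_sum[where f = "\<lambda>vs. (foldr dir_deriv (map (\<lambda>v. (v, 0)) vs @ replicate j (0, 1)) K X)\<^sup>2"])
       (use that finite_lists_length_eq[OF finite_Basis] in auto)
  obtain A0 where A0: "A0 \<ge> 0" "\<And>X. X \<noteq> 0 \<Longrightarrow> deriv_norm 0 0 K X \<le> A0 / pnorm X ^ (m + 0 + 2 * 0)"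
    using bound by blast
  show "\<exists>A\<ge>0. \<forall>X. X \<noteq> 0 \<longrightarrow> \<bar>K X\<bar> \<le> A / pnorm X ^ m"
  proof (intro exI[of _ A0] conjI allI impI A0(1))
    fix X :: "(real^'n) \<times> real" assume X: "X \<noteq> 0"
    show "\<bar>K X\<bar> \<le> A0 / pnorm X ^ m" using le_deriv_norm[of "[]" 0 0 X] A0(2)[OF X] by simp
  qed
  have lin: "linear (\<lambda>V. dir_deriv V K X)" if "X \<noteq> 0" for X
    unfolding dir_deriv_def using linear_frechet_derivative[OF diff[OF that]] by (simp add: eta_contract_eq)
  obtain A1 where A1: "A1 \<ge> 0" "\<And>X. X \<noteq> 0 \<Longrightarrow> deriv_norm 1 0 K X \<le> A1 / pnorm X ^ (m + 1 + 2 * 0)"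
    using bound by blast
  have "\<bar>dir_deriv (v, 0) K X\<bar> \<le> (real (card (Basis :: (real^'n) set)) * A1) * norm v / pnorm X ^ (m + 1)"
    if X: "X \<noteq> 0" for X and v :: "real^'n"
  proof -
    have "(v, 0::real) = (\<Sum>b\<in>Basis. (v \<bullet> b) *\<^sub>R (b, 0))"
      by (simp add: prod_eq_iff fst_sum snd_sum euclidean_representation)
    then have "dir_deriv (v, 0) K X = (\<Sum>b\<in>Basis. dir_deriv ((v \<bullet> b) *\<^sub>R (b, 0)) K X)"
      using linear_sum[OF lin[OF X], of "\<lambda>b. (v \<bullet> b) *\<^sub>R (b, 0)" Basis] by (simp only:)
    also have "\<dots> = (\<Sum>b\<in>Basis. (v \<bullet> b) * dir_deriv (b, 0) K X)"
      by (intro sum.cong refl) (simp only: linear_scale[OF lin[OF X]] real_scaleR_def)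
    also have "\<bar>\<dots>\<bar> \<le> (\<Sum>b\<in>Basis. \<bar>(v \<bullet> b) * dir_deriv (b, 0) K X\<bar>)" by (rule sum_abs)
    also have "\<dots> \<le> (\<Sum>b\<in>(Basis :: (real^'n) set). norm v * (A1 / pnorm X ^ (m + 1)))"
    proof (intro sum_mono)
      fix b :: "real^'n" assume b: "b \<in> Basis"
      have "\<bar>dir_deriv (b, 0) K X\<bar> \<le> A1 / pnorm X ^ (m + 1)"
        using le_deriv_norm[of "[b]" 1 0 X] A1(2)[OF X] b by simp
      then show "\<bar>(v \<bullet> b) * dir_deriv (b, 0) K X\<bar> \<le> norm v * (A1 / pnorm X ^ (m + 1))"
        unfolding abs_mult using b by (intro mult_mono Basis_le_norm) auto
    qed
    finally show ?thesis by (simp add: mult_ac)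
  qed
  then show "\<exists>A\<ge>0. \<forall>X v. X \<noteq> 0 \<longrightarrow> \<bar>dir_deriv (v, 0) K X\<bar> \<le> A * norm v / pnorm X ^ (m + 1)"
    using A1(1) by (intro exI[of _ "real (card (Basis :: (real^'n) set)) * A1"]) auto
  obtain A2 where A2: "A2 \<ge> 0" "\<And>X. X \<noteq> 0 \<Longrightarrow> deriv_norm 0 1 K X \<le> A2 / pnorm X ^ (m + 0 + 2 * 1)"
    using bound by blast
  have "\<bar>dir_deriv (0, s) K X\<bar> \<le> A2 * \<bar>s\<bar> / pnorm X ^ (m + 2)" if X: "X \<noteq> 0" for X and s :: real
  proof -
    have "dir_deriv (0, s) K X = s * dir_deriv (0, 1) K X"
      using linear_scale[OF lin[OF X], of s "(0, 1)"] by simp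
    moreover have "\<bar>dir_deriv (0, 1) K X\<bar> \<le> A2 / pnorm X ^ (m + 2)"
      using le_deriv_norm[of "[]" 0 1 X] A2(2)[OF X] by simp
    then have "\<bar>s\<bar> * \<bar>dir_deriv (0, 1) K X\<bar> \<le> \<bar>s\<bar> * (A2 / pnorm X ^ (m + 2))" by (rule mult_left_mono) simp
    ultimately show ?thesis by (simp add: abs_mult mult_ac)
  qed
  then show "\<exists>A\<ge>0. \<forall>X s. X \<noteq> 0 \<longrightarrow> \<bar>dir_deriv (0, s) K X\<bar> \<le> A * \<bar>s\<bar> / pnorm X ^ (m + 2)"
    using A2(1) by blast
qed

text \<open>The increment is split into a spatial and a temporal leg. No point of either leg is
  farther from \<open>X\<close> than \<open>X'\<close> is, so both keep distance at least
  \<open>\<rho>\<close> from the singularity. The time increment is at most the square of that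
  distance, which pays for the additional power of the norm in the time derivative.\<close>

lemma admissible_kernel_lipschitz:
  assumes K: "admissible_kernel m K"
  shows "\<exists>A\<ge>0. \<forall>\<rho> X X'. 0 < \<rho> \<longrightarrow> 2 * \<rho> \<le> pnorm X \<longrightarrow> pnorm (X - X') \<le> \<rho> \<longrightarrow>
    \<bar>K X - K X'\<bar> \<le> A * pnorm (X - X') / \<rho> ^ (m + 1)"
proof -
  obtain A1 where A1: "A1 \<ge> 0" "\<And>X v. X \<noteq> 0 \<Longrightarrow> \<bar>dir_deriv (v, 0) K X\<bar> \<le> A1 * norm v / pnorm X ^ (m + 1)"
    using admissible_kernelD(4)[OF K] by blast
  obtain A2 where A2: "A2 \<ge> 0" "\<And>X s. X \<noteq> 0 \<Longrightarrow> \<bar>dir_deriv (0, s) K X\<bar> \<le> A2 * \<bar>s\<bar> / pnorm X ^ (m + 2)"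
    using admissible_kernelD(5)[OF K] by blast
  have "\<bar>K X - K X'\<bar> \<le> (A1 + A2) * pnorm (X - X') / \<rho> ^ (m + 1)"
    if r: "0 < \<rho>" and X: "2 * \<rho> \<le> pnorm X" and d: "pnorm (X - X') \<le> \<rho>" for \<rho> X X'
  proof -
    define \<delta> where "\<delta> = pnorm (X - X')"
    have d0: "\<delta> \<ge> 0" by (simp add: \<delta>_def pnorm_nonneg)
    define v where "v = fst X' - fst X"
    define s where "s = snd X' - snd X"
    have \<delta>2: "\<delta>\<^sup>2 = (norm v)\<^sup>2 + \<bar>s\<bar>"
      unfolding \<delta>_def v_def s_def pnorm_power2 by (simp add: norm_minus_commute abs_minus_commute)
    have far: "\<rho> \<le> pnorm Z" if "(norm (fst Z - fst X))\<^sup>2 + \<bar>snd Z - snd X\<bar> \<le> \<delta>\<^sup>2" for Z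
    proof -
      have "(pnorm (Z - X))\<^sup>2 \<le> \<delta>\<^sup>2" unfolding pnorm_power2 using that by simp
      then have "pnorm (Z - X) \<le> \<delta>" by (rule power2_le_imp_le) (rule d0)
      then show ?thesis using pnorm_add_le[of "X - Z" Z] pnorm_minus_commute[of X Z] X d
        by (simp add: \<delta>_def)
    qed
    have nz: "Z \<noteq> 0" if "\<rho> \<le> pnorm Z" for Z using that r pnorm_eq_0_iff[of Z] by auto
    have far1: "\<rho> \<le> pnorm (X + h *\<^sub>R (v, 0))" if "0 \<le> h" "h \<le> 1" for h
    proof (rule far)
      have "(h * norm v)\<^sup>2 \<le> (norm v)\<^sup>2" using that by (intro power_mono) (auto simp: mult_left_le_one_le)
      then show "(norm (fst (X + h *\<^sub>R (v, 0)) - fst X))\<^sup>2 + \<bar>snd (X + h *\<^sub>R (v, 0)) - snd X\<bar> \<le> \<delta>\<^sup>2"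
      proof -
        have eq: "norm (fst (X + h *\<^sub>R (v, 0)) - fst X) = h * norm v" "snd (X + h *\<^sub>R (v, 0)) - snd X = 0"
          using that by simp_all
        have "(h * norm v)\<^sup>2 \<le> \<delta>\<^sup>2"
          using \<open>(h * norm v)\<^sup>2 \<le> (norm v)\<^sup>2\<close> \<delta>2 abs_ge_zero[of s] by linarith
        then show ?thesis unfolding eq by (simp only: abs_zero add_0_right)
      qed
    qed
    have far2: "\<rho> \<le> pnorm ((X + (v, 0)) + h *\<^sub>R (0, s))" if "0 \<le> h" "h \<le> 1" for h
    proof (rule far)
      have "\<bar>h * s\<bar> \<le> \<bar>s\<bar>" using that by (simp add: abs_mult mult_left_le_one_le)
      then show "(norm (fst (X + (v, 0) + h *\<^sub>R (0, s)) - fst X))\<^sup>2 + \<bar>snd (X + (v, 0) + h *\<^sub>R (0, s)) - snd X\<bar> \<le> \<delta>\<^sup>2"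
        using \<delta>2 by simp
    qed
    obtain h1 where h1: "0 < h1" "h1 < 1" "K (X + (v, 0)) - K X = dir_deriv (v, 0) K (X + h1 *\<^sub>R (v, 0))"
      using mvt_dir_deriv[of K X "(v, 0)"] admissible_kernelD(1)[OF K nz[OF far1]] by blast
    obtain h2 where h2: "0 < h2" "h2 < 1"
      "K ((X + (v, 0)) + (0, s)) - K (X + (v, 0)) = dir_deriv (0, s) K ((X + (v, 0)) + h2 *\<^sub>R (0, s))"
      using mvt_dir_deriv[of K "X + (v, 0)" "(0, s)"] admissible_kernelD(1)[OF K nz[OF far2]] by blast
    have X': "X' = (X + (v, 0)) + (0, s)" by (simp add: v_def s_def prod_eq_iff)
    have nv: "norm v \<le> \<delta>" by (rule power2_le_imp_le) (use \<delta>2 d0 in auto)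
    have ns: "\<bar>s\<bar> \<le> \<delta> * \<rho>"
    proof -
      have "\<bar>s\<bar> \<le> \<delta> * \<delta>" using \<delta>2 by (simp add: power2_eq_square)
      also have "\<dots> \<le> \<delta> * \<rho>" using d d0 by (intro mult_left_mono) (auto simp: \<delta>_def)
      finally show ?thesis .
    qed
    have "\<bar>K (X + (v, 0)) - K X\<bar> \<le> A1 * \<delta> / \<rho> ^ (m + 1)"
    proof -
      let ?Z = "X + h1 *\<^sub>R (v, 0)"
      have Z: "\<rho> \<le> pnorm ?Z" using h1 by (intro far1) auto
      have "\<bar>K (X + (v, 0)) - K X\<bar> \<le> A1 * norm v / pnorm ?Z ^ (m + 1)"
        unfolding h1(3) by (rule A1(2)[OF nz[OF Z]])
      also have "\<dots> \<le> A1 * \<delta> / \<rho> ^ (m + 1)"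
        using A1(1) nv r Z d0 by (intro frac_le mult_left_mono power_mono mult_nonneg_nonneg) auto
      finally show ?thesis .
    qed
    moreover have "\<bar>K X' - K (X + (v, 0))\<bar> \<le> A2 * \<delta> / \<rho> ^ (m + 1)"
    proof -
      let ?Z = "(X + (v, 0)) + h2 *\<^sub>R (0, s)"
      have Z: "\<rho> \<le> pnorm ?Z" using h2 by (intro far2) auto
      have "\<bar>K X' - K (X + (v, 0))\<bar> \<le> A2 * \<bar>s\<bar> / pnorm ?Z ^ (m + 2)"
        unfolding X' h2(3) by (rule A2(2)[OF nz[OF Z]])
      also have "\<dots> \<le> A2 * (\<delta> * \<rho>) / \<rho> ^ (m + 2)"
        using A2(1) ns r Z d0 by (intro frac_le mult_left_mono power_mono mult_nonneg_nonneg) auto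
      also have "\<dots> = A2 * \<delta> / \<rho> ^ (m + 1)" using r by simp
      finally show ?thesis .
    qed
    ultimately have "\<bar>K X - K X'\<bar> \<le> A1 * \<delta> / \<rho> ^ (m + 1) + A2 * \<delta> / \<rho> ^ (m + 1)" by linarith
    then show ?thesis by (simp add: \<delta>_def add_divide_distrib distrib_right)
  qed
  then show ?thesis using A1(1) A2(1) by (intro exI[of _ "A1 + A2"]) auto
qed

lemma admissible_kernel_measurable:
  assumes K: "admissible_kernel m K"
  shows "K \<in> borel_measurable borel"
proof -
  have "continuous_on (- {0}) K"
    using admissible_kernelD(1)[OF K]
    by (intro continuous_at_imp_continuous_on ballI differentiable_imp_continuous_within) auto
  \<comment> \<open>The value at the origin is arbitrary; since every function is continuous on a
    single point, the two continuous parts are glued.\<close>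
  then have "(\<lambda>X. if X \<in> {0} then K X else K X) \<in> borel_measurable borel"
    by (intro borel_measurable_continuous_on_if) auto
  then show ?thesis by simp
qed

section \<open>Dyadic decomposition of the kernel\<close>

definition outer_cutoff :: "int \<Rightarrow> (real^'n) \<times> real \<Rightarrow> real" where
  "outer_cutoff N X = max 0 (min 1 (pnorm X / 2 powi N - 1))"

text \<open>The cutoff rises linearly from 0 at norm \<open>2 powi N\<close> to 1 at twice that
  radius, so the piece lives where the norm is between \<open>2 powi (j - 2)\<close> and
  \<open>2 powi j\<close>. The shift of the indices puts it into the ball that
  \<open>bump_kernel\<close> prescribes at scale \<open>j\<close>.\<close>

definition kernel_piece :: "((real^'n) \<times> real \<Rightarrow> real) \<Rightarrow> int \<Rightarrow> (real^'n) \<times> real \<Rightarrow> real" where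
  "kernel_piece K j X = K X * (outer_cutoff (j - 2) X - outer_cutoff (j - 1) X)"

lemma outer_cutoff_measurable [measurable]: "outer_cutoff N \<in> borel_measurable borel"
  unfolding outer_cutoff_def[abs_def] by measurable

lemma outer_cutoff_bounds: "0 \<le> outer_cutoff N X" "outer_cutoff N X \<le> 1"
  by (auto simp: outer_cutoff_def)

lemma outer_cutoff_eq_0: "pnorm X \<le> 2 powi N \<Longrightarrow> outer_cutoff N X = 0"
proof -
  assume "pnorm X \<le> 2 powi N"
  moreover have "(2::real) powi N > 0" by simp
  ultimately have "pnorm X / 2 powi N \<le> 1" by (subst pos_divide_le_eq) auto
  then show ?thesis unfolding outer_cutoff_def by linarith
qed

lemma outer_cutoff_eq_1: "2 powi (N + 1) \<le> pnorm X \<Longrightarrow> outer_cutoff N X = 1"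
proof -
  assume "2 powi (N + 1) \<le> pnorm X"
  then have "2 * 2 powi N \<le> pnorm X" by (simp add: power_int_add mult.commute)
  moreover have "(2::real) powi N > 0" by simp
  ultimately have "2 \<le> pnorm X / 2 powi N" by (subst pos_le_divide_eq)
  then show ?thesis by (simp add: outer_cutoff_def)
qed

lemma outer_cutoff_lipschitz: "\<bar>outer_cutoff N X - outer_cutoff N Y\<bar> \<le> pnorm (X - Y) / 2 powi N"
proof -
  have "\<bar>outer_cutoff N X - outer_cutoff N Y\<bar> \<le> \<bar>pnorm X / 2 powi N - pnorm Y / 2 powi N\<bar>"
    unfolding outer_cutoff_def by linarith
  also have "\<dots> = \<bar>pnorm X - pnorm Y\<bar> / 2 powi N"
    by (simp add: diff_divide_distrib[symmetric])
  also have "\<dots> \<le> pnorm (X - Y) / 2 powi N"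
    by (intro divide_right_mono pnorm_diff_le) auto
  finally show ?thesis .
qed

text \<open>The cutoffs telescope; the condition on \<open>n\<close> admits the empty sum, with
  which the induction starts.\<close>

lemma sum_kernel_piece:
  assumes "N \<le> n + 1"
  shows "(\<Sum>j\<in>{N..n}. kernel_piece K j X) = K X * (outer_cutoff (N - 2) X - outer_cutoff (n - 1) X)"
proof -
  have "(\<Sum>j\<in>{N..n}. kernel_piece K j X) = K X * (outer_cutoff (N - 2) X - outer_cutoff (n - 1) X)"
    if "n = N - 1 + int p" for n p
    using that
  proof (induction p arbitrary: n)
    case (Suc p)
    have eq: "{N..n} = insert n {N..n - 1}" using Suc.prems by auto
    have "(\<Sum>j\<in>{N..n}. kernel_piece K j X) = kernel_piece K n X + (\<Sum>j\<in>{N..n - 1}. kernel_piece K j X)"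
      unfolding eq by (subst sum.insert) auto
    also have "(\<Sum>j\<in>{N..n - 1}. kernel_piece K j X) = K X * (outer_cutoff (N - 2) X - outer_cutoff (n - 1 - 1) X)"
      using Suc.prems by (intro Suc.IH) simp
    finally show ?case by (simp add: kernel_piece_def algebra_simps)
  qed simp
  from this[of n "nat (n + 1 - N)"] assms show ?thesis by simp
qed

lemma kernel_piece_eq_0:
  "pnorm X \<le> 2 powi (j - 2) \<Longrightarrow> kernel_piece K j X = 0"
  "2 powi j \<le> pnorm X \<Longrightarrow> kernel_piece K j X = 0"
proof -
  have mono: "(2::real) powi (j - 2) \<le> 2 powi (j - 1)" "(2::real) powi (j - 1) \<le> 2 powi j"
    by (intro power_int_increasing; simp)+
  show "pnorm X \<le> 2 powi (j - 2) \<Longrightarrow> kernel_piece K j X = 0"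
    using mono by (simp add: kernel_piece_def outer_cutoff_eq_0)
  show "2 powi j \<le> pnorm X \<Longrightarrow> kernel_piece K j X = 0"
    using mono outer_cutoff_eq_1[of "j - 2" X] outer_cutoff_eq_1[of "j - 1" X] by (simp add: kernel_piece_def)
qed

lemma kernel_piece_odd:
  assumes K: "admissible_kernel m K"
  shows "kernel_piece K j (- x, t) = - kernel_piece K j (x, t)"
proof (cases "(x, t) = 0")
  \<comment> \<open>At the origin the kernel need not be odd, but the cutoffs vanish there.\<close>
  case True
  then show ?thesis by (simp add: kernel_piece_eq_0 pnorm_def zero_prod_def)
next
  case False
  have "pnorm (- x, t) = pnorm (x, t)" by (simp add: pnorm_def)
  then have "outer_cutoff N (- x, t) = outer_cutoff N (x, t)" for N by (simp add: outer_cutoff_def)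
  then show ?thesis using admissible_kernelD(2)[OF K False] by (simp add: kernel_piece_def)
qed

text \<open>For distant points the size bound is enough. For close points one of which is outside
  the inner radius, the product rule combines the Lipschitz bound of \<open>K\<close> away from the
  origin with that of the cutoffs.\<close>

lemma kernel_piece_bounds:
  assumes K: "admissible_kernel m K"
  shows "\<exists>c>0. (\<forall>j X. \<bar>kernel_piece K j X\<bar> \<le> c * (1 / (2 powi j) ^ m)) \<and>
    (\<forall>j X X'. \<bar>kernel_piece K j X - kernel_piece K j X'\<bar> \<le> c * (1 / (2 powi j) ^ m) * pnorm (X - X') / 2 powi j)"
proof -
  obtain A where A: "A \<ge> 0" "\<And>X. X \<noteq> 0 \<Longrightarrow> \<bar>K X\<bar> \<le> A / pnorm X ^ m"
    using admissible_kernelD(3)[OF K] by blast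
  obtain B where B: "B \<ge> 0" "\<And>\<rho> X X'. 0 < \<rho> \<Longrightarrow> 2 * \<rho> \<le> pnorm X \<Longrightarrow> pnorm (X - X') \<le> \<rho> \<Longrightarrow>
    \<bar>K X - K X'\<bar> \<le> B * pnorm (X - X') / \<rho> ^ (m + 1)"
    using admissible_kernelD(3)[OF K] admissible_kernel_lipschitz[OF K] by blast
  \<comment> \<open>Here \<open>38 = 6 + 32\<close>: the two cutoffs have Lipschitz constants 4 and
    2 over \<open>2 powi j\<close>, and points at least \<open>2 powi j / 16\<close> apart pay 16
    times twice the size bound. The powers of 8 come from estimating at radius
    \<open>2 powi j / 8\<close>.\<close>
  define c where "c = 38 * A * 8 ^ m + B * 8 ^ (m + 1) + 1"
  have c0: "c > 0" using A(1) B(1) by (simp add: c_def add_nonneg_pos)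
  have size: "\<bar>K X\<bar> \<le> A * 8 ^ m * (1 / (2 powi j) ^ m)" if "2 powi (j - 3) \<le> pnorm X" for j X
  proof -
    have p: "(2::real) powi (j - 3) = 2 powi j / 8" by (simp add: power_int_diff)
    have "(2::real) powi (j - 3) > 0" by simp
    then have "pnorm X > 0" using that by (rule order_less_le_trans)
    then have "X \<noteq> 0" using pnorm_eq_0_iff[of X] by force
    then have "\<bar>K X\<bar> \<le> A / pnorm X ^ m" by (rule A(2))
    also have "\<dots> \<le> A / (2 powi (j - 3)) ^ m"
      using that A(1) \<open>pnorm X > 0\<close> by (intro divide_left_mono power_mono mult_pos_pos zero_less_power) simp_all
    also have "\<dots> = A * 8 ^ m * (1 / (2 powi j) ^ m)" unfolding p by (simp add: power_divide)
    finally show ?thesis .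
  qed
  have cut: "\<bar>outer_cutoff (j - 2) X - outer_cutoff (j - 1) X\<bar> \<le> 1" for j and X :: "(real^'n) \<times> real"
    using outer_cutoff_bounds[of "j - 2" X] outer_cutoff_bounds[of "j - 1" X] by linarith
  have b1: "\<bar>kernel_piece K j X\<bar> \<le> A * 8 ^ m * (1 / (2 powi j) ^ m)" for j X
  proof (cases "pnorm X \<le> 2 powi (j - 2)")
    case False
    have "(2::real) powi (j - 3) \<le> 2 powi (j - 2)" by (intro power_int_increasing) auto
    then have "\<bar>K X\<bar> * \<bar>outer_cutoff (j - 2) X - outer_cutoff (j - 1) X\<bar> \<le> (A * 8 ^ m * (1 / (2 powi j) ^ m)) * 1"
      using False A(1) by (intro mult_mono size cut) auto
    then show ?thesis by (simp add: kernel_piece_def abs_mult)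
  qed (use A(1) in \<open>simp add: kernel_piece_eq_0\<close>)
  have main: "\<bar>kernel_piece K j X - kernel_piece K j X'\<bar> \<le> c * (1 / (2 powi j) ^ m) * pnorm (X - X') / 2 powi j"
    if X: "pnorm X > 2 powi (j - 2)" and d: "pnorm (X - X') < 2 powi (j - 4)" for j X X'
  proof -
    define \<delta> where "\<delta> = pnorm (X - X')"
    have d0: "\<delta> \<ge> 0" by (simp add: \<delta>_def pnorm_nonneg)
    define R where "R = (2::real) powi j"
    have R0: "R > 0" by (simp add: R_def)
    have p: "(2::real) powi (j - 1) = R / 2" "(2::real) powi (j - 2) = R / 4" "(2::real) powi (j - 3) = R / 8" "(2::real) powi (j - 4) = R / 16"
      by (simp_all add: R_def power_int_diff)
    have far: "R / 8 \<le> pnorm X'"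
      using pnorm_add_le[of "X - X'" X'] X d R0 unfolding p by simp
    \<comment> \<open>The radius \<open>R / 8\<close> is admissible in the Lipschitz bound, for
      twice it is at most the norm of \<open>X\<close>.\<close>
    have 1: "\<bar>K X - K X'\<bar> \<le> B * \<delta> / (R / 8) ^ (m + 1)"
      unfolding \<delta>_def using X d R0 unfolding p by (intro B(2)) auto
    have 2: "\<bar>K X'\<bar> \<le> A * 8 ^ m * (1 / R ^ m)"
      using size[of j X'] far unfolding p R_def[symmetric] by simp
    let ?\<chi> = "\<lambda>X. outer_cutoff (j - 2) X - outer_cutoff (j - 1) X"
    have 3: "\<bar>?\<chi> X - ?\<chi> X'\<bar> \<le> 6 * \<delta> / R"
    proof -
      have "\<bar>?\<chi> X - ?\<chi> X'\<bar> \<le> \<delta> / (R / 4) + \<delta> / (R / 2)"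
        unfolding \<delta>_def p(1,2)[symmetric]
        by (rule order_trans[OF _ add_mono[OF outer_cutoff_lipschitz outer_cutoff_lipschitz]]) linarith
      then show ?thesis by (simp add: field_simps)
    qed
    have "kernel_piece K j X - kernel_piece K j X' = (K X - K X') * ?\<chi> X + K X' * (?\<chi> X - ?\<chi> X')"
      by (simp add: kernel_piece_def algebra_simps)
    then have "\<bar>kernel_piece K j X - kernel_piece K j X'\<bar> \<le> \<bar>K X - K X'\<bar> * \<bar>?\<chi> X\<bar> + \<bar>K X'\<bar> * \<bar>?\<chi> X - ?\<chi> X'\<bar>"
      by (metis abs_mult abs_triangle_ineq)
    also have "\<dots> \<le> (B * \<delta> / (R / 8) ^ (m + 1)) * 1 + (A * 8 ^ m * (1 / R ^ m)) * (6 * \<delta> / R)"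
      using 1 2 3 cut[of j X] A(1) B(1) R0 d0 by (intro add_mono mult_mono) auto
    also have "\<dots> = (B * 8 ^ (m + 1) + 6 * (A * 8 ^ m)) * (\<delta> / (R ^ m * R))"
      using R0 by (simp add: power_divide field_simps)
    also have "\<dots> \<le> c * (\<delta> / (R ^ m * R))"
      using A(1) B(1) d0 R0 by (intro mult_right_mono) (auto simp: c_def)
    finally show ?thesis by (simp add: \<delta>_def R_def)
  qed
  have b2: "\<bar>kernel_piece K j X - kernel_piece K j X'\<bar> \<le> c * (1 / (2 powi j) ^ m) * pnorm (X - X') / 2 powi j" for j X X'
  proof (cases "pnorm (X - X') < 2 powi (j - 4)")
    case True
    consider "pnorm X > 2 powi (j - 2)" | "pnorm X' > 2 powi (j - 2)"
      | "pnorm X \<le> 2 powi (j - 2)" "pnorm X' \<le> 2 powi (j - 2)" by linarith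
    then show ?thesis
    proof cases
      case 1
      then show ?thesis by (rule main[OF _ True])
    next
      case 2
      then show ?thesis using main[of j X' X] True
        by (simp add: pnorm_minus_commute[of X' X] abs_minus_commute)
    next
      case 3
      then show ?thesis using c0 by (simp add: kernel_piece_eq_0 pnorm_nonneg)
    qed
  next
    case False
    define R where "R = (2::real) powi j"
    have R0: "R > 0" by (simp add: R_def)
    have p: "(2::real) powi (j - 4) = R / 16" by (simp add: R_def power_int_diff)
    have "1 \<le> 16 * (pnorm (X - X') / R)" using False R0 unfolding p by (simp add: field_simps)
    then have "2 * (A * 8 ^ m * (1 / R ^ m)) * 1 \<le> 2 * (A * 8 ^ m * (1 / R ^ m)) * (16 * (pnorm (X - X') / R))"
      using A(1) R0 by (intro mult_left_mono) auto
    moreover have "\<bar>kernel_piece K j X - kernel_piece K j X'\<bar> \<le> 2 * (A * 8 ^ m * (1 / R ^ m))"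
      using b1[of j X] b1[of j X'] unfolding R_def by linarith
    ultimately have "\<bar>kernel_piece K j X - kernel_piece K j X'\<bar> \<le> (32 * (A * 8 ^ m)) * ((1 / R ^ m) * (pnorm (X - X') / R))"
      by simp
    also have "\<dots> \<le> c * ((1 / R ^ m) * (pnorm (X - X') / R))"
      using A(1) B(1) R0 by (intro mult_right_mono) (auto simp: c_def pnorm_nonneg)
    finally show ?thesis by (simp add: R_def)
  qed
  have "\<bar>kernel_piece K j X\<bar> \<le> c * (1 / (2 powi j) ^ m)" for j X
    using b1[of j X] by (rule order_trans) (use A(1) B(1) in \<open>auto intro!: divide_right_mono simp: c_def\<close>)
  then show ?thesis using c0 b2 by blast
qed

section \<open>Maximal truncations\<close>

lemma term_le_suminf_ennreal:
  fixes f :: "nat \<Rightarrow> ennreal"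
  shows "f i \<le> suminf f"
  using sum_le_suminf[OF summableI, of "{i}" f] by simp

context growth_space
begin

text \<open>On a dyadic shell of radius R the square of \<open>u\<close> is of order R to the power
  -2m, while the mass is at most of order R to the power m; the sum over the shells is geometric
  because \<open>m \<ge> 1\<close>. Truncated kernels can therefore be paired with every function in
  \<open>L2\<close>.\<close>

lemma tail_in_L2:
  assumes m: "m \<ge> 1" and u: "u \<in> borel_measurable M" and A: "A \<ge> 0"
    and zero: "\<And>y. d x y \<le> 2 powi N \<Longrightarrow> u y = 0"
    and le: "\<And>y. d x y > 2 powi N \<Longrightarrow> \<bar>u y\<bar> \<le> A / d x y ^ m"
  shows "u \<in> L2 M"
proof -
  let ?R = "\<lambda>i::nat. (2::real) powi (N + int i)"
  let ?g = "\<lambda>i y. ennreal ((A / ?R i ^ m)\<^sup>2) * indicator {y. d x y < 2 * ?R i} y"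
  have "ennreal ((u y)\<^sup>2) \<le> (\<Sum>i. ?g i y)" for y
  proof (cases "d x y > 2 powi N")
    case True
    define q where "q = d x y / 2 powi N"
    have q1: "q > 1" using True by (simp add: q_def)
    \<comment> \<open>The shell containing \<open>y\<close>, numbered outwards from the truncation
      radius.\<close>
    define i where "i = nat \<lfloor>log 2 q\<rfloor>"
    have i: "real i \<le> log 2 q" "log 2 q < real i + 1"
      using q1 by (auto simp: i_def of_nat_nat zero_le_log_cancel_iff)
    have "2 powr real i \<le> q" "q < 2 powr (real i + 1)"
      using i q1 by (auto simp: le_log_iff log_less_iff)
    then have q2: "2 ^ i \<le> q" "q < 2 * 2 ^ i" by (auto simp: powr_add powr_realpow)
    have R: "?R i = 2 powi N * 2 ^ i" by (simp add: power_int_add)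
    have dR: "?R i \<le> d x y" "d x y < 2 * ?R i"
      using q2 unfolding R q_def by (auto simp: field_simps)
    have "\<bar>u y\<bar> \<le> A / ?R i ^ m"
    proof (rule order_trans[OF le[OF True]])
      have R0: "?R i > 0" by simp
      then have "d x y > 0" using dR(1) by linarith
      then show "A / d x y ^ m \<le> A / ?R i ^ m"
        using dR(1) A R0 \<open>d x y > 0\<close> by (intro divide_left_mono power_mono mult_pos_pos zero_less_power) simp_all
    qed
    then have "\<bar>u y\<bar>\<^sup>2 \<le> (A / ?R i ^ m)\<^sup>2" by (intro power_mono) auto
    then have "ennreal ((u y)\<^sup>2) \<le> ?g i y" using dR by (simp add: ennreal_leI)
    also have "\<dots> \<le> (\<Sum>i. ?g i y)" by (rule term_le_suminf_ennreal)
    finally show ?thesis .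
  next
    case False
    then show ?thesis using zero[of y] by simp
  qed
  then have "(\<integral>\<^sup>+y. ennreal ((u y)\<^sup>2) \<partial>M) \<le> (\<integral>\<^sup>+y. (\<Sum>i. ?g i y) \<partial>M)"
    by (intro nn_integral_mono)
  also have "\<dots> = (\<Sum>i. \<integral>\<^sup>+y. ?g i y \<partial>M)"
    by (intro nn_integral_suminf borel_measurable_times_ennreal borel_measurable_const borel_measurable_indicator ball_measurable)
  also have "\<dots> = (\<Sum>i. ennreal ((A / ?R i ^ m)\<^sup>2) * emeasure M {y. d x y < 2 * ?R i})"
    by (intro suminf_cong nn_integral_cmult_indicator ball_measurable)
  also have "\<dots> \<le> (\<Sum>i. ennreal (A\<^sup>2 * C * 2 ^ m / (2 powi N) ^ m * (1/2) ^ i))"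
  proof (intro suminf_le)
    fix i
    have R: "?R i = 2 powi N * 2 ^ i" by (simp add: power_int_add)
    have R0: "?R i > 0" by simp
    have "ennreal ((A / ?R i ^ m)\<^sup>2) * emeasure M {y. d x y < 2 * ?R i}
        \<le> ennreal ((A / ?R i ^ m)\<^sup>2) * ennreal (C * (2 * ?R i) ^ m)"
      by (intro mult_left_mono growth) auto
    also have "\<dots> = ennreal ((A / ?R i ^ m)\<^sup>2 * (C * (2 * ?R i) ^ m))"
      using C_pos by (simp add: ennreal_mult')
    also have "(A / ?R i ^ m)\<^sup>2 * (C * (2 * ?R i) ^ m) = A\<^sup>2 * C * 2 ^ m / ?R i ^ m"
      using R0 by (simp add: power_mult_distrib power2_eq_square power_divide)
    also have "\<dots> \<le> A\<^sup>2 * C * 2 ^ m / (2 powi N) ^ m * (1/2) ^ i"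
    proof -
      have "(2::real) ^ i \<le> 2 ^ (i * m)" using m by (intro power_increasing) auto
      then have "1 / (2::real) ^ (i * m) \<le> 1 / 2 ^ i" by (intro divide_left_mono) auto
      then have "A\<^sup>2 * C * 2 ^ m / (2 powi N) ^ m * (1 / 2 ^ (i * m)) \<le> A\<^sup>2 * C * 2 ^ m / (2 powi N) ^ m * (1 / 2 ^ i)"
        using C_pos by (intro mult_left_mono) auto
      then show ?thesis unfolding R by (simp add: power_mult_distrib power_mult power_divide)
    qed
    finally show "ennreal ((A / ?R i ^ m)\<^sup>2) * emeasure M {y. d x y < 2 * ?R i}
        \<le> ennreal (A\<^sup>2 * C * 2 ^ m / (2 powi N) ^ m * (1/2) ^ i)" by (simp add: ennreal_leI)
  qed auto
  also have "\<dots> < top"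
    using C_pos by (subst suminf_ennreal2) (auto intro!: summable_mult summable_geometric)
  finally show ?thesis using u by (simp add: L2_def)
qed

end

text \<open>Puts \<open>\<epsilon>\<close> on the ramp of \<open>outer_cutoff (N - 2)\<close>, so
  that the sharp cutoff at \<open>\<epsilon>\<close> and the Lipschitz one differ only between the
  radii \<open>2 powi (N - 2)\<close> and \<open>2 powi (N - 1)\<close>.\<close>

lemma exists_dyadic_scale:
  fixes \<epsilon> :: real
  assumes "\<epsilon> > 0"
  shows "\<exists>N::int. 2 powi (N - 2) \<le> \<epsilon> \<and> \<epsilon> < 2 powi (N - 1)"
proof -
  define N where "N = \<lfloor>log 2 \<epsilon>\<rfloor> + 2"
  have "real_of_int (N - 2) \<le> log 2 \<epsilon>" "log 2 \<epsilon> < real_of_int (N - 1)"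
    unfolding N_def by linarith+
  then have "2 powr real_of_int (N - 2) \<le> \<epsilon>" "\<epsilon> < 2 powr real_of_int (N - 1)"
    using assms by (auto simp: le_log_iff log_less_iff)
  moreover have "2 powr real_of_int i = 2 powi i" for i by (simp add: powr_real_of_int')
  ultimately show ?thesis by (intro exI[of _ N]) (simp only: simp_thms)
qed

text \<open>
  The antisymmetry of the kernel enters only through the reflections: they annihilate the integrals of all
  dyadic pieces of the kernel.
\<close>

theorem CZO_L2_bounded_of_reflections:
  fixes \<mu> :: "((real^'n) \<times> real) measure"
  assumes sets: "sets \<mu> = sets borel" and sig: "sigma_finite_measure \<mu>" and m: "m \<ge> 1"
    and C0: "C > 0" and upper: "\<And>X r. r > 0 \<Longrightarrow> emeasure \<mu> (pball X r) \<le> ennreal (C * r ^ m)"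
    and c0: "c0 > 0" and lower: "AE X in \<mu>. \<forall>r>0. ennreal (c0 * r ^ m) \<le> emeasure \<mu> (pball X r)"
    and reflect: "AE X in \<mu>. distr \<mu> borel (\<lambda>Y. (2 *\<^sub>R fst X - fst Y, snd Y)) = \<mu>"
    and K: "admissible_kernel m K"
  shows "CZO_L2_bounded K \<mu>"
proof -
  let ?d = "\<lambda>X Y :: (real^'n) \<times> real. pnorm (X - Y)"
  have sp: "space \<mu> = UNIV" using sets_eq_imp_space_eq[OF sets] by simp
  have sets2: "sets (\<mu> \<Otimes>\<^sub>M \<mu>) = sets borel"
    using sets_pair_measure_cong[OF sets sets] borel_prod by metis
  have meas1: "borel_measurable \<mu> = borel_measurable borel" by (rule measurable_cong_sets[OF sets refl])
  have meas2: "borel_measurable (\<mu> \<Otimes>\<^sub>M \<mu>) = borel_measurable borel" by (rule measurable_cong_sets[OF sets2 refl])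
  have diffm: "(\<lambda>p. fst p - snd p) \<in> borel_measurable (borel :: (((real^'n) \<times> real) \<times> ((real^'n) \<times> real)) measure)"
    by (intro borel_measurable_continuous_onI continuous_intros)
  interpret G: growth_space \<mu> ?d m C
  proof (intro growth_space.intro growth_space_axioms.intro)
    show "sigma_finite_measure \<mu>" by (rule sig)
    show "(\<lambda>p. ?d (fst p) (snd p)) \<in> borel_measurable (\<mu> \<Otimes>\<^sub>M \<mu>)"
      unfolding meas2 using measurable_compose[OF diffm pnorm_measurable] .
    show "emeasure \<mu> {Y. ?d X Y < r} \<le> ennreal (C * r ^ m)" if "r > 0" for X r
      using upper[OF that] by (simp add: pball_def)
    show "?d X Y = ?d Y X" for X Y by (rule pnorm_minus_commute)
    show "?d X Z \<le> ?d X Y + ?d Y Z" for X Y Z by (rule pnorm_triangle)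
  qed (simp_all add: sp C0 pnorm_eq_0_iff)
  obtain c where c: "c > 0" "\<And>j X. \<bar>kernel_piece K j X\<bar> \<le> c * (1 / (2 powi j) ^ m)"
    "\<And>j X X'. \<bar>kernel_piece K j X - kernel_piece K j X'\<bar> \<le> c * (1 / (2 powi j) ^ m) * pnorm (X - X') / 2 powi j"
    using kernel_piece_bounds[OF K] by blast
  let ?k = "\<lambda>j X Y. kernel_piece K j (X - Y)"
  have Km: "K \<in> borel_measurable borel" by (rule admissible_kernel_measurable[OF K])
  have km: "kernel_piece K j \<in> borel_measurable borel" for j
    unfolding kernel_piece_def[abs_def] using Km by measurable
  have kmX: "(\<lambda>Y. kernel_piece K j (X - Y)) \<in> borel_measurable borel" "(\<lambda>Y. kernel_piece K j (Y - X)) \<in> borel_measurable borel" for j X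
    by (rule measurable_compose[OF _ km]; intro borel_measurable_continuous_onI continuous_intros)+
  have ref_m: "(\<lambda>Y. (2 *\<^sub>R x - fst Y, snd Y)) \<in> measurable \<mu> borel" for x :: "real^'n"
    unfolding measurable_cong_sets[OF sets refl]
    by (intro borel_measurable_continuous_onI continuous_intros)
  have odd: "kernel_piece K j (- fst Z, snd Z) = - kernel_piece K j Z" for j Z
    using kernel_piece_odd[OF K, of j "fst Z" "snd Z"] by simp
  interpret F: kernel_family \<mu> ?d m C ?k c
  proof (intro kernel_family.intro kernel_family_axioms.intro)
    show "growth_space \<mu> ?d m C" by (rule G.growth_space_axioms)
    show "G.bump_kernel c j (?k j)" for j
      unfolding G.bump_kernel_def
    proof (intro conjI allI)
      show "(\<lambda>p. kernel_piece K j (fst p - snd p)) \<in> borel_measurable (\<mu> \<Otimes>\<^sub>M \<mu>)"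
        unfolding meas2 using measurable_compose[OF diffm km] .
      show "ennreal \<bar>kernel_piece K j (X - Y)\<bar> \<le> ennreal c * G.ball_kernel j X Y" for X Y
        using c(1) c(2)[of j "X - Y"] kernel_piece_eq_0(2)[of j "X - Y" K] G.weight_pos[of j]
        by (auto simp: G.ball_kernel_def G.weight_def ennreal_mult'[symmetric] not_less intro!: ennreal_leI)
    qed
    show "\<bar>?k j X Y - ?k j X' Y\<bar> \<le> c * G.weight j * ?d X X' / 2 powi j" for j X Y X'
      using c(3)[of j "X - Y" "X' - Y"] by (simp add: G.weight_def)
    show "\<bar>?k j Y X - ?k j Y X'\<bar> \<le> c * G.weight j * ?d X X' / 2 powi j" for j X Y X'
      using c(3)[of j "Y - X" "Y - X'"] pnorm_minus_commute[of X' X] by (simp add: G.weight_def)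
    \<comment> \<open>The reflection fixes time and moves \<open>X - Y\<close> to its spatial
      antipode, where the piece has the opposite sign; by invariance the integral equals its own
      negative.\<close>
    show "AE X in \<mu>. (\<integral>Y. ?k j X Y \<partial>\<mu>) = 0" for j
      using reflect
    proof eventually_elim
      fix X :: "(real^'n) \<times> real" assume X: "distr \<mu> borel (\<lambda>Y. (2 *\<^sub>R fst X - fst Y, snd Y)) = \<mu>"
      have "(\<integral>Y. ?k j X Y \<partial>\<mu>) = (\<integral>Y. ?k j X Y \<partial>(distr \<mu> borel (\<lambda>Y. (2 *\<^sub>R fst X - fst Y, snd Y))))"
        by (simp only: X)
      also have "\<dots> = (\<integral>Y. ?k j X (2 *\<^sub>R fst X - fst Y, snd Y) \<partial>\<mu>)"
        by (rule integral_distr[OF ref_m kmX(1)])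
      also have "\<dots> = (\<integral>Y. - ?k j X Y \<partial>\<mu>)"
      proof (intro Bochner_Integration.integral_cong refl)
        fix Y :: "(real^'n) \<times> real"
        have "X - (2 *\<^sub>R fst X - fst Y, snd Y) = (- fst (X - Y), snd (X - Y))"
          by (simp add: prod_eq_iff scaleR_2)
        then show "?k j X (2 *\<^sub>R fst X - fst Y, snd Y) = - ?k j X Y" by (simp only: odd)
      qed
      finally show "(\<integral>Y. ?k j X Y \<partial>\<mu>) = 0" by simp
    qed
    show "AE Y in \<mu>. (\<integral>X. ?k j X Y \<partial>\<mu>) = 0" for j
      using reflect
    proof eventually_elim
      fix X :: "(real^'n) \<times> real" assume X: "distr \<mu> borel (\<lambda>Y. (2 *\<^sub>R fst X - fst Y, snd Y)) = \<mu>"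
      have "(\<integral>Y. ?k j Y X \<partial>\<mu>) = (\<integral>Y. ?k j Y X \<partial>(distr \<mu> borel (\<lambda>Y. (2 *\<^sub>R fst X - fst Y, snd Y))))"
        by (simp only: X)
      also have "\<dots> = (\<integral>Y. ?k j (2 *\<^sub>R fst X - fst Y, snd Y) X \<partial>\<mu>)"
        by (rule integral_distr[OF ref_m kmX(2)])
      also have "\<dots> = (\<integral>Y. - ?k j Y X \<partial>\<mu>)"
      proof (intro Bochner_Integration.integral_cong refl)
        fix Y :: "(real^'n) \<times> real"
        have "(2 *\<^sub>R fst X - fst Y, snd Y) - X = (- fst (Y - X), snd (Y - X))"
          by (simp add: prod_eq_iff scaleR_2)
        then show "?k j (2 *\<^sub>R fst X - fst Y, snd Y) X = - ?k j Y X" by (simp only: odd)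
      qed
      finally show "(\<integral>Y. ?k j Y X \<partial>\<mu>) = 0" by simp
    qed
  qed (rule c(1))
  obtain A where A: "A \<ge> 0" "\<And>X. X \<noteq> 0 \<Longrightarrow> \<bar>K X\<bar> \<le> A / pnorm X ^ m"
    using admissible_kernelD(3)[OF K] by blast
  define D where "D = F.truncation_const c0"
  have D0: "D \<ge> 0"
    unfolding D_def F.truncation_const_def Let_def using G.maximal_const_pos
    by (intro mult_nonneg_nonneg add_nonneg_nonneg) auto
  \<comment> \<open>For the difference of the sharp and the Lipschitz truncation: outside radius
    \<open>2 powi (N - 2)\<close> the kernel is at most \<open>A / (2 powi (N - 2)) ^ m\<close>, and
    \<open>2 ^ m\<close> converts this to the weight of scale \<open>N - 1\<close>.\<close>
  define b where "b = A * 2 ^ m"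
  have b0: "b \<ge> 0" using A(1) by (simp add: b_def)
  have low: "AE X in \<mu>. \<forall>r>0. ennreal (c0 * r ^ m) \<le> emeasure \<mu> {Y. ?d X Y < r}"
    using lower by (simp add: pball_def)
  have main: "(\<integral>\<^sup>+ X. (SUP \<epsilon>\<in>{0<..}. ennreal (\<bar>trunc_op K \<mu> \<epsilon> f X\<bar>\<^sup>2)) \<partial>\<mu>)
      \<le> ennreal (2 * (b\<^sup>2 * G.maximal_const + D)) * (\<integral>\<^sup>+ X. ennreal ((f X)\<^sup>2) \<partial>\<mu>)"
    if fm: "f \<in> borel_measurable \<mu>" and ffin: "(\<integral>\<^sup>+ X. ennreal ((f X)\<^sup>2) \<partial>\<mu>) < \<infinity>" for f
  proof -
    have f: "f \<in> L2 \<mu>" using fm ffin by (simp add: L2_def)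
    have fb: "f \<in> borel_measurable borel" using fm by (simp add: meas1)
    let ?mf = "G.maximal (\<lambda>Y. ennreal \<bar>f Y\<bar>)"
    \<comment> \<open>Measurability of the supremum over all real \<open>\<epsilon>\<close> is
      avoided: up to the maximal function it is dominated by the limit inferior of these finite
      suprema, and monotonicity of the nonnegative integral asks nothing of the smaller
      side.\<close>
    define G where "G n X = (SUP N\<in>{- int n..int n}. ennreal \<bar>\<Sum>j\<in>{N..int n}. F.T j f X\<bar>)" for n :: nat and X
    have Gm: "G n \<in> borel_measurable \<mu>" for n
    proof -
      have "(\<lambda>X. \<Sum>j\<in>{N..int n}. F.T j f X) \<in> borel_measurable \<mu>" for N
        by (intro borel_measurable_sum L2_measurable F.T_L2 f)
      then show ?thesis
        unfolding G_def[abs_def]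
        by (intro borel_measurable_SUP countableI_type measurable_compose[OF _ measurable_ennreal] borel_measurable_abs) auto
    qed
    have Gm2: "(\<lambda>X. (G n X)\<^sup>2) \<in> borel_measurable \<mu>" for n
      unfolding power2_eq_square by (intro borel_measurable_times_ennreal Gm)
    have pw: "ennreal (\<bar>trunc_op K \<mu> \<epsilon> f X\<bar>\<^sup>2) \<le> 2 * (ennreal (b\<^sup>2) * (?mf X)\<^sup>2 + liminf (\<lambda>n. (G n X)\<^sup>2))"
      if eps: "\<epsilon> > 0" for \<epsilon> X
    proof -
      obtain N :: int where N: "2 powi (N - 2) \<le> \<epsilon>" "\<epsilon> < 2 powi (N - 1)"
        using exists_dyadic_scale[OF eps] by blast
      let ?KX = "\<lambda>Y. K (X - Y)"
      have subm: "(\<lambda>Y. X - Y) \<in> borel_measurable borel"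
        by (intro borel_measurable_continuous_onI continuous_intros)
      have KXm: "?KX \<in> borel_measurable borel" by (rule measurable_compose[OF subm Km])
      have cutm: "(\<lambda>Y. outer_cutoff i (X - Y)) \<in> borel_measurable borel" for i
        by (rule measurable_compose[OF subm outer_cutoff_measurable])
      have indm: "(\<lambda>Y. indicator {Y. pnorm (X - Y) > e} Y :: real) \<in> borel_measurable borel" for e
      proof -
        have "{Y \<in> space borel. pnorm (X - Y) > e} \<in> sets borel"
          using measurable_compose[OF subm pnorm_measurable] by measurable
        then show ?thesis by (intro borel_measurable_indicator) simp
      qed
      \<comment> \<open>The kernel outside the smaller dyadic radius; its product with
        \<open>f\<close> dominates all the truncated integrands below and makes them
        integrable.\<close>
      define u where "u Y = (indicator {Y. pnorm (X - Y) > 2 powi (N - 2)} Y :: real) * ?KX Y" for Y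
      have "u \<in> L2 \<mu>"
      proof (rule G.tail_in_L2[OF m _ A(1), where x = X and N = "N - 2"])
        show "u \<in> borel_measurable \<mu>" unfolding meas1 u_def by (intro borel_measurable_times indm KXm)
        fix Y assume "pnorm (X - Y) > 2 powi (N - 2)"
        moreover have "(2::real) powi (N - 2) > 0" by simp
        ultimately have "pnorm (X - Y) > 0" by (rule order_less_trans[rotated])
        then have "X - Y \<noteq> 0" using pnorm_eq_0_iff[of "X - Y"] by force
        then show "\<bar>u Y\<bar> \<le> A / pnorm (X - Y) ^ m" using A(2)[of "X - Y"] \<open>pnorm (X - Y) > 2 powi (N - 2)\<close>
          by (simp add: u_def)
      qed (simp add: u_def)
      then have uf: "integrable \<mu> (\<lambda>Y. u Y * f Y)" using f by (rule L2_integrable_product)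
      define v where "v w Y = w Y * ?KX Y * f Y" for w :: "(real^'n) \<times> real \<Rightarrow> real" and Y
      have v_int: "integrable \<mu> (v w)" and v_le: "\<And>Y. \<bar>v w Y\<bar> \<le> \<bar>u Y * f Y\<bar>"
        if w: "w \<in> borel_measurable borel" "\<And>Y. \<bar>w Y\<bar> \<le> 1" "\<And>Y. pnorm (X - Y) \<le> 2 powi (N - 2) \<Longrightarrow> w Y = 0" for w
      proof -
        show le: "\<bar>v w Y\<bar> \<le> \<bar>u Y * f Y\<bar>" for Y
        proof (cases "pnorm (X - Y) \<le> 2 powi (N - 2)")
          case False
          have "\<bar>w Y\<bar> * (\<bar>?KX Y\<bar> * \<bar>f Y\<bar>) \<le> 1 * (\<bar>?KX Y\<bar> * \<bar>f Y\<bar>)" using w(2) by (intro mult_right_mono) auto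
          then show ?thesis using False by (simp add: u_def v_def abs_mult mult.assoc)
        qed (simp add: v_def w(3))
        show "integrable \<mu> (v w)"
        proof (rule Bochner_Integration.integrable_bound[OF uf])
          show "v w \<in> borel_measurable \<mu>" unfolding meas1 v_def by (intro borel_measurable_times w KXm fb)
        qed (use le in auto)
      qed
      \<comment> \<open>Three weights on one footing: the sharp cutoff, the Lipschitz one, and the
        Lipschitz one with a finite outer range, which yields a finite sum of pieces.\<close>
      define w1 where "w1 Y = (indicator {Y. pnorm (X - Y) > \<epsilon>} Y :: real)" for Y
      define w2 where "w2 Y = outer_cutoff (N - 2) (X - Y)" for Y
      define w3 where "w3 n Y = outer_cutoff (N - 2) (X - Y) - outer_cutoff (int n - 1) (X - Y)" for n :: nat and Y
      have w1: "w1 \<in> borel_measurable borel" "\<And>Y. \<bar>w1 Y\<bar> \<le> 1" "\<And>Y. pnorm (X - Y) \<le> 2 powi (N - 2) \<Longrightarrow> w1 Y = 0"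
        using N(1) unfolding w1_def by (auto intro: indm simp: indicator_def)
      have w2: "w2 \<in> borel_measurable borel" "\<And>Y. \<bar>w2 Y\<bar> \<le> 1" "\<And>Y. pnorm (X - Y) \<le> 2 powi (N - 2) \<Longrightarrow> w2 Y = 0"
        unfolding w2_def by (auto intro: cutm simp: outer_cutoff_bounds outer_cutoff_eq_0)
      have w3: "w3 n \<in> borel_measurable borel" "\<bar>w3 n Y\<bar> \<le> 1" "pnorm (X - Y) \<le> 2 powi (N - 2) \<Longrightarrow> w3 n Y = 0"
        if n: "N \<le> int n" for n Y
      proof -
        show "w3 n \<in> borel_measurable borel" unfolding w3_def by (intro borel_measurable_diff cutm)
        show "\<bar>w3 n Y\<bar> \<le> 1" unfolding w3_def
          using outer_cutoff_bounds[of "N - 2" "X - Y"] outer_cutoff_bounds[of "int n - 1" "X - Y"] by linarith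
        assume "pnorm (X - Y) \<le> 2 powi (N - 2)"
        moreover have "(2::real) powi (N - 2) \<le> 2 powi (int n - 1)" using n by (intro power_int_increasing) auto
        ultimately show "w3 n Y = 0" unfolding w3_def by (simp add: outer_cutoff_eq_0)
      qed
      have trunc: "trunc_op K \<mu> \<epsilon> f X = (\<integral>Y. v w1 Y \<partial>\<mu>)"
        by (simp add: trunc_op_def set_lebesgue_integral_def v_def w1_def mult.assoc)
      define S where "S = (\<integral>Y. v w2 Y \<partial>\<mu>)"
      have Sn: "(\<Sum>j\<in>{N..int n}. F.T j f X) = (\<integral>Y. v (w3 n) Y \<partial>\<mu>)" if n: "N \<le> int n" for n
      proof -
        have "(\<Sum>j\<in>{N..int n}. F.T j f X) = (\<integral>Y. (\<Sum>j\<in>{N..int n}. kernel_piece K j (X - Y) * f Y) \<partial>\<mu>)"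
          unfolding integral_op_def
          by (intro Bochner_Integration.integral_sum[symmetric] G.bump_at_product(2)[OF F.T_at f])
        also have "\<dots> = (\<integral>Y. v (w3 n) Y \<partial>\<mu>)"
        proof (intro Bochner_Integration.integral_cong refl)
          fix Y
          have "(\<Sum>j\<in>{N..int n}. kernel_piece K j (X - Y) * f Y)
              = (\<Sum>j\<in>{N..int n}. kernel_piece K j (X - Y)) * f Y"
            by (rule sum_distrib_right[symmetric])
          also have "(\<Sum>j\<in>{N..int n}. kernel_piece K j (X - Y)) = ?KX Y * w3 n Y"
            using n unfolding w3_def by (intro sum_kernel_piece) simp
          finally show "(\<Sum>j\<in>{N..int n}. kernel_piece K j (X - Y) * f Y) = v (w3 n) Y"
            by (simp add: v_def mult_ac)
        qed
        finally show ?thesis .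
      qed
      \<comment> \<open>The shift makes the window of scales contain \<open>N\<close> from the first
        index on; the limit inferior is insensitive to it.\<close>
      obtain n0 :: nat where n0: "\<bar>N\<bar> \<le> int n0" by (metis abs_ge_zero nonneg_int_cases order_refl)
      have lim: "(\<lambda>n. \<integral>Y. v (w3 (n + n0)) Y \<partial>\<mu>) \<longlonglongrightarrow> S"
        unfolding S_def
      proof (rule integral_dominated_convergence[where w = "\<lambda>Y. \<bar>u Y * f Y\<bar>"])
        show "v w2 \<in> borel_measurable \<mu>" using v_int[OF w2] by simp
        have N': "N \<le> int (n + n0)" for n using n0 by linarith
        show "v (w3 (n + n0)) \<in> borel_measurable \<mu>" for n using v_int[OF w3[OF N']] by simp
        show "integrable \<mu> (\<lambda>Y. \<bar>u Y * f Y\<bar>)" using uf by simp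
        show "AE Y in \<mu>. norm (v (w3 (n + n0)) Y) \<le> \<bar>u Y * f Y\<bar>" for n
          using v_le[OF w3[OF N']] by simp
        \<comment> \<open>For fixed \<open>Y\<close> the sequence is eventually constant, because
          the outer cutoff vanishes once its inner radius exceeds the distance of \<open>X\<close>
          and \<open>Y\<close>.\<close>
        have "(\<lambda>n. v (w3 (n + n0)) Y) \<longlonglongrightarrow> v w2 Y" for Y
        proof (rule tendsto_eventually)
          obtain p :: nat where p: "pnorm (X - Y) < 2 ^ p" using real_arch_pow[of 2 "pnorm (X - Y)"] by auto
          have "v (w3 (n + n0)) Y = v w2 Y" if "n \<ge> Suc p" for n
          proof -
            have "(2::real) ^ p = 2 powi int p" by simp
            also have "\<dots> \<le> 2 powi (int (n + n0) - 1)" using that by (intro power_int_increasing) auto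
            finally have "outer_cutoff (int (n + n0) - 1) (X - Y) = 0" using p by (intro outer_cutoff_eq_0) simp
            then show ?thesis by (simp add: v_def w3_def w2_def)
          qed
          then show "\<forall>\<^sub>F n in sequentially. v (w3 (n + n0)) Y = v w2 Y" by (auto simp: eventually_sequentially)
        qed
        then show "AE Y in \<mu>. (\<lambda>n. v (w3 (n + n0)) Y) \<longlonglongrightarrow> v w2 Y" by simp
      qed
      have "ennreal (S\<^sup>2) \<le> liminf (\<lambda>n. (G n X)\<^sup>2)"
      proof -
        have "(\<lambda>n. (\<integral>Y. v (w3 (n + n0)) Y \<partial>\<mu>)\<^sup>2) \<longlonglongrightarrow> S\<^sup>2" by (intro tendsto_power lim)
        then have "(\<lambda>n. ennreal ((\<integral>Y. v (w3 (n + n0)) Y \<partial>\<mu>)\<^sup>2)) \<longlonglongrightarrow> ennreal (S\<^sup>2)" by (rule tendsto_ennrealI)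
        then have "ennreal (S\<^sup>2) = liminf (\<lambda>n. ennreal ((\<integral>Y. v (w3 (n + n0)) Y \<partial>\<mu>)\<^sup>2))"
          by (intro lim_imp_Liminf[symmetric]) auto
        also have "\<dots> \<le> liminf (\<lambda>n. (G (n + n0) X)\<^sup>2)"
        proof (intro Liminf_mono always_eventually allI)
          fix n
          have n: "N \<le> int (n + n0)" "- int (n + n0) \<le> N" using n0 by linarith+
          have "ennreal \<bar>\<integral>Y. v (w3 (n + n0)) Y \<partial>\<mu>\<bar> \<le> G (n + n0) X"
            unfolding Sn[OF n(1), symmetric] G_def using n by (intro SUP_upper2[of N]) auto
          then have "(ennreal \<bar>\<integral>Y. v (w3 (n + n0)) Y \<partial>\<mu>\<bar>)\<^sup>2 \<le> (G (n + n0) X)\<^sup>2" by (intro power_mono) auto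
          then show "ennreal ((\<integral>Y. v (w3 (n + n0)) Y \<partial>\<mu>)\<^sup>2) \<le> (G (n + n0) X)\<^sup>2"
            by (simp only: ennreal_abs_power2)
        qed
        also have "\<dots> = liminf (\<lambda>n. (G n X)\<^sup>2)"
          using liminf_shift_k[of "\<lambda>n. (G n X)\<^sup>2" n0] by simp
        finally show ?thesis .
      qed
      moreover have "ennreal \<bar>trunc_op K \<mu> \<epsilon> f X - S\<bar> \<le> ennreal b * ?mf X"
      proof -
        define p where "p Y = (w1 Y - w2 Y) * ?KX Y" for Y
        have eq: "trunc_op K \<mu> \<epsilon> f X - S = (\<integral>Y. p Y * f Y \<partial>\<mu>)"
          unfolding trunc S_def using v_int[OF w1] v_int[OF w2]
          by (subst Bochner_Integration.integral_diff[symmetric]) (auto simp: v_def p_def algebra_simps)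
        have p1: "(2::real) powi (N - 1) = 2 * 2 powi (N - 2)" by (simp add: power_int_diff)
        have "G.bump_at b (N - 1) X p"
        proof (rule G.bump_atI[OF _ b0])
          show "p \<in> borel_measurable \<mu>"
            unfolding meas1 p_def by (intro borel_measurable_times borel_measurable_diff w1 w2 KXm)
          show "p Y = 0" if "2 powi (N - 1) \<le> pnorm (X - Y)" for Y
            using that N(2) outer_cutoff_eq_1[of "N - 2" "X - Y"] by (simp add: p_def w1_def w2_def)
          show "\<bar>p Y\<bar> \<le> b * G.weight (N - 1)" for Y
          proof (cases "pnorm (X - Y) \<le> 2 powi (N - 2)")
            case True
            then show ?thesis using w1(3) w2(3) b0 G.weight_pos[of "N - 1"] by (simp add: p_def)
          next
            case False
            have pos: "(2::real) powi (N - 2) > 0" by simp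
            have "pnorm (X - Y) > 0" using False by (intro order_less_trans[OF pos]) simp
            then have "X - Y \<noteq> 0" using pnorm_eq_0_iff[of "X - Y"] by force
            then have "\<bar>?KX Y\<bar> \<le> A / pnorm (X - Y) ^ m" by (rule A(2))
            also have "\<dots> \<le> A / (2 powi (N - 2)) ^ m"
              using False A(1) pos \<open>pnorm (X - Y) > 0\<close>
              by (intro divide_left_mono power_mono mult_pos_pos zero_less_power) simp_all
            also have "\<dots> = b * G.weight (N - 1)"
              unfolding b_def G.weight_def p1 by (simp add: power_mult_distrib)
            finally have k: "\<bar>?KX Y\<bar> \<le> b * G.weight (N - 1)" .
            have "\<bar>w1 Y - w2 Y\<bar> \<le> 1"
              unfolding w1_def w2_def using outer_cutoff_bounds[of "N - 2" "X - Y"] by (auto simp: indicator_def)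
            then have "\<bar>w1 Y - w2 Y\<bar> * \<bar>?KX Y\<bar> \<le> 1 * (b * G.weight (N - 1))"
              using k by (intro mult_mono) auto
            then show ?thesis by (simp add: p_def abs_mult)
          qed
        qed
        from G.bump_at_product(3)[OF this f]
        have "ennreal \<bar>trunc_op K \<mu> \<epsilon> f X - S\<bar> \<le> ennreal b * G.ball_avg (N - 1) (\<lambda>Y. ennreal \<bar>f Y\<bar>) X"
          by (simp add: eq)
        also have "\<dots> \<le> ennreal b * ?mf X"
          unfolding G.maximal_def by (intro mult_left_mono SUP_upper) auto
        finally show ?thesis .
      qed
      then have "(ennreal \<bar>trunc_op K \<mu> \<epsilon> f X - S\<bar>)\<^sup>2 \<le> (ennreal b * ?mf X)\<^sup>2" by (intro power_mono) auto
      then have "ennreal ((trunc_op K \<mu> \<epsilon> f X - S)\<^sup>2) \<le> ennreal (b\<^sup>2) * (?mf X)\<^sup>2"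
        using b0 by (simp add: ennreal_abs_power2 power_mult_distrib ennreal_power)
      moreover have "ennreal (\<bar>trunc_op K \<mu> \<epsilon> f X\<bar>\<^sup>2) \<le> 2 * (ennreal ((trunc_op K \<mu> \<epsilon> f X - S)\<^sup>2) + ennreal (S\<^sup>2))"
      proof -
        let ?t = "trunc_op K \<mu> \<epsilon> f X"
        have "?t\<^sup>2 \<le> 2 * ((?t - S)\<^sup>2 + S\<^sup>2)"
          using zero_le_power2[of "?t - 2 * S"] by (simp add: power2_eq_square algebra_simps)
        then have "ennreal (?t\<^sup>2) \<le> ennreal (2 * ((?t - S)\<^sup>2 + S\<^sup>2))" by (rule ennreal_leI)
        also have "\<dots> = 2 * (ennreal ((?t - S)\<^sup>2) + ennreal (S\<^sup>2))"
          by (simp add: ennreal_mult' ennreal_plus del: distrib_left_numeral)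
        finally show ?thesis by simp
      qed
      ultimately show ?thesis
        by (meson add_mono mult_left_mono order_trans zero_le)
    qed
    have "(\<integral>\<^sup>+ X. (SUP \<epsilon>\<in>{0<..}. ennreal (\<bar>trunc_op K \<mu> \<epsilon> f X\<bar>\<^sup>2)) \<partial>\<mu>)
        \<le> (\<integral>\<^sup>+ X. 2 * (ennreal (b\<^sup>2) * (?mf X)\<^sup>2 + liminf (\<lambda>n. (G n X)\<^sup>2)) \<partial>\<mu>)"
      by (intro nn_integral_mono SUP_least pw) auto
    also have "\<dots> = 2 * (ennreal (b\<^sup>2) * (\<integral>\<^sup>+ X. (?mf X)\<^sup>2 \<partial>\<mu>) + (\<integral>\<^sup>+ X. liminf (\<lambda>n. (G n X)\<^sup>2) \<partial>\<mu>))"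
    proof -
      have mm: "(\<lambda>X. (?mf X)\<^sup>2) \<in> borel_measurable \<mu>"
        using fm by measurable
      have lm: "(\<lambda>X. liminf (\<lambda>n. (G n X)\<^sup>2)) \<in> borel_measurable \<mu>"
        by (intro borel_measurable_liminf Gm2)
      show ?thesis
        by (subst nn_integral_cmult, intro borel_measurable_add borel_measurable_times_ennreal borel_measurable_const mm lm,
            subst nn_integral_add, intro borel_measurable_times_ennreal borel_measurable_const mm, rule lm,
            subst nn_integral_cmult, rule mm, rule refl)
    qed
    also have "\<dots> \<le> 2 * (ennreal (b\<^sup>2) * (ennreal G.maximal_const * (\<integral>\<^sup>+ X. ennreal ((f X)\<^sup>2) \<partial>\<mu>))
        + ennreal D * (\<integral>\<^sup>+ X. ennreal ((f X)\<^sup>2) \<partial>\<mu>))"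
    proof (intro mult_left_mono add_mono)
      have "(\<integral>\<^sup>+ X. (?mf X)\<^sup>2 \<partial>\<mu>) \<le> ennreal G.maximal_const * (\<integral>\<^sup>+ X. (ennreal \<bar>f X\<bar>)\<^sup>2 \<partial>\<mu>)"
        using fm ffin by (intro G.maximal_bound) (auto simp: ennreal_abs_power2)
      then show "(\<integral>\<^sup>+ X. (?mf X)\<^sup>2 \<partial>\<mu>) \<le> ennreal G.maximal_const * (\<integral>\<^sup>+ X. ennreal ((f X)\<^sup>2) \<partial>\<mu>)"
        by (simp only: ennreal_abs_power2)
      \<comment> \<open>Fatou's lemma; the bound for each window of scales is uniform in
        \<open>n\<close>.\<close>
      have "(\<integral>\<^sup>+ X. liminf (\<lambda>n. (G n X)\<^sup>2) \<partial>\<mu>) \<le> liminf (\<lambda>n. \<integral>\<^sup>+ X. (G n X)\<^sup>2 \<partial>\<mu>)"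
        by (intro nn_integral_liminf Gm2)
      also have "\<dots> \<le> liminf (\<lambda>n::nat. ennreal D * (\<integral>\<^sup>+ X. ennreal ((f X)\<^sup>2) \<partial>\<mu>))"
        unfolding G_def D_def
        by (intro Liminf_mono always_eventually allI F.truncations_bound[OF c0 low f])
      finally show "(\<integral>\<^sup>+ X. liminf (\<lambda>n. (G n X)\<^sup>2) \<partial>\<mu>) \<le> ennreal D * (\<integral>\<^sup>+ X. ennreal ((f X)\<^sup>2) \<partial>\<mu>)"
        by (simp add: Liminf_const)
    qed auto
    also have "\<dots> = ennreal (2 * (b\<^sup>2 * G.maximal_const + D)) * (\<integral>\<^sup>+ X. ennreal ((f X)\<^sup>2) \<partial>\<mu>)"
      using D0 G.maximal_const_pos
      by (simp add: ennreal_mult' ennreal_plus distrib_right mult.assoc del: distrib_left_numeral)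
    finally show ?thesis .
  qed
  show ?thesis
    unfolding CZO_L2_bounded_def
  proof (intro exI conjI ballI impI)
    \<comment> \<open>Of \<open>b\<close> and \<open>D\<close> only nonnegativity has been recorded;
      the summand 1 makes the constant positive.\<close>
    show "2 * (b\<^sup>2 * G.maximal_const + D) + 1 > 0"
      using D0 G.maximal_const_pos by (intro add_nonneg_pos) auto
    fix f assume f: "f \<in> borel_measurable \<mu>" "(\<integral>\<^sup>+ X. ennreal ((f X)\<^sup>2) \<partial>\<mu>) < \<infinity>"
    show "(\<integral>\<^sup>+ X. (SUP \<epsilon>\<in>{0<..}. ennreal (\<bar>trunc_op K \<mu> \<epsilon> f X\<bar>\<^sup>2)) \<partial>\<mu>)
        \<le> ennreal (2 * (b\<^sup>2 * G.maximal_const + D) + 1) * (\<integral>\<^sup>+ X. ennreal ((f X)\<^sup>2) \<partial>\<mu>)"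
      by (rule order_trans[OF main[OF f]]) (intro mult_right_mono ennreal_leI, auto)
  qed
qed

section \<open>Product measures\<close>

text \<open>Every point off the support has a null neighbourhood taken from a countable basis, so
  countably many null sets cover the complement.\<close>

lemma emeasure_Compl_msupport:
  fixes M :: "'a::second_countable_topology measure"
  assumes sets: "sets M = sets borel"
  shows "emeasure M (- msupport M) = 0"
proof -
  obtain B :: "'a set set" where B: "countable B" "topological_basis B" using ex_countable_basis by blast
  let ?B = "{U \<in> B. emeasure M U = 0}"
  have "- msupport M \<subseteq> \<Union>?B"
  proof
    fix x assume "x \<in> - msupport M"
    then obtain U where U: "open U" "x \<in> U" "emeasure M U = 0" by (auto simp: msupport_def)
    then obtain V where V: "V \<in> B" "x \<in> V" "V \<subseteq> U"
      using topological_basisE[OF B(2)] by metis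
    then have "emeasure M V = 0" using U emeasure_mono[of V U M] by (simp add: sets)
    then show "x \<in> \<Union>?B" using V by blast
  qed
  moreover have "\<Union>?B \<in> null_sets M"
  proof (rule null_sets_UN'[of ?B id M, simplified])
    show "countable ?B" using B(1) by (rule countable_subset[rotated]) blast
    show "U \<in> null_sets M" if "U \<in> B \<and> emeasure M U = 0" for U
      using that topological_basis_open[OF B(2)] sets by auto
  qed
  ultimately show ?thesis by (metis emeasure_eq_0 null_setsD1 null_setsD2)
qed

lemma locally_finite_borel_sigma_finite:
  fixes M :: "'a::second_countable_topology measure"
  assumes "locally_finite_borel M"
  shows "sigma_finite_measure M"
proof
  have sets: "sets M = sets borel" and fin: "\<And>x. \<exists>U. open U \<and> x \<in> U \<and> emeasure M U < \<infinity>"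
    using assms by (auto simp: locally_finite_borel_def)
  obtain B :: "'a set set" where B: "countable B" "topological_basis B" using ex_countable_basis by blast
  let ?B = "{U \<in> B. emeasure M U < \<infinity>}"
  have open_B: "open U" if "U \<in> B" for U using topological_basis_open[OF B(2) that] .
  have "\<Union>?B = UNIV"
  proof (intro equalityI subsetI UNIV_I)
    fix x
    obtain U where U: "open U" "x \<in> U" "emeasure M U < \<infinity>" using fin by blast
    then obtain V where V: "V \<in> B" "x \<in> V" "V \<subseteq> U"
      using topological_basisE[OF B(2)] by metis
    then have "emeasure M V < \<infinity>" using U emeasure_mono[of V U M] by (auto simp: sets intro: order_le_less_trans)
    then show "x \<in> \<Union>?B" using V by blast
  qed
  show "\<exists>A. countable A \<and> A \<subseteq> sets M \<and> \<Union>A = space M \<and> (\<forall>a\<in>A. emeasure M a \<noteq> \<infinity>)"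
  proof (intro exI[of _ ?B] conjI ballI)
    show "countable ?B" by (rule countable_subset[OF _ B(1)]) blast
    show "?B \<subseteq> sets M" using open_B by (auto simp: sets)
    show "\<Union>?B = space M" using \<open>\<Union>?B = UNIV\<close> sets_eq_imp_space_eq[OF sets] by simp
  qed auto
qed

text \<open>Halving the radius suffices for the inner cylinder because
  \<open>2 * (r / 2)\<^sup>2 \<le> r\<^sup>2\<close>; the time intervals are those of
  \<open>time_growth\<close>.\<close>

lemma pball_bounds:
  shows "pball X r \<subseteq> ball (fst X) r \<times> {snd X - r\<^sup>2<..<snd X + r\<^sup>2}"
    and "r > 0 \<Longrightarrow> ball (fst X) (r / 2) \<times> {snd X - (r / 2)\<^sup>2<..<snd X + (r / 2)\<^sup>2} \<subseteq> pball X r"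
proof -
  show "pball X r \<subseteq> ball (fst X) r \<times> {snd X - r\<^sup>2<..<snd X + r\<^sup>2}"
  proof
    fix Y assume "Y \<in> pball X r"
    then have Y: "pnorm (X - Y) < r" by (simp add: pball_def)
    then have r: "r > 0" using pnorm_nonneg[of "X - Y"] by linarith
    have "(pnorm (X - Y))\<^sup>2 < r\<^sup>2" using Y by (intro power_strict_mono) (auto simp: pnorm_nonneg)
    then have Y2: "(norm (fst X - fst Y))\<^sup>2 + \<bar>snd X - snd Y\<bar> < r\<^sup>2" by (simp add: pnorm_power2)
    then have "(norm (fst X - fst Y))\<^sup>2 < r\<^sup>2" by linarith
    then have "norm (fst X - fst Y) < r" using r by (intro power_less_imp_less_base[of _ 2 r]) auto
    moreover have "\<bar>snd X - snd Y\<bar> < r\<^sup>2" using Y2 zero_le_power2[of "norm (fst X - fst Y)"] by linarith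
    ultimately show "Y \<in> ball (fst X) r \<times> {snd X - r\<^sup>2<..<snd X + r\<^sup>2}"
      by (auto simp: dist_norm mem_Times_iff abs_less_iff)
  qed
  assume r: "r > 0"
  show "ball (fst X) (r / 2) \<times> {snd X - (r / 2)\<^sup>2<..<snd X + (r / 2)\<^sup>2} \<subseteq> pball X r"
  proof
    fix Y assume "Y \<in> ball (fst X) (r / 2) \<times> {snd X - (r / 2)\<^sup>2<..<snd X + (r / 2)\<^sup>2}"
    then have Y: "norm (fst X - fst Y) < r / 2" "\<bar>snd X - snd Y\<bar> < (r / 2)\<^sup>2"
      by (auto simp: dist_norm mem_Times_iff abs_less_iff)
    then have "(norm (fst X - fst Y))\<^sup>2 < (r / 2)\<^sup>2" by (intro power_strict_mono) auto
    then have "(pnorm (X - Y))\<^sup>2 < (r / 2)\<^sup>2 + (r / 2)\<^sup>2" using Y by (simp add: pnorm_power2)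
    also have "\<dots> \<le> r\<^sup>2" by (simp add: power_divide)
    finally have "pnorm (X - Y) < r" using r by (intro power_less_imp_less_base[of _ 2 r]) auto
    then show "Y \<in> pball X r" by (simp add: pball_def)
  qed
qed

lemma open_pball: "open (pball X r)"
  unfolding pball_def by (intro open_Collect_less continuous_intros)

lemma pball_subset_double:
  assumes "Y \<in> pball X r"
  shows "pball X r \<subseteq> pball Y (2 * r)"
proof
  fix Z assume "Z \<in> pball X r"
  then show "Z \<in> pball Y (2 * r)"
    using assms pnorm_triangle[of Y Z X] pnorm_minus_commute[of X Y] by (simp add: pball_def)
qed

text \<open>Prescribing the product of the two growth functions covers the three cases at once:
  \<open>\<phi>\<close> and \<open>\<psi>\<close> are \<open>r ^ (k + 1)\<close> and
  \<open>r\<close>, or \<open>r ^ k * max 1 r\<close> and \<open>min r (r\<^sup>2)\<close>, or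
  \<open>r ^ (k + 2)\<close> and 1. The closed set \<open>G\<close> carries \<open>\<sigma>\<close>
  and stands in for its support.\<close>

theorem product_regular_CZO_bounded:
  fixes \<sigma> :: "(real^'n) measure" and \<nu> :: "real measure" and \<phi> \<psi> :: "real \<Rightarrow> real"
  assumes sets: "sets \<sigma> = sets borel" and G: "closed G" and null: "emeasure \<sigma> (- G) = 0"
    and reflect: "\<And>x. x \<in> G \<Longrightarrow> distr \<sigma> borel (\<lambda>y. 2 *\<^sub>R x - y) = \<sigma>"
    and a: "a > 0" "A > 0"
    and lower: "\<And>x r. x \<in> G \<Longrightarrow> r > 0 \<Longrightarrow> ennreal (a * \<phi> r) \<le> emeasure \<sigma> (ball x r)"
    and upper: "\<And>x r. x \<in> G \<Longrightarrow> r > 0 \<Longrightarrow> emeasure \<sigma> (ball x r) \<le> ennreal (A * \<phi> r)"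
    and lf: "locally_finite_borel \<nu>" and tg: "time_growth \<psi> \<nu>"
    and pos: "\<And>r. r > 0 \<Longrightarrow> \<phi> r \<ge> 0" "\<And>r. r > 0 \<Longrightarrow> \<psi> r \<ge> 0"
    and prod: "\<And>r. r > 0 \<Longrightarrow> \<phi> r * \<psi> r = r ^ m" and m: "m \<ge> 1"
  shows "parabolic_regular m (\<sigma> \<Otimes>\<^sub>M \<nu>) \<and> all_CZOs_bounded m (\<sigma> \<Otimes>\<^sub>M \<nu>)"
proof -
  let ?\<mu> = "\<sigma> \<Otimes>\<^sub>M \<nu>"
  have sets\<nu>: "sets \<nu> = sets borel" using lf by (simp add: locally_finite_borel_def)
  have sets\<mu>: "sets ?\<mu> = sets borel"
    using sets_pair_measure_cong[OF sets sets\<nu>] borel_prod by metis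
  have lf\<sigma>: "locally_finite_borel \<sigma>"
    unfolding locally_finite_borel_def
  proof (intro conjI allI sets)
    fix x
    show "\<exists>U. open U \<and> x \<in> U \<and> emeasure \<sigma> U < \<infinity>"
    proof (cases "x \<in> G")
      case True
      then have "emeasure \<sigma> (ball x 1) < \<infinity>" using upper[of x 1] by (auto intro: order_le_less_trans)
      then show ?thesis by (intro exI[of _ "ball x 1"]) auto
    next
      case False
      then show ?thesis using G null by (intro exI[of _ "- G"]) auto
    qed
  qed
  interpret S: sigma_finite_measure \<sigma> by (rule locally_finite_borel_sigma_finite[OF lf\<sigma>])
  interpret N: sigma_finite_measure \<nu> by (rule locally_finite_borel_sigma_finite[OF lf])
  have Times: "emeasure ?\<mu> (P \<times> Q) = emeasure \<sigma> P * emeasure \<nu> Q" if "P \<in> sets borel" "Q \<in> sets borel" for P Q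
    using that by (intro N.emeasure_pair_measure_Times) (auto simp: sets sets\<nu>)
  have lf\<mu>: "locally_finite_borel ?\<mu>"
    unfolding locally_finite_borel_def
  proof (intro conjI allI sets\<mu>)
    fix X :: "(real^'n) \<times> real"
    obtain U where U: "open U" "fst X \<in> U" "emeasure \<sigma> U < \<infinity>"
      using lf\<sigma> unfolding locally_finite_borel_def by blast
    obtain V where V: "open V" "snd X \<in> V" "emeasure \<nu> V < \<infinity>"
      using lf unfolding locally_finite_borel_def by blast
    have "emeasure ?\<mu> (U \<times> V) < \<infinity>" using U V by (subst Times) (auto simp: ennreal_mult_less_top)
    then show "\<exists>W. open W \<and> X \<in> W \<and> emeasure ?\<mu> W < \<infinity>"
      using U V by (intro exI[of _ "U \<times> V"]) (auto intro: open_Times simp: mem_Times_iff)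
  qed
  obtain A' where A': "A' > 0" "\<And>t r. t \<in> msupport \<nu> \<Longrightarrow> r > 0 \<Longrightarrow> ennreal (\<psi> r / A') \<le> emeasure \<nu> {t - r\<^sup>2<..<t + r\<^sup>2}"
    "\<And>t r. t \<in> msupport \<nu> \<Longrightarrow> r > 0 \<Longrightarrow> emeasure \<nu> {t - r\<^sup>2<..<t + r\<^sup>2} \<le> ennreal (A' * \<psi> r)"
    using tg unfolding time_growth_def by blast
  \<comment> \<open>The lower bound is taken on the inner cylinder of radius \<open>r / 2\<close>,
    whence the factor \<open>2 ^ m\<close>.\<close>
  define c where "c = a / (A' * 2 ^ m)"
  have c0: "c > 0" using a A'(1) by (simp add: c_def)
  let ?S = "G \<times> msupport \<nu>"
  have up: "emeasure ?\<mu> (pball X r) \<le> ennreal (A * A' * r ^ m)"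
    and lo: "ennreal (c * r ^ m) \<le> emeasure ?\<mu> (pball X r)" if X: "X \<in> ?S" and r: "r > 0" for X r
  proof -
    have xt: "fst X \<in> G" "snd X \<in> msupport \<nu>" using X by (auto simp: mem_Times_iff)
    have "emeasure ?\<mu> (pball X r) \<le> emeasure ?\<mu> (ball (fst X) r \<times> {snd X - r\<^sup>2<..<snd X + r\<^sup>2})"
      by (intro emeasure_mono pball_bounds) (auto simp: sets\<mu> intro!: borel_open open_Times)
    also have "\<dots> = emeasure \<sigma> (ball (fst X) r) * emeasure \<nu> {snd X - r\<^sup>2<..<snd X + r\<^sup>2}"
      by (intro Times) auto
    also have "\<dots> \<le> ennreal (A * \<phi> r) * ennreal (A' * \<psi> r)"
      by (intro mult_mono upper A' xt r) auto
    also have "\<dots> = ennreal (A * A' * r ^ m)"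
      using a A'(1) pos[OF r] prod[OF r] by (subst ennreal_mult'[symmetric]) (auto simp: mult_ac)
    finally show "emeasure ?\<mu> (pball X r) \<le> ennreal (A * A' * r ^ m)" .
    have r2: "r / 2 > 0" using r by simp
    have "ennreal (c * r ^ m) = ennreal (a * \<phi> (r / 2)) * ennreal (\<psi> (r / 2) / A')"
    proof -
      have "c * r ^ m = (a / A') * (r / 2) ^ m" by (simp add: c_def power_divide)
      also have "\<dots> = (a * \<phi> (r / 2)) * (\<psi> (r / 2) / A')" using prod[OF r2] by simp
      finally show ?thesis using a A'(1) pos[OF r2] by (simp add: ennreal_mult'[symmetric])
    qed
    also have "\<dots> \<le> emeasure \<sigma> (ball (fst X) (r / 2)) * emeasure \<nu> {snd X - (r / 2)\<^sup>2<..<snd X + (r / 2)\<^sup>2}"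
      by (intro mult_mono lower A' xt r2) auto
    also have "\<dots> = emeasure ?\<mu> (ball (fst X) (r / 2) \<times> {snd X - (r / 2)\<^sup>2<..<snd X + (r / 2)\<^sup>2})"
      by (intro Times[symmetric]) auto
    also have "\<dots> \<le> emeasure ?\<mu> (pball X r)"
      by (intro emeasure_mono pball_bounds r) (auto simp: sets\<mu> intro!: borel_open open_pball)
    finally show "ennreal (c * r ^ m) \<le> emeasure ?\<mu> (pball X r)" .
  qed
  \<comment> \<open>The bounds are known at the points of \<open>?S\<close>; this inclusion carries
    them over to the support of the product.\<close>
  have supp: "msupport ?\<mu> \<subseteq> ?S"
  proof
    fix X assume X: "X \<in> msupport ?\<mu>"
    have "fst X \<in> G"
    proof (rule ccontr)
      assume "fst X \<notin> G"
      moreover have "open ((- G) \<times> (UNIV :: real set))" using G by (intro open_Times) auto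
      ultimately have "emeasure ?\<mu> ((- G) \<times> UNIV) > 0" using X by (auto simp: msupport_def mem_Times_iff)
      then show False using G null by (subst (asm) Times) auto
    qed
    moreover have "snd X \<in> msupport \<nu>"
      unfolding msupport_def
    proof (intro CollectI allI impI)
      fix U assume U: "open U \<and> snd X \<in> U"
      then have "open ((UNIV :: (real^'n) set) \<times> U)" "X \<in> UNIV \<times> U"
        by (simp_all add: open_Times mem_Times_iff)
      then have "emeasure ?\<mu> (UNIV \<times> U) > 0"
        using X unfolding msupport_def by blast
      then show "emeasure \<nu> U > 0" using U by (subst (asm) Times) (auto simp: zero_less_iff_neq_zero)
    qed
    ultimately show "X \<in> ?S" by (simp add: mem_Times_iff)
  qed
  have supp_borel: "msupport \<nu> \<in> sets borel"
  proof -
    have "open (- msupport \<nu>)"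
    proof (subst open_subopen, intro ballI)
      fix x assume "x \<in> - msupport \<nu>"
      then obtain U where "open U" "x \<in> U" "\<not> emeasure \<nu> U > 0" by (auto simp: msupport_def)
      then show "\<exists>T. open T \<and> x \<in> T \<and> T \<subseteq> - msupport \<nu>" unfolding msupport_def by blast
    qed
    then show ?thesis by (auto simp: closed_def intro: borel_closed)
  qed
  have null_S: "- ?S \<in> null_sets ?\<mu>"
  proof (rule null_sets_subset)
    show "(- G) \<times> UNIV \<union> UNIV \<times> (- msupport \<nu>) \<in> null_sets ?\<mu>"
    proof (intro null_sets.Un null_setsI)
      show "emeasure ?\<mu> ((- G) \<times> UNIV) = 0" using G null by (subst Times) auto
      show "emeasure ?\<mu> (UNIV \<times> (- msupport \<nu>)) = 0"
        using supp_borel emeasure_Compl_msupport[OF sets\<nu>] by (subst Times) auto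
    qed (use G supp_borel in \<open>auto simp: sets sets\<nu> intro!: pair_measureI\<close>)
    have "?S \<in> sets ?\<mu>" using G supp_borel by (intro pair_measureI) (auto simp: sets sets\<nu>)
    then show "- ?S \<in> sets ?\<mu>" by (simp add: sets\<mu> borel_comp)
  qed auto
  then have AE_S: "AE X in ?\<mu>. X \<in> ?S"
    by (rule AE_I') auto
  \<comment> \<open>Centres off \<open>?S\<close> are included, as \<open>growth_space\<close>
    demands: a ball missing \<open>?S\<close> is null, and any other lies in a ball of twice the
    radius about a point of \<open>?S\<close>.\<close>
  have up_all: "emeasure ?\<mu> (pball X r) \<le> ennreal ((A * A' * 2 ^ m) * r ^ m)" if r: "r > 0" for X r
  proof (cases "pball X r \<inter> ?S = {}")
    case True
    then have "pball X r \<subseteq> - ?S" by blast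
    then have "emeasure ?\<mu> (pball X r) \<le> emeasure ?\<mu> (- ?S)" using null_S by (intro emeasure_mono) auto
    then have "emeasure ?\<mu> (pball X r) \<le> 0" by (simp only: null_setsD1[OF null_S])
    then show ?thesis by (rule order_trans) simp
  next
    case False
    then obtain Y where Y: "Y \<in> pball X r" "Y \<in> ?S" by blast
    have "emeasure ?\<mu> (pball X r) \<le> emeasure ?\<mu> (pball Y (2 * r))"
      by (intro emeasure_mono pball_subset_double Y) (auto simp: sets\<mu> intro!: borel_open open_pball)
    also have "\<dots> \<le> ennreal (A * A' * (2 * r) ^ m)" using r by (intro up Y) auto
    finally show ?thesis by (simp add: power_mult_distrib mult.assoc)
  qed
  \<comment> \<open>The reflection acts on the spatial factor alone, so the product inherits the
    invariance of \<open>\<sigma>\<close>.\<close>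
  have refl': "distr ?\<mu> borel (\<lambda>Y. (2 *\<^sub>R x - fst Y, snd Y)) = ?\<mu>" if x: "x \<in> G" for x
  proof -
    have f: "(\<lambda>y. 2 *\<^sub>R x - y) \<in> measurable \<sigma> borel"
      unfolding measurable_cong_sets[OF sets refl]
      by (intro borel_measurable_continuous_onI continuous_intros)
    have id: "distr \<nu> \<nu> (\<lambda>t. t) = \<nu>" by (rule distr_id)
    have "?\<mu> = distr \<sigma> borel (\<lambda>y. 2 *\<^sub>R x - y) \<Otimes>\<^sub>M distr \<nu> \<nu> (\<lambda>t. t)"
      by (simp only: reflect[OF x] id)
    also have "\<dots> = distr ?\<mu> (borel \<Otimes>\<^sub>M \<nu>) (\<lambda>(y, t). (2 *\<^sub>R x - y, t))"
      by (rule pair_measure_distr[OF f]) (auto simp: id N.sigma_finite_measure_axioms)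
    also have "\<dots> = distr ?\<mu> borel (\<lambda>Y. (2 *\<^sub>R x - fst Y, snd Y))"
    proof (rule distr_cong[OF refl])
      show "sets (borel \<Otimes>\<^sub>M \<nu>) = sets (borel :: ((real^'n) \<times> real) measure)"
        using sets_pair_measure_cong[OF refl sets\<nu>] borel_prod by metis
    qed (simp add: case_prod_beta)
    finally show ?thesis by simp
  qed
  have "parabolic_regular m ?\<mu>"
    unfolding parabolic_regular_def
  proof (intro conjI lf\<mu> exI[of _ "max (A * A') (1 / c)"] ballI allI impI)
    show "max (A * A') (1 / c) > 0" using a A'(1) by (simp add: less_max_iff_disj)
    fix X r assume X: "X \<in> msupport ?\<mu>" and r: "(r::real) > 0"
    have X: "X \<in> ?S" using X supp by blast
    have "r ^ m / max (A * A') (1 / c) \<le> r ^ m / (1 / c)"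
      using r c0 a A'(1) by (intro divide_left_mono mult_pos_pos) (auto simp: less_max_iff_disj)
    then have "ennreal (r ^ m / max (A * A') (1 / c)) \<le> ennreal (c * r ^ m)"
      by (intro ennreal_leI) (simp add: mult.commute)
    then show "ennreal (r ^ m / max (A * A') (1 / c)) \<le> emeasure ?\<mu> (pball X r)"
      using lo[OF X r] by (rule order_trans)
    have "ennreal (A * A' * r ^ m) \<le> ennreal (max (A * A') (1 / c) * r ^ m)"
      using r by (intro ennreal_leI mult_right_mono) auto
    then show "emeasure ?\<mu> (pball X r) \<le> ennreal (max (A * A') (1 / c) * r ^ m)"
      using up[OF X r] by (rule order_trans[rotated])
  qed
  moreover have "all_CZOs_bounded m ?\<mu>"
    unfolding all_CZOs_bounded_def
  proof (intro allI impI)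
    fix K :: "(real^'n) \<times> real \<Rightarrow> real" assume K: "admissible_kernel m K"
    show "CZO_L2_bounded K ?\<mu>"
    proof (rule CZO_L2_bounded_of_reflections[OF sets\<mu> locally_finite_borel_sigma_finite[OF lf\<mu>] m _ up_all c0 _ _ K])
      show "A * A' * 2 ^ m > 0" using a A'(1) by simp
      show "AE X in ?\<mu>. \<forall>r>0. ennreal (c * r ^ m) \<le> emeasure ?\<mu> (pball X r)"
        using AE_S by eventually_elim (auto intro: lo)
      show "AE X in ?\<mu>. distr ?\<mu> borel (\<lambda>Y. (2 *\<^sub>R fst X - fst Y, snd Y)) = ?\<mu>"
        using AE_S by eventually_elim (auto intro: refl')
    qed
  qed
  ultimately show ?thesis ..
qed

section \<open>Measures on planes and on stacks of planes\<close>

lemma plane_closed: "is_plane m L \<Longrightarrow> closed L"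
  by (simp add: is_plane_def affine_closed)

lemma plane_reflection:
  assumes L: "is_plane m L" and "x \<in> L" "y \<in> L"
  shows "2 *\<^sub>R x - y \<in> L"
  using mem_affine[of L x y 2 "- 1"] assms by (simp add: is_plane_def)

text \<open>Hausdorff measure is invariant under isometries, and the reflection in a point of
  \<open>L\<close> maps \<open>L\<close> onto itself.\<close>

lemma hausdorff_on_reflection:
  assumes L: "is_plane m L" and x: "x \<in> L"
  shows "distr (hausdorff_on l L) borel (\<lambda>y. 2 *\<^sub>R x - y) = hausdorff_on l L"
proof (rule measure_eqI)
  fix A assume "A \<in> sets (distr (hausdorff_on l L) borel (\<lambda>y. 2 *\<^sub>R x - y))"
  then have A: "A \<in> sets borel" by simp
  let ?f = "\<lambda>y. 2 *\<^sub>R x - y"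
  have f: "?f \<in> borel_measurable borel" by (intro borel_measurable_continuous_onI continuous_intros)
  then have f': "?f \<in> measurable (hausdorff_on l L) borel" by simp
  have fA: "?f -` A \<in> sets borel" using measurable_sets[OF f A] by simp
  have sp: "space (hausdorff_on l L) = UNIV" using sets_eq_imp_space_eq[OF sets_hausdorff_on[of l L]] by simp
  have "?f ` (L \<inter> ?f -` A) = L \<inter> A"
  proof (intro equalityI subsetI)
    fix z assume "z \<in> L \<inter> A"
    then have "z = ?f (?f z)" "?f z \<in> L \<inter> ?f -` A" using plane_reflection[OF L x] by auto
    then show "z \<in> ?f ` (L \<inter> ?f -` A)" by blast
  qed (use plane_reflection[OF L x] in auto)
  moreover have "hausdorff_outer l (?f ` (L \<inter> ?f -` A)) = hausdorff_outer l (L \<inter> ?f -` A)"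
    by (intro hausdorff_outer_isometry) (simp add: dist_norm norm_minus_commute)
  ultimately show "emeasure (distr (hausdorff_on l L) borel ?f) A = emeasure (hausdorff_on l L) A"
    using plane_closed[OF L] A fA by (simp add: emeasure_distr[OF f'] sp emeasure_hausdorff_on)
qed simp

text \<open>The Hausdorff measure of a ball centred on the plane is exactly
  \<open>K * r ^ l\<close>, so the time factor has to supply the missing power of
  \<open>r\<close>.\<close>

lemma single_plane_case:
  fixes L :: "(real^'n) set" and \<nu> :: "real measure"
  assumes L: "is_plane l L" and l: "l \<ge> 1" and lf: "locally_finite_borel \<nu>" and tg: "time_growth \<psi> \<nu>"
    and pos: "\<And>r. r > 0 \<Longrightarrow> \<psi> r \<ge> 0" and prod: "\<And>r. r > 0 \<Longrightarrow> r ^ l * \<psi> r = r ^ m" and m: "m \<ge> 1"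
  shows "parabolic_regular m (hausdorff_on l L \<Otimes>\<^sub>M \<nu>) \<and> all_CZOs_bounded m (hausdorff_on l L \<Otimes>\<^sub>M \<nu>)"
proof -
  note cl = plane_closed[OF L]
  obtain K where K: "K > 0" "\<And>x r. x \<in> L \<Longrightarrow> r > 0 \<Longrightarrow> hausdorff_outer l (L \<inter> ball x r) = ennreal (K * r ^ l)"
    using hausdorff_outer_plane[OF L l] by blast
  show ?thesis
  proof (rule product_regular_CZO_bounded[OF _ cl _ hausdorff_on_reflection[OF L] K(1) K(1) _ _ lf tg _ pos prod m])
    show "emeasure (hausdorff_on l L) (- L) = 0"
      using cl by (subst emeasure_hausdorff_on) auto
    show "ennreal (K * r ^ l) \<le> emeasure (hausdorff_on l L) (ball x r)" if "x \<in> L" "r > 0" for x r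
      using cl K(2)[OF that] by (subst emeasure_hausdorff_on) auto
    show "emeasure (hausdorff_on l L) (ball x r) \<le> ennreal (K * r ^ l)" if "x \<in> L" "r > 0" for x r
      using cl K(2)[OF that] by (subst emeasure_hausdorff_on) auto
  qed auto
qed

lemma sets_measure_sum [simp]: "sets (measure_sum M) = sets borel"
  unfolding measure_sum_def by (metis sets.sets_measure_of_eq space_borel)

text \<open>Interchanging the two sums gives countable additivity, without which
  \<open>measure_of\<close> would yield the zero measure.\<close>

lemma emeasure_measure_sum:
  assumes sets: "\<And>i. sets (M i) = sets borel" and A: "A \<in> sets borel"
  shows "emeasure (measure_sum M) A = (\<integral>\<^sup>+ i. emeasure (M i) A \<partial>count_space UNIV)"
proof (rule emeasure_measure_of[OF measure_sum_def])
  show "countably_additive (sets (measure_sum M)) (\<lambda>A. \<integral>\<^sup>+ i. emeasure (M i) A \<partial>count_space UNIV)"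
    unfolding countably_additive_def
  proof (intro allI impI)
    fix B :: "nat \<Rightarrow> 'b set"
    assume B: "range B \<subseteq> sets (measure_sum M)" "disjoint_family B" "(\<Union>i. B i) \<in> sets (measure_sum M)"
    have "(\<Sum>n. \<integral>\<^sup>+ i. emeasure (M i) (B n) \<partial>count_space UNIV) = (\<integral>\<^sup>+ i. (\<Sum>n. emeasure (M i) (B n)) \<partial>count_space UNIV)"
      by (rule nn_integral_suminf[symmetric]) simp
    also have "\<dots> = (\<integral>\<^sup>+ i. emeasure (M i) (\<Union>n. B n) \<partial>count_space UNIV)"
      using B by (intro nn_integral_cong suminf_emeasure) (auto simp: sets)
    finally show "(\<Sum>n. \<integral>\<^sup>+ i. emeasure (M i) (B n) \<partial>count_space UNIV) = (\<integral>\<^sup>+ i. emeasure (M i) (\<Union>n. B n) \<partial>count_space UNIV)" .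
  qed
qed (use A in \<open>auto simp: positive_def\<close>)

text \<open>A ball of radius \<open>r\<close> centred on the stack meets about
  \<open>1 + r / norm e\<close> planes, each in mass at most of order \<open>r ^ k\<close>. The
  growth is thus \<open>r ^ k * max 1 r\<close>, and times \<open>min r (r\<^sup>2)\<close> this is
  \<open>r ^ (k + 2)\<close>.\<close>

lemma stacked_planes_case:
  fixes L :: "(real^'n) set" and \<nu> :: "real measure" and e :: "real^'n"
  assumes L: "is_plane k L" and k: "k \<ge> 1" and e: "e \<noteq> 0" and normal: "normal_to e L"
    and lf: "locally_finite_borel \<nu>" and tg: "time_growth (\<lambda>r. min r (r\<^sup>2)) \<nu>"
  defines "\<sigma> \<equiv> measure_sum (\<lambda>j::int. hausdorff_on k ((\<lambda>x. x + of_int j *\<^sub>R e) ` L))"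
  shows "parabolic_regular (k + 2) (\<sigma> \<Otimes>\<^sub>M \<nu>) \<and> all_CZOs_bounded (k + 2) (\<sigma> \<Otimes>\<^sub>M \<nu>)"
proof -
  define E where "E = norm e"
  have E0: "E > 0" using e by (simp add: E_def)
  note cl = plane_closed[OF L]
  have "L \<noteq> {}" using L by (auto simp: is_plane_def)
  then obtain a where a: "a \<in> L" by blast
  \<comment> \<open>The coordinate along \<open>e\<close> in units of the spacing; it takes the
    value \<open>j\<close> on the plane \<open>P j\<close> and so tells the planes apart.\<close>
  define h where "h x = ((x - a) \<bullet> e) / (e \<bullet> e)" for x
  have hL: "h x = 0" if "x \<in> L" for x
    using normal that a by (simp add: h_def normal_to_def inner_commute)
  have h_shift: "h (x + c *\<^sub>R e) = h x + c" for x c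
    using e by (simp add: h_def inner_add_left inner_diff_left add_divide_distrib diff_divide_distrib)
  have h_dist: "\<bar>h x - h y\<bar> * E \<le> dist x y" for x y
  proof -
    have "h x - h y = ((x - y) \<bullet> e) / (e \<bullet> e)"
      by (simp add: h_def inner_diff_left diff_divide_distrib)
    then have "\<bar>h x - h y\<bar> * E = \<bar>(x - y) \<bullet> e\<bar> / E"
      using E0 by (simp add: E_def dot_square_norm power2_eq_square)
    also have "\<dots> \<le> (norm (x - y) * E) / E"
      using E0 unfolding E_def by (intro divide_right_mono Cauchy_Schwarz_ineq2) auto
    finally show ?thesis using E0 by (simp add: dist_norm)
  qed
  define P where "P j = (\<lambda>x. x + of_int j *\<^sub>R e) ` L" for j :: int
  have P_iff: "x \<in> P j \<longleftrightarrow> x - of_int j *\<^sub>R e \<in> L" for x j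
    unfolding P_def by (auto simp: image_iff) (metis diff_add_cancel)
  have P_h: "h x = of_int j" if "x \<in> P j" for x j
    using that hL h_shift unfolding P_def by auto
  have P_shift: "x + of_int i *\<^sub>R e \<in> P (j + i)" if "x \<in> P j" for x i j
    using that by (simp add: P_iff algebra_simps)
  have P_closed: "closed (P j)" for j
    unfolding P_def using closed_translation[OF cl, of "of_int j *\<^sub>R e"] by (simp add: add.commute)
  have P_refl: "2 *\<^sub>R x - y \<in> P (2 * i - j)" if "x \<in> P i" "y \<in> P j" for x y i j
    using plane_reflection[OF L, of "x - of_int i *\<^sub>R e" "y - of_int j *\<^sub>R e"] that
    by (simp add: P_iff algebra_simps)
  define G where "G = (\<Union>j. P j)"
  have G_closed: "closed G"
  proof -
    \<comment> \<open>An infinite union of closed sets need not be closed, so \<open>G\<close> is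
      rewritten by closed conditions on continuous functions.\<close>
    have "G = {x. h x \<in> \<int>} \<inter> {x. x - h x *\<^sub>R e \<in> L}"
    proof (intro equalityI subsetI)
      fix x assume "x \<in> G"
      then obtain j where "x \<in> P j" by (auto simp: G_def)
      then show "x \<in> {x. h x \<in> \<int>} \<inter> {x. x - h x *\<^sub>R e \<in> L}" using P_h[of x j] by (auto simp: P_iff)
    next
      fix x assume "x \<in> {x. h x \<in> \<int>} \<inter> {x. x - h x *\<^sub>R e \<in> L}"
      then obtain j where "h x = of_int j" "x - h x *\<^sub>R e \<in> L" by (auto elim: Ints_cases)
      then show "x \<in> G" by (auto simp: G_def P_iff)
    qed
    moreover have ch: "continuous_on UNIV h" unfolding h_def by (intro continuous_intros) (use e in auto)
    then have "closed (h -` \<int>)" by (intro closed_vimage closed_Ints) auto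
    moreover have "closed ((\<lambda>x. x - h x *\<^sub>R e) -` L)"
      using ch by (intro closed_vimage cl continuous_intros) auto
    ultimately show ?thesis by (simp add: vimage_def closed_Int)
  qed
  obtain K where K: "K > 0" "\<And>x r. x \<in> L \<Longrightarrow> r > 0 \<Longrightarrow> hausdorff_outer k (L \<inter> ball x r) = ennreal (K * r ^ k)"
    using hausdorff_outer_plane[OF L k] by blast
  have KP: "hausdorff_outer k (P j \<inter> ball x r) = ennreal (K * r ^ k)" if x: "x \<in> P j" and r: "r > 0" for j x r
  proof -
    let ?y = "x - of_int j *\<^sub>R e"
    have "(\<lambda>z. z + of_int j *\<^sub>R e) ` (L \<inter> ball ?y r) = P j \<inter> ball x r"
      unfolding P_def by (auto simp: dist_norm algebra_simps image_iff)
    moreover have "hausdorff_outer k ((\<lambda>z. z + of_int j *\<^sub>R e) ` (L \<inter> ball ?y r)) = hausdorff_outer k (L \<inter> ball ?y r)"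
      by (intro hausdorff_outer_isometry) simp
    ultimately show ?thesis using K(2)[of ?y r] x r by (simp add: P_iff)
  qed
  have em: "emeasure \<sigma> A = (\<integral>\<^sup>+ j. hausdorff_outer k (P j \<inter> A) \<partial>count_space UNIV)" if "A \<in> sets borel" for A
    unfolding \<sigma>_def using that P_closed
    by (subst emeasure_measure_sum) (auto simp: emeasure_hausdorff_on P_def)
  have sets\<sigma>: "sets \<sigma> = sets borel" by (simp add: \<sigma>_def)
  show ?thesis
  \<comment> \<open>The constants count planes: at most \<open>2 * r / E + 1\<close> meet the ball,
    and at least 1 and at least \<open>r / (2 * E)\<close> pass so near its centre that the ball
    contains a disc of radius \<open>r / 2\<close> of each.\<close>
  proof (rule product_regular_CZO_bounded[OF sets\<sigma> G_closed, where \<phi> = "\<lambda>r. r ^ k * max 1 r"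
        and a = "K / 2 ^ k * min 1 (1 / (2 * E))" and A = "K * (2 / E + 1)"])
    have "P j \<inter> - G = {}" for j by (auto simp: G_def)
    then show "emeasure \<sigma> (- G) = 0" using G_closed by (subst em) auto
    show "K / 2 ^ k * min 1 (1 / (2 * E)) > 0" "K * (2 / E + 1) > 0" using K(1) E0 by (auto intro!: mult_pos_pos add_pos_pos)
    \<comment> \<open>The reflection in a point of \<open>P i\<close> swaps \<open>P j\<close> with
      \<open>P (2 * i - j)\<close>; it permutes the summands and so preserves their sum.\<close>
    show "distr \<sigma> borel (\<lambda>y. 2 *\<^sub>R x - y) = \<sigma>" if x: "x \<in> G" for x
    proof (rule measure_eqI)
      obtain i where i: "x \<in> P i" using x by (auto simp: G_def)
      let ?f = "\<lambda>y. 2 *\<^sub>R x - y"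
      fix A assume "A \<in> sets (distr \<sigma> borel ?f)"
      then have A: "A \<in> sets borel" by simp
      have f: "?f \<in> borel_measurable borel" by (intro borel_measurable_continuous_onI continuous_intros)
      then have f': "?f \<in> measurable \<sigma> borel" unfolding measurable_cong_sets[OF sets\<sigma> refl] .
      have fA: "?f -` A \<in> sets borel" using measurable_sets[OF f A] by simp
      have sp: "space \<sigma> = UNIV" using sets_eq_imp_space_eq[OF sets\<sigma>] by simp
      have img: "?f ` (P j \<inter> ?f -` A) = P (2 * i - j) \<inter> A" for j
      proof (intro equalityI subsetI)
        fix z assume z: "z \<in> P (2 * i - j) \<inter> A"
        then have "z = ?f (?f z)" "?f z \<in> P j \<inter> ?f -` A" using P_refl[OF i, of z "2 * i - j"] by auto
        then show "z \<in> ?f ` (P j \<inter> ?f -` A)" by blast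
      qed (use P_refl[OF i] in auto)
      have "hausdorff_outer k (P j \<inter> ?f -` A) = hausdorff_outer k (P (2 * i - j) \<inter> A)" for j
        unfolding img[symmetric] by (intro hausdorff_outer_isometry[symmetric]) (simp add: dist_norm norm_minus_commute)
      then have "emeasure \<sigma> (?f -` A) = (\<integral>\<^sup>+ j. hausdorff_outer k (P (2 * i - j) \<inter> A) \<partial>count_space UNIV)"
        by (simp add: em[OF fA])
      also have "\<dots> = (\<integral>\<^sup>+ j. hausdorff_outer k (P j \<inter> A) \<partial>count_space UNIV)"
        by (rule nn_integral_bij_count_space[where g = "\<lambda>j. 2 * i - j"])
           (rule bij_betwI[where g = "\<lambda>j. 2 * i - j"]; simp)
      finally show "emeasure (distr \<sigma> borel ?f) A = emeasure \<sigma> A"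
        by (simp add: emeasure_distr[OF f' A] sp em[OF A])
    qed (simp add: sets\<sigma>)
    fix x r assume x: "x \<in> G" and r: "(r::real) > 0"
    obtain i where i: "x \<in> P i" using x by (auto simp: G_def)
    have centre: "x + of_int (j - i) *\<^sub>R e \<in> P j" for j using P_shift[OF i, of "j - i"] by simp
    have q0: "0 \<le> \<lfloor>r / E\<rfloor>" using r E0 by simp
    show "emeasure \<sigma> (ball x r) \<le> ennreal (K * (2 / E + 1) * (r ^ k * max 1 r))"
    proof -
      let ?F = "{i - \<lfloor>r / E\<rfloor>..i + \<lfloor>r / E\<rfloor>}"
      have le: "hausdorff_outer k (P j \<inter> ball x r) \<le> ennreal (K * r ^ k) * indicator ?F j" for j
      proof (cases "j \<in> ?F")
        case True
        let ?y = "x + of_int (j - i) *\<^sub>R e"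
        \<comment> \<open>The plane is orthogonal to \<open>e\<close>, so by Pythagoras its points
          are no farther from the foot point \<open>?y\<close> than from \<open>x\<close>.\<close>
        have "P j \<inter> ball x r \<subseteq> P j \<inter> ball ?y r"
        proof
          fix z assume z: "z \<in> P j \<inter> ball x r"
          have "(z - ?y) \<bullet> e = 0"
          proof -
            have "h z - h ?y = 0" using P_h[of z j] P_h[OF centre] z by simp
            then show ?thesis using e by (simp add: h_def diff_divide_distrib[symmetric] inner_diff_left)
          qed
          then have "orthogonal (z - ?y) (of_int (j - i) *\<^sub>R e)" by (simp add: orthogonal_def)
          then have "(norm (z - x))\<^sup>2 = (norm (z - ?y))\<^sup>2 + (norm (of_int (j - i) *\<^sub>R e))\<^sup>2"
            using norm_add_Pythagorean[of "z - ?y" "of_int (j - i) *\<^sub>R e"] by simp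
          then have "(norm (z - ?y))\<^sup>2 \<le> (norm (z - x))\<^sup>2" by simp
          then have "norm (z - ?y) \<le> norm (z - x)" by (rule power2_le_imp_le) simp
          then show "z \<in> P j \<inter> ball ?y r" using z by (simp add: dist_norm norm_minus_commute)
        qed
        then have "hausdorff_outer k (P j \<inter> ball x r) \<le> hausdorff_outer k (P j \<inter> ball ?y r)"
          by (rule hausdorff_outer_mono)
        then show ?thesis using True KP[OF centre r, of j] by simp
      next
        case False
        have "P j \<inter> ball x r = {}"
        proof (rule ccontr)
          assume "P j \<inter> ball x r \<noteq> {}"
          then obtain z where z: "z \<in> P j" "dist z x < r" by (auto simp: dist_commute)
          then have "\<bar>of_int j - of_int i\<bar> * E < r" using h_dist[of z x] P_h[OF z(1)] P_h[OF i] by simp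
          then have "\<bar>of_int (j - i)\<bar> < r / E" using E0 by (simp add: field_simps)
          then have "\<bar>j - i\<bar> \<le> \<lfloor>r / E\<rfloor>" by (simp add: le_floor_iff)
          then show False using False by auto
        qed
        then show ?thesis by simp
      qed
      have "emeasure \<sigma> (ball x r) \<le> (\<integral>\<^sup>+ j. ennreal (K * r ^ k) * indicator ?F j \<partial>count_space UNIV)"
        by (subst em) (auto intro!: nn_integral_mono le)
      also have "\<dots> = ennreal (K * r ^ k) * of_nat (card ?F)"
        by (subst nn_integral_cmult_indicator) auto
      also have "\<dots> = ennreal (K * r ^ k * real (card ?F))"
        using K(1) r by (simp add: ennreal_mult' ennreal_of_nat_eq_real_of_nat)
      also have "\<dots> \<le> ennreal (K * (2 / E + 1) * (r ^ k * max 1 r))"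
      proof (rule ennreal_leI)
        have "real (card ?F) = 2 * of_int \<lfloor>r / E\<rfloor> + 1" using q0 by simp
        also have "\<dots> \<le> 2 * (r / E) + 1" using of_int_floor_le[of "r / E"] by linarith
        also have "\<dots> \<le> 2 / E * max 1 r + 1 * max 1 r"
          using E0 by (intro add_mono) (auto simp: divide_right_mono)
        finally have "real (card ?F) \<le> (2 / E + 1) * max 1 r" by (simp only: distrib_right)
        then have "K * r ^ k * real (card ?F) \<le> K * r ^ k * ((2 / E + 1) * max 1 r)"
          using K(1) r by (intro mult_left_mono) auto
        then show "K * r ^ k * real (card ?F) \<le> K * (2 / E + 1) * (r ^ k * max 1 r)" by (simp only: mult_ac)
      qed
      finally show ?thesis .
    qed
    show "ennreal (K / 2 ^ k * min 1 (1 / (2 * E)) * (r ^ k * max 1 r)) \<le> emeasure \<sigma> (ball x r)"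
    proof -
      \<comment> \<open>The planes \<open>i\<close> to \<open>i + n - 1\<close>, on one side only:
        since \<open>n - 1 < r / (2 * E)\<close>, their foot points are within \<open>r / 2\<close>
        of \<open>x\<close>. The ceiling makes \<open>n\<close> at least 1, so at small radii the
        plane through \<open>x\<close> is still counted.\<close>
      define n where "n = \<lceil>r / (2 * E)\<rceil>"
      have n: "n \<ge> 1" "r / (2 * E) \<le> of_int n" "of_int n - 1 < r / (2 * E)"
        using r E0 unfolding n_def by (auto simp: one_le_ceiling) linarith
      let ?F = "{i..i + (n - 1)}"
      have ge: "ennreal (K * (r / 2) ^ k) * indicator ?F j \<le> hausdorff_outer k (P j \<inter> ball x r)" for j
      proof (cases "j \<in> ?F")
        case True
        let ?y = "x + of_int (j - i) *\<^sub>R e"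
        have "of_int (j - i) \<le> (of_int (n - 1) :: real)" using True by (subst of_int_le_iff) simp
        then have "of_int (j - i) < r / (2 * E)" using n(3) by simp
        then have "of_int (j - i) * E < r / 2" using E0 by (simp add: field_simps)
        then have xy: "dist x ?y < r / 2" using True by (simp add: dist_norm E_def)
        have "ball ?y (r / 2) \<subseteq> ball x r"
        proof
          fix z assume "z \<in> ball ?y (r / 2)"
          then show "z \<in> ball x r" using xy dist_triangle[of x z ?y] by simp
        qed
        then have "hausdorff_outer k (P j \<inter> ball ?y (r / 2)) \<le> hausdorff_outer k (P j \<inter> ball x r)"
          by (intro hausdorff_outer_mono) auto
        then show ?thesis using True KP[OF centre, of "r / 2" j] r by simp
      qed simp
      have "ennreal (K / 2 ^ k * min 1 (1 / (2 * E)) * (r ^ k * max 1 r)) \<le> ennreal (K * (r / 2) ^ k * real (card ?F))"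
      proof (rule ennreal_leI)
        have nc: "real (card ?F) = of_int n" using n(1) by simp
        have "min 1 (1 / (2 * E)) * max 1 r \<le> of_int n"
        proof (cases "r \<le> 1")
          case True
          then have "min 1 (1 / (2 * E)) * max 1 r \<le> 1" by simp
          then show ?thesis using n(1) by linarith
        next
          case False
          then have "min 1 (1 / (2 * E)) * max 1 r \<le> 1 / (2 * E) * r" using E0 by (intro mult_mono) auto
          then show ?thesis using n(2) by simp
        qed
        then have "K * (r / 2) ^ k * (min 1 (1 / (2 * E)) * max 1 r) \<le> K * (r / 2) ^ k * real (card ?F)"
          unfolding nc using K(1) r by (intro mult_left_mono) auto
        then show "K / 2 ^ k * min 1 (1 / (2 * E)) * (r ^ k * max 1 r) \<le> K * (r / 2) ^ k * real (card ?F)"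
          by (simp only: power_divide times_divide_eq_left times_divide_eq_right mult_ac)
      qed
      also have "\<dots> = ennreal (K * (r / 2) ^ k) * of_nat (card ?F)"
        using K(1) r by (simp add: ennreal_mult' ennreal_of_nat_eq_real_of_nat)
      also have "\<dots> = (\<integral>\<^sup>+ j. ennreal (K * (r / 2) ^ k) * indicator ?F j \<partial>count_space UNIV)"
        by (subst nn_integral_cmult_indicator) auto
      also have "\<dots> \<le> emeasure \<sigma> (ball x r)"
        by (subst em) (auto intro!: nn_integral_mono ge)
      finally show ?thesis .
    qed
  next
    fix r :: real assume r: "r > 0"
    show "r ^ k * max 1 r \<ge> 0" "min r (r\<^sup>2) \<ge> 0" using r by auto
    have "max 1 r * min r (r\<^sup>2) = r\<^sup>2"
    proof (cases "r \<le> 1")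
      case True
      then have "r\<^sup>2 \<le> r" using r by (simp add: power2_eq_square mult_left_le)
      then show ?thesis using True by simp
    next
      case False
      then have "r \<le> r\<^sup>2" using r by (simp add: power2_eq_square)
      then show ?thesis using False by (simp add: power2_eq_square)
    qed
    then show "r ^ k * max 1 r * min r (r\<^sup>2) = r ^ (k + 2)" by (simp only: power_add mult.assoc)
  qed (use lf tg in auto)
qed

text \<open>The complement of 0 is an open null set, so 0 is the only centre to be tested, and every
  interval about it has mass 1.\<close>

lemma time_growth_dirac: "time_growth (\<lambda>r. 1) (return borel (0 :: real))"
  unfolding time_growth_def
proof (intro exI[of _ 1] conjI ballI allI impI)
  fix t r :: real assume t: "t \<in> msupport (return borel 0)" and r: "r > 0"
  have "t = 0"
  proof (rule ccontr)
    assume "t \<noteq> 0"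
    then have "emeasure (return borel (0::real)) (- {0}) > 0"
      using t by (auto simp: msupport_def)
    then show False by (simp add: emeasure_return)
  qed
  then show "ennreal (1 / 1) \<le> emeasure (return borel 0) {t - r\<^sup>2<..<t + r\<^sup>2}"
    "emeasure (return borel 0) {t - r\<^sup>2<..<t + r\<^sup>2} \<le> ennreal (1 * 1)"
    using r by (auto simp: emeasure_return)
qed simp

theorem theorem7p1:
  fixes k :: nat
  assumes "CARD('n::finite) \<ge> 2" and "1 \<le> k" and "k \<le> CARD('n) - 1"
  shows
    "(\<forall>(\<nu> :: real measure) (L :: (real^'n) set).
        locally_finite_borel \<nu> \<and> time_growth (\<lambda>r. r) \<nu> \<and> is_plane (k + 1) L \<longrightarrow>
        (let \<mu> = hausdorff_on (k + 1) L \<Otimes>\<^sub>M \<nu>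
         in parabolic_regular (k + 2) \<mu> \<and> all_CZOs_bounded (k + 2) \<mu>)) \<and>
     (\<forall>(\<nu> :: real measure) (L :: (real^'n) set) (e :: real^'n).
        locally_finite_borel \<nu> \<and> time_growth (\<lambda>r. min r (r\<^sup>2)) \<nu> \<and>
        is_plane k L \<and> e \<noteq> 0 \<and> normal_to e L \<longrightarrow>
        (let \<mu> = measure_sum (\<lambda>j::int. hausdorff_on k ((\<lambda>x. x + of_int j *\<^sub>R e) ` L)) \<Otimes>\<^sub>M \<nu>
         in parabolic_regular (k + 2) \<mu> \<and> all_CZOs_bounded (k + 2) \<mu>)) \<and>
     (\<forall>L :: (real^'n) set.
        k + 2 \<le> CARD('n) \<and> is_plane (k + 2) L \<longrightarrow>
        (let \<mu> = hausdorff_on (k + 2) L \<Otimes>\<^sub>M return borel (0 :: real)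
         in parabolic_regular (k + 2) \<mu> \<and> all_CZOs_bounded (k + 2) \<mu>))"
proof (intro conjI allI impI; elim conjE; unfold Let_def)
  fix \<nu> :: "real measure" and L :: "(real^'n) set"
  assume "locally_finite_borel \<nu>" "time_growth (\<lambda>r. r) \<nu>" "is_plane (k + 1) L"
  then show "parabolic_regular (k + 2) (hausdorff_on (k + 1) L \<Otimes>\<^sub>M \<nu>) \<and>
      all_CZOs_bounded (k + 2) (hausdorff_on (k + 1) L \<Otimes>\<^sub>M \<nu>)"
    by (intro single_plane_case[where \<psi> = "\<lambda>r. r"]) auto
next
  fix \<nu> :: "real measure" and L :: "(real^'n) set" and e :: "real^'n"
  assume "locally_finite_borel \<nu>" "time_growth (\<lambda>r. min r (r\<^sup>2)) \<nu>" "is_plane k L" "e \<noteq> 0" "normal_to e L"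
  then show "parabolic_regular (k + 2) (measure_sum (\<lambda>j::int. hausdorff_on k ((\<lambda>x. x + of_int j *\<^sub>R e) ` L)) \<Otimes>\<^sub>M \<nu>) \<and>
      all_CZOs_bounded (k + 2) (measure_sum (\<lambda>j::int. hausdorff_on k ((\<lambda>x. x + of_int j *\<^sub>R e) ` L)) \<Otimes>\<^sub>M \<nu>)"
    using assms(2) by (intro stacked_planes_case)
next
  fix L :: "(real^'n) set"
  assume "is_plane (k + 2) L"
  moreover have "locally_finite_borel (return borel (0 :: real))"
    unfolding locally_finite_borel_def
    by (auto intro!: exI[of _ UNIV] simp: emeasure_return)
  \<comment> \<open>Time contributes no growth here, so the plane alone supplies the dimension
    \<open>k + 2\<close>.\<close>
  ultimately show "parabolic_regular (k + 2) (hausdorff_on (k + 2) L \<Otimes>\<^sub>M return borel (0 :: real)) \<and>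
      all_CZOs_bounded (k + 2) (hausdorff_on (k + 2) L \<Otimes>\<^sub>M return borel (0 :: real))"
    by (intro single_plane_case[OF _ _ _ time_growth_dirac]) auto
qed

end
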